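(* Let $n\ge 2$. Up to a constant multiple there is exactly one nonzero linear CR invariant differential operator $\mathcal{E}\to\mathcal{E}(-n)$, i.e. a linear differential operator $\mathcal{E}\to\mathcal{E}(-n)$ commuting with the action of $G=SU(1,n)$.
   Context: Let $n\ge2$, $m=2n-1$. On $\mathbb{C}^{n+1}$ with coordinates $\zeta=(\zeta_0,\dots,\zeta_n)$ put $L(\zeta)=|\zeta_0|^2-|\zeta_1|^2-\cdots-|\zeta_n|^2$, and let $G=SU(1,n)$ be the group of complex linear maps of determinant one preserving $L$. Let $\mathcal{N}=\{\zeta\in\mathbb{C}^{n+1}\setminus\{0\}: L(\zeta)=0\}$, a $\mathbb{C}^*$-bundle over the sphere $S^m=\partial\{z\in\mathbb{C}^n:|z|<1\}$ via $\zeta\mapsto z=(\zeta_1/\zeta_0,\dots,\zeta_n/\zeta_0)$. For $p\in\mathbb{Z}$, $\mathcal{E}(p)=\{f\in C^\infty(\mathcal{N},\mathbb{R}): f(\lambda\zeta)=|\lambda|^{2p}f(\zeta)\ \forall\lambda\in\mathbb{C}^*\}$, with $G$ acting by $(g\cdot f)(\zeta)=f(g^{-1}\zeta)$; $\mathcal{E}=\mathcal{E}(0)$ is identified with $C^\infty(S^m,\mathbb{R})$ via $f\mapsto f(1,z)$ (and $\mathcal{E}(-n)$ with volume forms on $S^m$). A "CR invariant" operator means a $G$-equivariant one. *)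

theory Defs
  imports "HOL-Analysis.Analysis"
begin

fun Ck :: "nat \<Rightarrow> ('a::euclidean_space \<Rightarrow> real) \<Rightarrow> bool" where
  "Ck 0 f = continuous_on UNIV f"
| "Ck (Suc k) f = (continuous_on UNIV f \<and> f differentiable_on UNIV \<and>
      (\<forall>v\<in>Basis. Ck k (\<lambda>x. frechet_derivative f (at x) v)))"

definition smooth :: "('a::euclidean_space \<Rightarrow> real) \<Rightarrow> bool" where
  "smooth f \<longleftrightarrow> (\<forall>k. Ck k f)"

fun dd :: "'a::euclidean_space list \<Rightarrow> ('a \<Rightarrow> real) \<Rightarrow> ('a \<Rightarrow> real)" where
  "dd [] F = F"
| "dd (v # vs) F = (\<lambda>x. frechet_derivative (dd vs F) (at x) v)"

definition sphereS :: "(complex ^ 'n::finite) set" where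
  "sphereS = {z. norm z = 1}"

definition smoothS :: "(complex ^ 'n::finite \<Rightarrow> real) \<Rightarrow> bool" where
  "smoothS f \<longleftrightarrow> (\<exists>F. smooth F \<and> (\<forall>z\<in>sphereS. f z = F z))"

text \<open>linear differential operators on the sphere (scalar, acting on functions on S^m):
  D is induced by an ambient differential operator with smooth coefficients,
  applied to any smooth extension, and D f on the sphere only depends on f on the sphere.\<close>
definition diffopS :: "((complex ^ 'n::finite \<Rightarrow> real) \<Rightarrow> (complex ^ 'n \<Rightarrow> real)) \<Rightarrow> bool" where
  "diffopS D \<longleftrightarrow>
     (\<exists>ts :: ((complex ^ 'n \<Rightarrow> real) \<times> (complex ^ 'n) list) list.
        (\<forall>(a, vs) \<in> set ts. smooth a \<and> set vs \<subseteq> Basis) \<and>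
        (\<forall>F. smooth F \<longrightarrow> (\<forall>z\<in>sphereS. D F z = (\<Sum>(a, vs) \<leftarrow> ts. a z * dd vs F z)))) \<and>
     (\<forall>f F. smooth F \<and> (\<forall>z\<in>sphereS. f z = F z) \<longrightarrow> (\<forall>z\<in>sphereS. D f z = D F z))"

section \<open>The group G = SU(1,n) acting on C^(n+1); coordinate None is zeta_0\<close>

definition Lform :: "complex ^ ('n::finite option) \<Rightarrow> real" where
  "Lform \<zeta> = (cmod (\<zeta> $ None))\<^sup>2 - (\<Sum>i\<in>UNIV. (cmod (\<zeta> $ Some i))\<^sup>2)"

definition SU1n :: "(complex ^ ('n::finite option) ^ ('n option)) set" where
  "SU1n = {A. det A = 1 \<and> (\<forall>\<zeta>. Lform (A *v \<zeta>) = Lform \<zeta>)}"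

definition lift1 :: "complex ^ 'n::finite \<Rightarrow> complex ^ ('n::finite option)" where
  "lift1 z = (\<chi> k. case k of None \<Rightarrow> 1 | Some i \<Rightarrow> z $ i)"

text \<open>Under the identification E(p) = C^\<infinity>(S^m), f \<mapsto> f(1,z), the element of E(p)
  corresponding to f is  zeta \<mapsto> |zeta_0|^(2p) f(zeta'/zeta_0).\<close>
definition homog_ext :: "int \<Rightarrow> (complex ^ 'n::finite \<Rightarrow> real) \<Rightarrow> complex ^ ('n::finite option) \<Rightarrow> real" where
  "homog_ext p f \<zeta> = ((cmod (\<zeta> $ None))\<^sup>2) powi p * f (\<chi> i. \<zeta> $ Some i / \<zeta> $ None)"

text \<open>the action (g.f)(zeta) = f(g^-1 zeta) on E(p), transported to functions on S^m\<close>
definition actE :: "int \<Rightarrow> complex ^ ('n::finite option) ^ ('n option) \<Rightarrow> (complex ^ 'n \<Rightarrow> real) \<Rightarrow> (complex ^ 'n \<Rightarrow> real)" where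
  "actE p g f = (\<lambda>z. homog_ext p f (matrix_inv g *v lift1 z))"

definition CR_invariant_op :: "((complex ^ 'n::finite \<Rightarrow> real) \<Rightarrow> (complex ^ 'n \<Rightarrow> real)) \<Rightarrow> bool" where
  "CR_invariant_op D \<longleftrightarrow> diffopS D \<and>
     (\<forall>g\<in>SU1n. \<forall>f. smoothS f \<longrightarrow>
        (\<forall>z\<in>sphereS. D (actE 0 g f) z = actE (- int CARD('n)) g (D f) z))"

end

theory Submission
  imports Defs
begin

text \<open>Existence. Extend \<open>f\<close> to a function homogeneous of degree 0 near the cone and apply the \<open>n\<close>-th power of
  the ambient Laplacian of \<open>L\<close>. It commutes with \<open>SU(1,n)\<close>, and because degree 0 is critical for the \<open>n\<close>-th
  power, the result on the cone depends only on \<open>f\<close> there. In affine coordinates the operator is a product of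
  \<open>n\<close> second order operators, each multiplying \<open>Re (z\<^sub>i * cnj z\<^sub>j)\<close>, \<open>i \<noteq> j\<close>, by a nonzero constant.

  Uniqueness. By transitivity an invariant operator is determined by the functional \<open>ev F = (D F)(e)\<close>, which
  has finite order. With \<open>u = 1 - z\<^sub>1\<close> and \<open>\<gamma> a b = ev (u^a * cnj u^b)\<close>, dilations and central translations of
  the stabilizer of \<open>e\<close> give \<open>a * \<gamma> (a+1) b = (a + b - n) * \<gamma> a b = b * \<gamma> a (b+1)\<close>, so for \<open>n \<ge> 2\<close> all \<open>\<gamma> a b\<close> are
  determined by \<open>\<gamma> 1 1\<close>. Invariance under \<open>U(n-1)\<close> and polarization reduce every polynomial to these, and
  finite order reduces smooth functions to Taylor polynomials.\<close>

section \<open>Smooth functions on open sets\<close>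

text \<open>Nothing is known of an invariant operator but its values, so no symbol calculus is used;
  finite order serves as nilpotency instead. The functional \<open>ev\<close> kills every function
  vanishing to order \<open>M\<close> at \<open>e\<close>, and the maps used from the stabilizer act
  on \<open>u\<close> by \<open>c * u / (1 + q * u)\<close>, whose geometric expansion gains a power
  of \<open>u\<close> at each step. So the group parameter can be differentiated by descending
  induction on the degree, without exchanging \<open>D\<close> with a limit.

  The factor \<open>a + b - n\<close> is a difference of weights: the dilation by \<open>r\<close>
  scales \<open>u^a * cnj u^b\<close> by \<open>r^(-2 * (a + b))\<close>, and the weight of the
  target contributes \<open>r^(-2 * n)\<close>. \<open>\<gamma> 1 1\<close> stays free because the
  relations starting from \<open>\<gamma> 0 1\<close> and \<open>\<gamma> 1 0\<close> carry the
  factor 0 in front of it. That it is nonzero for the constructed operator is not computed: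
  otherwise the uniqueness argument would make the operator zero.

  Fractional linear maps have poles off the sphere, so a transformed function extends to the whole
  space only after a change off the sphere; independence of the extension is therefore proved on
  open sets \<open>W\<close>.\<close>

definition dv :: "'a::real_normed_vector \<Rightarrow> ('a \<Rightarrow> 'b::real_normed_vector) \<Rightarrow> 'a \<Rightarrow> 'b" where
  "dv v f = (\<lambda>x. frechet_derivative f (at x) v)"

text \<open>A version of \<open>Ck\<close> localised to a set and with vector values, since
  homogeneous extensions live only on a cone and powers of \<open>u\<close> are complex valued.
  Derivatives are taken in the whole space, so the notion is meant for open sets.\<close>

fun ck :: "nat \<Rightarrow> 'a::euclidean_space set \<Rightarrow> ('a \<Rightarrow> 'b::real_normed_vector) \<Rightarrow> bool" where
  "ck 0 S f = continuous_on S f"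
| "ck (Suc k) S f = (continuous_on S f \<and> (\<forall>x\<in>S. f differentiable at x) \<and> (\<forall>v\<in>Basis. ck k S (dv v f)))"

definition sm :: "'a::euclidean_space set \<Rightarrow> ('a \<Rightarrow> 'b::real_normed_vector) \<Rightarrow> bool" where
  "sm S f \<longleftrightarrow> open S \<and> (\<forall>k. ck k S f)"

lemma Ck_eq_ck: "Ck k f = ck k UNIV f"
  by (induction k arbitrary: f) (auto simp: dv_def differentiable_on_def)

lemma smooth_eq_sm: "smooth f = sm UNIV f"
  by (simp add: smooth_def sm_def Ck_eq_ck)

lemma dv_eqI: "(f has_derivative f') (at x) \<Longrightarrow> dv v f x = f' v"
  using frechet_derivative_at[of f f' x] by (simp add: dv_def)

lemma dv_works: "f differentiable at x \<Longrightarrow> (f has_derivative (\<lambda>v. dv v f x)) (at x)"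
  by (simp add: dv_def frechet_derivative_works)

text \<open>This also covers points where the functions are not differentiable:
  \<open>frechet_derivative\<close> is a choice among the derivatives at \<open>x\<close>, and
  functions agreeing near \<open>x\<close> have the same ones.\<close>

lemma dv_cong:
  assumes "open S" "x \<in> S" "\<And>y. y \<in> S \<Longrightarrow> f y = g y"
  shows "dv v f x = dv v g x"
proof (cases "f differentiable at x")
  case True
  then have "(f has_derivative (\<lambda>v. dv v f x)) (at x)" by (rule dv_works)
  then have "(g has_derivative (\<lambda>v. dv v f x)) (at x)"
    using assms has_derivative_transform_within_open by blast
  then show ?thesis by (simp add: dv_eqI)
next
  case False
  have "(f has_derivative D) (at x) = (g has_derivative D) (at x)" for D
    using assms has_derivative_transform_within_open[of f D x UNIV S g] has_derivative_transform_within_open[of g D x UNIV S f]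
    by auto
  then show ?thesis by (simp add: dv_def frechet_derivative_def)
qed

lemma differentiable_cong_open:
  assumes "open S" "x \<in> S" "\<And>y. y \<in> S \<Longrightarrow> f y = g y" "f differentiable at x"
  shows "g differentiable at x"
  using assms has_derivative_transform_within_open unfolding differentiable_def by blast

lemma ck_cong:
  assumes "open S" "\<And>x. x \<in> S \<Longrightarrow> f x = g x" "ck k S f"
  shows "ck k S g"
  using assms(2,3)
proof (induction k arbitrary: f g)
  case 0
  then show ?case by (simp cong: continuous_on_cong)
next
  case (Suc k)
  have "ck k S (dv v g)" if "v \<in> Basis" for v
    using Suc.IH[of "dv v f" "dv v g"] Suc.prems that dv_cong[OF assms(1), of _ f g v] by auto
  then show ?case
    using Suc.prems differentiable_cong_open[OF assms(1), of _ f g] by (simp cong: continuous_on_cong)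
qed

lemma ck_SucD: "ck (Suc k) S f \<Longrightarrow> ck k S f"
proof (induction k arbitrary: f)
  case 0
  then show ?case by simp
next
  case (Suc k)
  note u = iffD1[OF ck.simps(2)[of "Suc k" S f] Suc.prems]
  have "ck k S (dv v f)" if "v \<in> Basis" for v
    by (rule Suc.IH[OF bspec[OF u[THEN conjunct2, THEN conjunct2] that]])
  with u show ?case by (simp del: ck.simps add: ck.simps(2)[of k S f])
qed

lemma ck_subset: "T \<subseteq> S \<Longrightarrow> ck k S f \<Longrightarrow> ck k T f"
  by (induction k arbitrary: f) (auto intro: continuous_on_subset)

lemma ck_const: "ck k S (\<lambda>x. c)"
  by (induction k arbitrary: c) (auto simp: dv_def)

lemma dv_linear_compose:
  assumes "bounded_linear h" "f differentiable at x"
  shows "dv v (\<lambda>x. h (f x)) x = h (dv v f x)"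
  by (rule dv_eqI) (intro bounded_linear.has_derivative[OF assms(1)] dv_works assms(2))

lemma ck_linear_compose:
  assumes h: "bounded_linear h" and S: "open S" and "ck k S f"
  shows "ck k S (\<lambda>x. h (f x))"
  using assms(3)
proof (induction k arbitrary: f)
  case 0
  then show ?case by (simp add: bounded_linear.continuous_on[OF h])
next
  case (Suc k)
  have "ck k S (dv v (\<lambda>x. h (f x)))" if "v \<in> Basis" for v
    by (rule ck_cong[OF S _ Suc.IH[of "dv v f"]]) (use Suc.prems that in \<open>auto simp: dv_linear_compose[OF h]\<close>)
  moreover have "(\<lambda>x. h (f x)) differentiable at x" if "x \<in> S" for x
    using bounded_linear.has_derivative[OF h dv_works[of f x]] Suc.prems that by (auto simp: differentiable_def)
  ultimately show ?case using Suc.prems by (simp add: bounded_linear.continuous_on[OF h])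
qed

lemma dv_add:
  assumes "f differentiable at x" "g differentiable at x"
  shows "dv v (\<lambda>x. f x + g x) x = dv v f x + dv v g x"
  by (rule dv_eqI) (intro has_derivative_add dv_works assms)

lemma ck_add:
  assumes S: "open S" and "ck k S f" "ck k S g"
  shows "ck k S (\<lambda>x. f x + g x)"
  using assms(2,3)
proof (induction k arbitrary: f g)
  case 0
  then show ?case by (simp add: continuous_on_add)
next
  case (Suc k)
  have "ck k S (dv v (\<lambda>x. f x + g x))" if "v \<in> Basis" for v
    by (rule ck_cong[OF S _ Suc.IH[of "dv v f" "dv v g"]]) (use Suc.prems that in \<open>auto simp: dv_add\<close>)
  then show ?case using Suc.prems by (simp add: continuous_on_add)
qed

lemma dv_bilinear:
  assumes "bounded_bilinear m" "f differentiable at x" "g differentiable at x"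
  shows "dv v (\<lambda>x. m (f x) (g x)) x = m (f x) (dv v g x) + m (dv v f x) (g x)"
  by (rule dv_eqI) (intro bounded_bilinear.FDERIV[OF assms(1)] dv_works assms)

lemma ck_bilinear:
  assumes p: "bounded_bilinear m" and S: "open S" and "ck k S f" "ck k S g"
  shows "ck k S (\<lambda>x. m (f x) (g x))"
  using assms(3,4)
proof (induction k arbitrary: f g)
  case 0
  then show ?case by (simp add: bounded_bilinear.continuous_on[OF p])
next
  case (Suc k)
  have fg: "ck k S f" "ck k S g" using ck_SucD[OF Suc.prems(1)] ck_SucD[OF Suc.prems(2)] .
  have "ck k S (dv v (\<lambda>x. m (f x) (g x)))" if "v \<in> Basis" for v
    by (rule ck_cong[OF S _ ck_add[OF S Suc.IH[of f "dv v g"] Suc.IH[of "dv v f" g]]])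
       (use Suc.prems that fg in \<open>auto simp: dv_bilinear[OF p]\<close>)
  moreover have "(\<lambda>x. m (f x) (g x)) differentiable at x" if "x \<in> S" for x
    using bounded_bilinear.FDERIV[OF p dv_works[of f x] dv_works[of g x]] Suc.prems that by (auto simp: differentiable_def)
  ultimately show ?case using Suc.prems by (simp add: bounded_bilinear.continuous_on[OF p])
qed

lemma ck_sum:
  assumes "open S" "finite A" "\<And>a. a \<in> A \<Longrightarrow> ck k S (f a)"
  shows "ck k S (\<lambda>x. \<Sum>a\<in>A. f a x)"
  using assms(2,3) by (induction A rule: finite_induct) (auto simp: ck_const intro: ck_add[OF assms(1)])

lemma dv_sum_Basis:
  fixes v :: "'a::euclidean_space"
  assumes "f differentiable at x"
  shows "dv v f x = (\<Sum>b\<in>Basis. (v \<bullet> b) *\<^sub>R dv b f x)"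
proof -
  interpret linear "\<lambda>v. dv v f x"
    using dv_works[OF assms] has_derivative_linear by blast
  have "dv v f x = dv (\<Sum>b\<in>Basis. (v \<bullet> b) *\<^sub>R b) f x" by (simp add: euclidean_representation)
  also have "\<dots> = (\<Sum>b\<in>Basis. (v \<bullet> b) *\<^sub>R dv b f x)" by (simp add: sum scale)
  finally show ?thesis .
qed

lemma dv_compose:
  fixes g :: "'a::euclidean_space \<Rightarrow> 'b::euclidean_space"
  assumes "g differentiable at x" "f differentiable at (g x)"
  shows "dv v (\<lambda>x. f (g x)) x = dv (dv v g x) f (g x)"
  by (rule dv_eqI) (use diff_chain_at[OF dv_works[OF assms(1)] dv_works[OF assms(2)]] in \<open>simp add: o_def\<close>)

text \<open>The induction generalises over \<open>f\<close> and keeps \<open>g\<close> fixed: by the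
  chain rule the derivative of the composite is a sum of products of components of
  \<open>dv v g\<close> with partial derivatives of \<open>f\<close> composed with
  \<open>g\<close>.\<close>

lemma ck_compose:
  fixes g :: "'a::euclidean_space \<Rightarrow> 'b::euclidean_space" and f :: "'b \<Rightarrow> 'c::real_normed_vector"
  assumes S: "open S" and g: "\<And>x. x \<in> S \<Longrightarrow> g x \<in> T" and "ck k T f" "ck k S g"
  shows "ck k S (\<lambda>x. f (g x))"
  using assms(3,4)
proof (induction k arbitrary: f)
  case 0
  then show ?case using g continuous_on_compose2 by (metis ck.simps(1) image_subsetI)
next
  case (Suc k)
  have gk: "ck k S g" by (rule ck_SucD[OF Suc.prems(2)])
  have d: "f differentiable at (g x)" "g differentiable at x" if "x \<in> S" for x
    using Suc.prems g that by auto
  have "ck k S (dv v (\<lambda>x. f (g x)))" if v: "v \<in> Basis" for v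
  proof (rule ck_cong[OF S, of "\<lambda>x. \<Sum>b\<in>Basis. (dv v g x \<bullet> b) *\<^sub>R dv b f (g x)"])
    show "ck k S (\<lambda>x. \<Sum>b\<in>Basis. (dv v g x \<bullet> b) *\<^sub>R dv b f (g x))"
      using Suc.prems v gk
      by (intro ck_sum[OF S] ck_bilinear[OF bounded_bilinear_scaleR S]
                ck_linear_compose[OF bounded_linear_inner_left S] Suc.IH) auto
    show "(\<Sum>b\<in>Basis. (dv v g x \<bullet> b) *\<^sub>R dv b f (g x)) = dv v (\<lambda>x. f (g x)) x" if "x \<in> S" for x
      unfolding dv_compose[OF d(2)[OF that] d(1)[OF that]] by (rule dv_sum_Basis[OF d(1)[OF that], symmetric])
  qed
  moreover have "(\<lambda>x. f (g x)) differentiable at x" if "x \<in> S" for x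
    using differentiable_chain_at[OF d(2) d(1)] that by (simp add: o_def)
  moreover have "continuous_on S (\<lambda>x. f (g x))"
    using Suc.prems g continuous_on_compose2[of T f S g] by auto
  ultimately show ?case by simp
qed

section \<open>Closure rules for infinitely differentiable functions\<close>

lemma sm_open: "sm S f \<Longrightarrow> open S"
  by (simp add: sm_def)

lemma sm_differentiable: "sm S f \<Longrightarrow> x \<in> S \<Longrightarrow> f differentiable at x"
  unfolding sm_def using ck.simps(2) by blast

lemma sm_continuous_on: "sm S f \<Longrightarrow> continuous_on S f"
  unfolding sm_def using ck.simps(1) by blast

lemma sm_dv_Basis: "sm S f \<Longrightarrow> v \<in> Basis \<Longrightarrow> sm S (dv v f)"
  unfolding sm_def using ck.simps(2) by blast

lemma smI:
  assumes "open S" "\<And>x. x \<in> S \<Longrightarrow> f differentiable at x" "\<And>v. v \<in> Basis \<Longrightarrow> sm S (dv v f)"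
  shows "sm S f"
proof -
  have "continuous_on S f"
    using assms(2) differentiable_imp_continuous_within by (blast intro: continuous_at_imp_continuous_on)
  then have "ck k S f" for k
    using assms(2,3) unfolding sm_def by (cases k) auto
  with assms(1) show ?thesis by (simp add: sm_def)
qed

lemma sm_cong: "sm S f \<Longrightarrow> (\<And>x. x \<in> S \<Longrightarrow> f x = g x) \<Longrightarrow> sm S g"
  unfolding sm_def using ck_cong by blast

lemma sm_subset: "sm S f \<Longrightarrow> open T \<Longrightarrow> T \<subseteq> S \<Longrightarrow> sm T f"
  unfolding sm_def using ck_subset by blast

lemma sm_const: "open S \<Longrightarrow> sm S (\<lambda>x. c)"
  by (simp add: sm_def ck_const)

lemma sm_linear_compose: "bounded_linear h \<Longrightarrow> sm S f \<Longrightarrow> sm S (\<lambda>x. h (f x))"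
  unfolding sm_def using ck_linear_compose by blast

lemma sm_add: "sm S f \<Longrightarrow> sm S g \<Longrightarrow> sm S (\<lambda>x. f x + g x)"
  unfolding sm_def using ck_add by blast

lemma sm_bilinear: "bounded_bilinear m \<Longrightarrow> sm S f \<Longrightarrow> sm S g \<Longrightarrow> sm S (\<lambda>x. m (f x) (g x))"
  unfolding sm_def using ck_bilinear by blast

lemma sm_mult:
  fixes f g :: "'a::euclidean_space \<Rightarrow> 'b::real_normed_algebra"
  shows "sm S f \<Longrightarrow> sm S g \<Longrightarrow> sm S (\<lambda>x. f x * g x)"
  by (rule sm_bilinear[OF bounded_bilinear_mult])

lemma sm_scaleR: "sm S f \<Longrightarrow> sm S g \<Longrightarrow> sm S (\<lambda>x. f x *\<^sub>R g x)"
  by (rule sm_bilinear[OF bounded_bilinear_scaleR])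

lemma sm_uminus: "sm S f \<Longrightarrow> sm S (\<lambda>x. - f x)"
  by (rule sm_linear_compose[OF bounded_linear_minus[OF bounded_linear_ident]])

lemma sm_diff: "sm S f \<Longrightarrow> sm S g \<Longrightarrow> sm S (\<lambda>x. f x - g x)"
  using sm_add[of S f "\<lambda>x. - g x"] sm_uminus[of S g] by simp

lemma sm_sum: "open S \<Longrightarrow> (\<And>a. a \<in> A \<Longrightarrow> sm S (f a)) \<Longrightarrow> sm S (\<lambda>x. \<Sum>a\<in>A. f a x)"
  by (induction A rule: infinite_finite_induct) (simp_all add: sm_const sm_add)

lemma sm_power:
  fixes f :: "'a::euclidean_space \<Rightarrow> 'b::real_normed_algebra_1"
  shows "sm S f \<Longrightarrow> sm S (\<lambda>x. f x ^ k)"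
  by (induction k) (simp_all add: sm_open sm_const sm_mult)

lemma sm_compose:
  fixes g :: "'a::euclidean_space \<Rightarrow> 'b::euclidean_space"
  shows "sm T f \<Longrightarrow> sm S g \<Longrightarrow> (\<And>x. x \<in> S \<Longrightarrow> g x \<in> T) \<Longrightarrow> sm S (\<lambda>x. f (g x))"
  unfolding sm_def by (simp add: ck_compose[of S g T _ f])

lemma sm_bounded_linear:
  assumes "bounded_linear h" "open S"
  shows "sm S h"
proof (rule smI)
  show "h differentiable at x" for x
    by (simp add: assms(1) bounded_linear_imp_differentiable)
  have "dv v h = (\<lambda>x. h v)" for v
    by (rule ext, rule dv_eqI, rule bounded_linear_imp_has_derivative[OF assms(1)])
  then show "sm S (dv v h)" for v using assms(2) by (simp add: sm_const)
qed (rule assms(2))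

lemma sm_ident: "open S \<Longrightarrow> sm S (\<lambda>x. x)"
  by (rule sm_bounded_linear[OF bounded_linear_ident])

lemma sm_dv:
  assumes "sm S f"
  shows "sm S (dv v f)"
proof (rule sm_cong[of S "\<lambda>x. \<Sum>b\<in>Basis. (v \<bullet> b) *\<^sub>R dv b f x"])
  have o: "open S" by (rule sm_open[OF assms])
  show "sm S (\<lambda>x. \<Sum>b\<in>Basis. (v \<bullet> b) *\<^sub>R dv b f x)"
    by (rule sm_sum[OF o], rule sm_scaleR[OF sm_const[OF o]], rule sm_dv_Basis[OF assms])
  show "(\<Sum>b\<in>Basis. (v \<bullet> b) *\<^sub>R dv b f x) = dv v f x" if "x \<in> S" for x
    by (rule dv_sum_Basis[OF sm_differentiable[OF assms that], symmetric])
qed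

text \<open>The derivative of the inverse is a polynomial in the inverse itself, so each order of
  differentiability follows from the previous one.\<close>

lemma sm_real_inverse: "sm (- {0}) (inverse :: real \<Rightarrow> real)"
proof -
  have o: "open (- {0::real})" by auto
  have d: "dv v inverse x = - ((inverse x * v) * inverse x)" "inverse differentiable at x"
    if "x \<noteq> 0" for x v :: real
    by (rule dv_eqI[OF has_derivative_inverse'[OF that]]) (use has_derivative_inverse'[OF that, of UNIV] differentiable_def in blast)
  have "ck k (- {0}) (inverse :: real \<Rightarrow> real)" for k
  proof (induction k)
    case 0
    show ?case by (simp add: continuous_on_inverse)
  next
    case (Suc k)
    have "ck k (- {0}) (dv v inverse)" for v :: real
    proof (rule ck_cong[OF o])
      show "ck k (- {0}) (\<lambda>x. - ((inverse x * v) * inverse x))"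
        by (intro ck_linear_compose[OF bounded_linear_minus[OF bounded_linear_ident] o]
              ck_bilinear[OF bounded_bilinear_mult o] Suc.IH ck_const)
    qed (use d(1) in simp)
    then show ?case using d(2) by (simp add: continuous_on_inverse)
  qed
  then show ?thesis by (simp add: sm_def o)
qed

lemma sm_inverse_real:
  fixes f :: "'a::euclidean_space \<Rightarrow> real"
  assumes "sm S f" "\<And>x. x \<in> S \<Longrightarrow> f x \<noteq> 0"
  shows "sm S (\<lambda>x. inverse (f x))"
  by (rule sm_compose[OF sm_real_inverse assms(1)]) (use assms(2) in auto)

lemma sm_powi:
  fixes f :: "'a::euclidean_space \<Rightarrow> real"
  assumes "sm S f" "\<And>x. x \<in> S \<Longrightarrow> f x \<noteq> 0"
  shows "sm S (\<lambda>x. f x powi p)"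
  using assms(1) sm_inverse_real[OF assms] by (cases "p \<ge> 0") (simp_all add: power_int_def sm_power)

lemmas sm_cnj = sm_linear_compose[OF bounded_linear_cnj]
lemmas sm_Re = sm_linear_compose[OF bounded_linear_Re]
lemmas sm_Im = sm_linear_compose[OF bounded_linear_Im]
lemmas sm_of_real = sm_linear_compose[OF bounded_linear_of_real]

lemma sm_norm_sq:
  fixes f :: "'a::euclidean_space \<Rightarrow> 'b::real_inner"
  assumes "sm S f"
  shows "sm S (\<lambda>x. (norm (f x))\<^sup>2)"
  unfolding power2_norm_eq_inner by (rule sm_bilinear[OF bounded_bilinear_inner assms assms])

section \<open>Linearity in the direction and symmetry of second derivatives\<close>

lemma sm_has_derivative: "sm S f \<Longrightarrow> x \<in> S \<Longrightarrow> (f has_derivative (\<lambda>v. dv v f x)) (at x)"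
  by (intro dv_works sm_differentiable)

lemma linear_dv: "f differentiable at x \<Longrightarrow> linear (\<lambda>v. dv v f x)"
  by (rule has_derivative_linear[OF dv_works])

lemma dv_add_dir: "f differentiable at x \<Longrightarrow> dv (v + w) f x = dv v f x + dv w f x"
  by (rule linear_add[OF linear_dv])

lemma dv_scaleR_dir: "f differentiable at x \<Longrightarrow> dv (c *\<^sub>R v) f x = c *\<^sub>R dv v f x"
  by (rule linear_cmul[OF linear_dv])

lemma dv_minus_dir: "f differentiable at x \<Longrightarrow> dv (- v) f x = - dv v f x"
  using dv_scaleR_dir[of f x "-1" v] by simp

lemma dv_zero_dir: "f differentiable at x \<Longrightarrow> dv 0 f x = 0"
  using dv_scaleR_dir[of f x 0 0] by simp

text \<open>The mean value theorem is applied twice: along \<open>v\<close> to the increment of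
  \<open>f\<close> in direction \<open>w\<close>, then along \<open>w\<close> to
  \<open>dv v f\<close>.\<close>

lemma second_difference_mvt:
  fixes f :: "'a::euclidean_space \<Rightarrow> real"
  assumes f: "sm S f" and h: "h > 0"
    and S: "\<And>a b. 0 \<le> a \<Longrightarrow> a \<le> h \<Longrightarrow> 0 \<le> b \<Longrightarrow> b \<le> h \<Longrightarrow> x + a *\<^sub>R v + b *\<^sub>R w \<in> S"
  shows "\<exists>a b. 0 \<le> a \<and> a \<le> h \<and> 0 \<le> b \<and> b \<le> h \<and>
     f (x + h *\<^sub>R v + h *\<^sub>R w) - f (x + h *\<^sub>R v) - f (x + h *\<^sub>R w) + f x
       = h * h * dv w (dv v f) (x + a *\<^sub>R v + b *\<^sub>R w)"
proof -
  define g where "g a = f (x + a *\<^sub>R v + h *\<^sub>R w) - f (x + a *\<^sub>R v)" for a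
  have ind: "((\<lambda>a. F (c + a *\<^sub>R u)) has_real_derivative dv u F (c + a *\<^sub>R u)) (at a)"
    if "sm S F" "c + a *\<^sub>R u \<in> S" for F :: "'a \<Rightarrow> real" and c u a
  proof -
    have "((\<lambda>a. c + a *\<^sub>R u) has_derivative (\<lambda>t. t *\<^sub>R u)) (at a)"
      by (auto intro!: derivative_eq_intros)
    from diff_chain_at[OF this sm_has_derivative[OF that]]
    show ?thesis
      using sm_differentiable[OF that]
      by (simp add: o_def has_field_derivative_def dv_scaleR_dir mult_commute_abs)
  qed
  have "(g has_real_derivative (dv v f (x + a *\<^sub>R v + h *\<^sub>R w) - dv v f (x + a *\<^sub>R v))) (at a)"
    if "0 \<le> a" "a \<le> h" for a
    unfolding g_def
    using ind[OF f, of "x + h *\<^sub>R w" a v] ind[OF f, of x a v] S[of a h] S[of a 0] that h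
    by (intro DERIV_diff) (auto simp: algebra_simps)
  from MVT2[OF h this] obtain a where a: "0 < a" "a < h"
    "g h - g 0 = h * (dv v f (x + a *\<^sub>R v + h *\<^sub>R w) - dv v f (x + a *\<^sub>R v))" by auto
  have "((\<lambda>b. dv v f (x + a *\<^sub>R v + b *\<^sub>R w)) has_real_derivative dv w (dv v f) (x + a *\<^sub>R v + b *\<^sub>R w)) (at b)"
    if "0 \<le> b" "b \<le> h" for b
    using ind[OF sm_dv[OF f], of "x + a *\<^sub>R v" b w v] S[of a b] a that by auto
  from MVT2[OF h this] obtain b where "0 < b" "b < h"
    "dv v f (x + a *\<^sub>R v + h *\<^sub>R w) - dv v f (x + a *\<^sub>R v + 0 *\<^sub>R w) = h * dv w (dv v f) (x + a *\<^sub>R v + b *\<^sub>R w)" by auto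
  with a show ?thesis by (intro exI[of _ a] exI[of _ b]) (auto simp: g_def algebra_simps)
qed

text \<open>The second difference is symmetric in \<open>v\<close> and \<open>w\<close>, so
  arbitrarily close to \<open>x\<close> both mixed derivatives assume a common value, possibly at
  different points; continuity carries the equality to \<open>x\<close>.\<close>

lemma dv_commute:
  fixes f :: "'a::euclidean_space \<Rightarrow> real"
  assumes f: "sm S f" and x: "x \<in> S"
  shows "dv v (dv w f) x = dv w (dv v f) x"
proof (rule ccontr)
  define p q where "p = dv v (dv w f)" and "q = dv w (dv v f)"
  assume "dv v (dv w f) x \<noteq> dv w (dv v f) x"
  then have e: "\<bar>p x - q x\<bar> / 2 > 0" (is "?e > 0") by (simp add: p_def q_def)
  have "sm S p" "sm S q" unfolding p_def q_def using f by (simp_all add: sm_dv)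
  then have c: "isCont p x" "isCont q x"
    using x sm_open[OF f] sm_continuous_on continuous_on_eq_continuous_at by blast+
  obtain d1 where d1: "d1 > 0" "\<And>y. dist y x < d1 \<Longrightarrow> dist (p y) (p x) < ?e"
    using c(1) e unfolding continuous_at_eps_delta by blast
  obtain d2 where d2: "d2 > 0" "\<And>y. dist y x < d2 \<Longrightarrow> dist (q y) (q x) < ?e"
    using c(2) e unfolding continuous_at_eps_delta by blast
  note d = d1 d2
  obtain d3 where d3: "d3 > 0" "\<And>y. dist y x < d3 \<Longrightarrow> y \<in> S"
    using sm_open[OF f] x unfolding open_dist by blast
  define r where "r = min d1 (min d2 d3)"
  \<comment> \<open>Small enough that the whole parallelogram stays within distance \<open>r\<close>
    of \<open>x\<close>; the summand 1 keeps the denominator positive when \<open>v\<close> and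
    \<open>w\<close> are both 0.\<close>
  define h where "h = r / (norm v + norm w + 1)"
  have r: "r > 0" using d d3 by (simp add: r_def)
  have N: "norm v + norm w + 1 > 0" by (simp add: add_nonneg_pos)
  have h: "h > 0" using r N by (simp add: h_def)
  have near: "dist (x + a *\<^sub>R v + b *\<^sub>R w) x < r" if "0 \<le> a" "a \<le> h" "0 \<le> b" "b \<le> h" for a b
  proof -
    have "norm (a *\<^sub>R v + b *\<^sub>R w) \<le> a * norm v + b * norm w"
      using norm_triangle_ineq[of "a *\<^sub>R v" "b *\<^sub>R w"] that by simp
    also have "\<dots> \<le> h * norm v + h * norm w" using that by (intro add_mono mult_right_mono) auto
    also have "\<dots> < h * (norm v + norm w + 1)" using h by (simp add: algebra_simps)
    also have "\<dots> = r" using N by (simp add: h_def)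
    finally show ?thesis by (simp add: dist_norm add.assoc)
  qed
  have S: "x + a *\<^sub>R v + b *\<^sub>R w \<in> S" if "0 \<le> a" "a \<le> h" "0 \<le> b" "b \<le> h" for a b
    using d3(2) near[OF that] by (simp add: r_def)
  obtain a b where ab: "0 \<le> a" "a \<le> h" "0 \<le> b" "b \<le> h"
    "f (x + h *\<^sub>R v + h *\<^sub>R w) - f (x + h *\<^sub>R v) - f (x + h *\<^sub>R w) + f x = h * h * q (x + a *\<^sub>R v + b *\<^sub>R w)"
    using second_difference_mvt[OF f h S] unfolding q_def by auto
  have S': "x + a *\<^sub>R w + b *\<^sub>R v \<in> S" if "0 \<le> a" "a \<le> h" "0 \<le> b" "b \<le> h" for a b
    using S[OF that(3,4,1,2)] by (simp add: algebra_simps)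
  obtain a' b' where ab': "0 \<le> a'" "a' \<le> h" "0 \<le> b'" "b' \<le> h"
    "f (x + h *\<^sub>R w + h *\<^sub>R v) - f (x + h *\<^sub>R w) - f (x + h *\<^sub>R v) + f x = h * h * p (x + a' *\<^sub>R w + b' *\<^sub>R v)"
    using second_difference_mvt[OF f h S'] unfolding p_def by auto
  have "h * h * q (x + a *\<^sub>R v + b *\<^sub>R w) = h * h * p (x + b' *\<^sub>R v + a' *\<^sub>R w)"
    using ab(5) ab'(5) by (simp add: algebra_simps)
  then have eq: "q (x + a *\<^sub>R v + b *\<^sub>R w) = p (x + b' *\<^sub>R v + a' *\<^sub>R w)" using h by simp
  have "dist (q (x + a *\<^sub>R v + b *\<^sub>R w)) (q x) < ?e" using d(4) near ab by (simp add: r_def)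
  moreover have "dist (p (x + b' *\<^sub>R v + a' *\<^sub>R w)) (p x) < ?e" using d(2) near ab' by (simp add: r_def)
  ultimately show False using eq unfolding dist_real_def by (smt (verit) field_sum_of_halves)
qed

lemma dv_mult:
  fixes f g :: "'a::euclidean_space \<Rightarrow> 'b::real_normed_algebra"
  shows "f differentiable at x \<Longrightarrow> g differentiable at x \<Longrightarrow>
    dv v (\<lambda>x. f x * g x) x = f x * dv v g x + dv v f x * g x"
  by (rule dv_bilinear[OF bounded_bilinear_mult])

lemma dv_cmult:
  fixes f :: "'a::euclidean_space \<Rightarrow> 'b::real_normed_algebra"
  shows "f differentiable at x \<Longrightarrow> dv v (\<lambda>x. c * f x) x = c * dv v f x"
  by (rule dv_linear_compose[OF bounded_linear_mult_right])

lemma dv_const: "dv v (\<lambda>x. c) x = 0"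
  by (simp add: dv_def)

lemma sm_cmult:
  fixes f :: "'a::euclidean_space \<Rightarrow> 'b::real_normed_algebra"
  shows "sm S f \<Longrightarrow> sm S (\<lambda>x. c * f x)"
  by (rule sm_linear_compose[OF bounded_linear_mult_right])

lemma sm_vec:
  fixes g :: "'a::euclidean_space \<Rightarrow> ('c::euclidean_space) ^ 'n"
  assumes o: "open S" and "\<And>i. sm S (\<lambda>x. g x $ i)"
  shows "sm S g"
proof -
  have bl: "bounded_linear (axis i :: 'c \<Rightarrow> 'c ^ 'n)" for i
    by (rule linear_conv_bounded_linear[THEN iffD1], rule linearI) (auto simp: axis_def vec_eq_iff)
  have "sm S (\<lambda>x. \<Sum>i\<in>UNIV. axis i (g x $ i))"
    by (intro sm_sum[OF o] sm_linear_compose[OF bl] assms(2))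
  moreover have "(\<Sum>i\<in>UNIV. axis i (g x $ i)) = g x" for x
    by (simp add: vec_eq_iff axis_def sum.delta if_distrib cong: if_cong)
  ultimately show ?thesis by simp
qed

lemma sm_vec_nth:
  fixes g :: "'a::euclidean_space \<Rightarrow> ('c::euclidean_space) ^ 'n"
  shows "sm S g \<Longrightarrow> sm S (\<lambda>x. g x $ i)"
  by (rule sm_linear_compose[OF bounded_linear_vec_nth])

section \<open>Second derivatives as bilinear forms\<close>

definition hess :: "('a::euclidean_space \<Rightarrow> 'b::real_normed_vector) \<Rightarrow> 'a \<Rightarrow> 'a \<Rightarrow> 'a \<Rightarrow> 'b" where
  "hess f z x y = dv x (dv y f) z"

lemma hess_cong:
  assumes "open S" "z \<in> S" "\<And>y. y \<in> S \<Longrightarrow> f y = g y"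
  shows "hess f z x y = hess g z x y"
  unfolding hess_def
  by (rule dv_cong[OF assms(1,2)], rule dv_cong[OF assms(1)], assumption, rule assms(3))

lemma hess_mult:
  fixes f g :: "'a::euclidean_space \<Rightarrow> real"
  assumes "sm W f" "sm W g" "z \<in> W"
  shows "hess (\<lambda>z. f z * g z) z x y = f z * hess g z x y + dv x f z * dv y g z + dv y f z * dv x g z + hess f z x y * g z"
proof -
  have d: "F differentiable at z" if "sm W F" "z \<in> W" for F :: "'a \<Rightarrow> real" and z
    by (rule sm_differentiable[OF that])
  have "hess (\<lambda>z. f z * g z) z x y = dv x (\<lambda>z. f z * dv y g z + dv y f z * g z) z"
    unfolding hess_def
    by (rule dv_cong[OF sm_open[OF assms(1)] assms(3)]) (rule dv_mult[OF d[OF assms(1)] d[OF assms(2)]])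
  also have "\<dots> = dv x (\<lambda>z. f z * dv y g z) z + dv x (\<lambda>z. dv y f z * g z) z"
    by (rule dv_add) (use assms in \<open>auto intro!: d sm_mult sm_dv\<close>)
  also have "\<dots> = f z * hess g z x y + dv x f z * dv y g z + (dv y f z * dv x g z + hess f z x y * g z)"
    unfolding hess_def using assms by (simp add: dv_mult d sm_dv)
  finally show ?thesis by simp
qed

lemma hess_add:
  assumes "sm W f" "sm W g" "z \<in> W"
  shows "hess (\<lambda>z. f z + g z) z x y = hess f z x y + hess g z x y"
proof -
  have "hess (\<lambda>z. f z + g z) z x y = dv x (\<lambda>z. dv y f z + dv y g z) z"
    unfolding hess_def
    by (rule dv_cong[OF sm_open[OF assms(1)] assms(3)]) (rule dv_add[OF sm_differentiable[OF assms(1)] sm_differentiable[OF assms(2)]])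
  also have "\<dots> = hess f z x y + hess g z x y"
    unfolding hess_def by (rule dv_add[OF sm_differentiable[OF sm_dv[OF assms(1)] assms(3)] sm_differentiable[OF sm_dv[OF assms(2)] assms(3)]])
  finally show ?thesis .
qed

lemma hess_linear_compose:
  assumes h: "bounded_linear h" and "sm W f" "z \<in> W"
  shows "hess (\<lambda>z. h (f z)) z x y = h (hess f z x y)"
proof -
  have "hess (\<lambda>z. h (f z)) z x y = dv x (\<lambda>z. h (dv y f z)) z"
    unfolding hess_def
    by (rule dv_cong[OF sm_open[OF assms(2)] assms(3)]) (rule dv_linear_compose[OF h sm_differentiable[OF assms(2)]])
  also have "\<dots> = h (hess f z x y)"
    unfolding hess_def by (rule dv_linear_compose[OF h sm_differentiable[OF sm_dv[OF assms(2)] assms(3)]])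
  finally show ?thesis .
qed

lemma hess_expand:
  fixes f :: "'a::euclidean_space \<Rightarrow> real"
  assumes "sm W f" "z \<in> W"
  shows "hess f z x y = (\<Sum>b\<in>Basis. \<Sum>c\<in>Basis. (x \<bullet> b) * (y \<bullet> c) * hess f z b c)"
proof -
  have "dv b (dv y f) z = (\<Sum>c\<in>Basis. (y \<bullet> c) * dv b (dv c f) z)" for b
  proof -
    have "dv b (dv y f) z = dv y (dv b f) z" by (rule dv_commute[OF assms])
    also have "\<dots> = (\<Sum>c\<in>Basis. (y \<bullet> c) *\<^sub>R dv c (dv b f) z)"
      by (rule dv_sum_Basis[OF sm_differentiable[OF sm_dv[OF assms(1)] assms(2)]])
    finally show ?thesis by (simp add: dv_commute[OF assms, of _ b])
  qed
  then show ?thesis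
    unfolding hess_def using dv_sum_Basis[OF sm_differentiable[OF sm_dv[OF assms(1)] assms(2)], of x y]
    by (simp add: sum_distrib_left mult.assoc)
qed

section \<open>The operators on functions of affine weight w\<close>

text \<open>Complex second derivatives are kept real in this way: four times the Levi form of a
  function in direction \<open>z\<close> is the sum of its real second derivatives along
  \<open>z\<close> and along \<open>imul z\<close>.\<close>

definition imul :: "complex ^ 'n \<Rightarrow> complex ^ 'n" where "imul z = \<i> *s z"

lemma inner_vec_complex: "(x :: complex ^ 'n) \<bullet> y = (\<Sum>i\<in>UNIV. Re (x $ i * cnj (y $ i)))"
  by (simp add: inner_vec_def inner_complex_def)

lemma inner_imul [simp]: "z \<bullet> imul z = 0" "imul z \<bullet> z = 0" "imul z \<bullet> imul z = z \<bullet> z"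
  by (simp_all add: inner_vec_complex imul_def algebra_simps)

lemma bounded_linear_imul: "bounded_linear imul"
  unfolding imul_def by (rule linear_conv_bounded_linear[THEN iffD1], rule linearI)
    (simp_all add: vec_eq_iff algebra_simps scaleR_conv_of_real)

text \<open>Four times \<open>(w - R) (w - R') - (\<Sum>j. \<partial>\<^sub>j \<partial>'\<^sub>j)\<close>, where \<open>R = (\<Sum>j. z\<^sub>j \<partial>\<^sub>j)\<close> and primes denote
  conjugates: this is what the ambient Laplacian of \<open>L\<close> does to \<open>|\<zeta>\<^sub>0|\<^bsup>2w\<^esup> f(\<zeta>'/\<zeta>\<^sub>0)\<close>, see \<open>lap_homog_ext\<close>.\<close>

definition Qop :: "real \<Rightarrow> (complex ^ 'n \<Rightarrow> real) \<Rightarrow> (complex ^ 'n \<Rightarrow> real)" where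
  "Qop w f z = 4 * w\<^sup>2 * f z - 4 * w * dv z f z + hess f z z z + hess f z (imul z) (imul z) - (\<Sum>b\<in>Basis. hess f z b b)"

text \<open>The coordinate form with smooth coefficients, from which smoothness of
  \<open>Qop w f\<close>, its order of vanishing and its being a differential operator are read
  off.\<close>

lemma Qop_expand:
  assumes "sm W f" "z \<in> W"
  shows "Qop w f z = 4 * w\<^sup>2 * f z - 4 * w * (\<Sum>b\<in>Basis. (z \<bullet> b) * dv b f z)
    + (\<Sum>b\<in>Basis. \<Sum>c\<in>Basis. ((z \<bullet> b) * (z \<bullet> c) + (imul z \<bullet> b) * (imul z \<bullet> c)) * dv b (dv c f) z)
    - (\<Sum>b\<in>Basis. dv b (dv b f) z)"
  unfolding Qop_def hess_expand[OF assms, of z z] hess_expand[OF assms, of "imul z" "imul z"]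
    dv_sum_Basis[OF sm_differentiable[OF assms], of z]
  by (simp add: hess_def sum.distrib distrib_right)

lemma sm_inner_const: "sm S f \<Longrightarrow> sm S (\<lambda>x. f x \<bullet> c)"
  by (rule sm_linear_compose[OF bounded_linear_inner_left])

lemma sm_imul: "open S \<Longrightarrow> sm S imul"
  by (rule sm_bounded_linear[OF bounded_linear_imul])

lemma sm_Qop:
  assumes "sm W f"
  shows "sm W (Qop w f)"
proof (rule sm_cong[OF _ Qop_expand[OF assms, symmetric]])
  note o = sm_open[OF assms]
  show "sm W (\<lambda>z. 4 * w\<^sup>2 * f z - 4 * w * (\<Sum>b\<in>Basis. (z \<bullet> b) * dv b f z)
    + (\<Sum>b\<in>Basis. \<Sum>c\<in>Basis. ((z \<bullet> b) * (z \<bullet> c) + (imul z \<bullet> b) * (imul z \<bullet> c)) * dv b (dv c f) z)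
    - (\<Sum>b\<in>Basis. dv b (dv b f) z))"
    by (intro sm_add sm_diff sm_mult sm_sum sm_const sm_dv sm_inner_const sm_ident sm_imul o assms)
qed

lemma Qop_cong:
  assumes "open S" "z \<in> S" "\<And>y. y \<in> S \<Longrightarrow> f y = g y"
  shows "Qop w f z = Qop w g z"
  unfolding Qop_def using hess_cong[OF assms] dv_cong[OF assms] assms(2,3) by simp

lemma Qop_add:
  assumes "sm W f" "sm W g" "z \<in> W"
  shows "Qop w (\<lambda>z. f z + g z) z = Qop w f z + Qop w g z"
  unfolding Qop_def hess_add[OF assms] dv_add[OF sm_differentiable[OF assms(1,3)] sm_differentiable[OF assms(2,3)]]
  by (simp add: algebra_simps sum.distrib)

lemma Qop_cmult:
  assumes "sm W f" "z \<in> W"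
  shows "Qop w (\<lambda>z. c * f z) z = c * Qop w f z"
  unfolding Qop_def hess_linear_compose[OF bounded_linear_mult_right assms] dv_cmult[OF sm_differentiable[OF assms]]
  by (simp add: algebra_simps sum_distrib_left)

section \<open>The defining function of the sphere and its commutator with the operators\<close>

definition rho :: "'a::real_inner \<Rightarrow> real" where "rho z = 1 - z \<bullet> z"

lemma rho_sphere: "z \<in> sphereS \<Longrightarrow> rho z = 0"
  by (simp add: rho_def sphereS_def dot_square_norm)

lemma sm_rho: "open S \<Longrightarrow> sm S rho"
  unfolding rho_def by (intro sm_diff sm_const sm_bilinear[OF bounded_bilinear_inner] sm_ident)

lemma dv_rho: "dv v rho z = - 2 * (z \<bullet> v)"
  unfolding rho_def
  by (rule dv_eqI) (auto intro!: derivative_eq_intros simp: inner_commute)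

lemma hess_rho: "hess rho z x y = - 2 * (x \<bullet> y)"
proof -
  have "dv y rho = (\<lambda>z. - 2 * (z \<bullet> y))" by (auto simp: dv_rho)
  then show ?thesis unfolding hess_def
    by (simp, intro dv_eqI) (auto intro!: derivative_eq_intros)
qed

text \<open>This is the affine form of the commutator of the ambient Laplacian with multiplication
  by \<open>Lform\<close>. The extra first order terms combine to
  \<open>4 * (1 - z \<bullet> z)\<close> times the radial derivative, a multiple of
  \<open>rho\<close>, which is absorbed by lowering \<open>w\<close> by one.\<close>

lemma Qop_rho:
  fixes g :: "complex ^ 'n::finite \<Rightarrow> real"
  assumes "sm W g" "z \<in> W"
  shows "Qop w (\<lambda>z. rho z * g z) z = rho z * Qop (w - 1) g z + 4 * (2 * w + real CARD('n) - 1) * g z"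
proof -
  note o = sm_open[OF assms(1)]
  note m = hess_mult[OF sm_rho[OF o] assms]
  have dim: "(\<Sum>b\<in>Basis. (b::complex ^ 'n) \<bullet> b) = 2 * real CARD('n)"
    by (simp add: inner_same_Basis)
  have lin: "(\<Sum>b\<in>Basis. (z \<bullet> b) * dv b g z) = dv z g z"
    using dv_sum_Basis[OF sm_differentiable[OF assms], of z] by simp
  have S: "(\<Sum>b\<in>Basis. hess (\<lambda>z. rho z * g z) z b b)
     = rho z * (\<Sum>b\<in>Basis. hess g z b b) - 4 * dv z g z - 4 * real CARD('n) * g z"
  proof -
    have "(\<Sum>b\<in>Basis. hess (\<lambda>z. rho z * g z) z b b)
      = (\<Sum>b\<in>Basis. rho z * hess g z b b - 4 * ((z \<bullet> b) * dv b g z) - 2 * g z * (b \<bullet> b))"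
      unfolding m dv_rho hess_rho by (intro sum.cong) (auto simp: algebra_simps)
    also have "\<dots> = rho z * (\<Sum>b\<in>Basis. hess g z b b) - 4 * dv z g z - 2 * g z * (2 * real CARD('n))"
      unfolding sum_subtractf sum_distrib_left[symmetric] lin dim by simp
    finally show ?thesis by simp
  qed
  show ?thesis
    unfolding Qop_def S unfolding m
      dv_mult[OF sm_differentiable[OF sm_rho[OF o] assms(2)] sm_differentiable[OF assms]]
    unfolding dv_rho hess_rho inner_imul
    by (simp add: rho_def algebra_simps power2_eq_square)
qed

section \<open>Independence of the extension\<close>

text \<open>An ambient Laplacian lowers the weight by one, so the parameter drops by one from each
  factor to the next.\<close>

fun chain :: "nat \<Rightarrow> real \<Rightarrow> (complex ^ 'n \<Rightarrow> real) \<Rightarrow> (complex ^ 'n \<Rightarrow> real)" where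
  "chain 0 w f = f"
| "chain (Suc k) w f = Qop (w - real k) (chain k w f)"

lemma sm_chain: "sm W f \<Longrightarrow> sm W (chain k w f)"
  by (induction k) (simp_all add: sm_Qop)

lemma chain_add:
  assumes "sm W f" "sm W g" "z \<in> W"
  shows "chain k w (\<lambda>z. f z + g z) z = chain k w f z + chain k w g z"
  using assms(3)
proof (induction k arbitrary: z)
  case (Suc k)
  show ?case
    using Qop_cong[OF sm_open[OF assms(1)] Suc.prems Suc.IH]
      Qop_add[OF sm_chain[OF assms(1)] sm_chain[OF assms(2)] Suc.prems] by simp
qed simp

lemma chain_cmult:
  assumes "sm W f" "z \<in> W"
  shows "chain k w (\<lambda>z. c * f z) z = c * chain k w f z"
  using assms(2)
proof (induction k arbitrary: z)
  case (Suc k)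
  show ?case
    using Qop_cong[OF sm_open[OF assms(1)] Suc.prems Suc.IH] Qop_cmult[OF sm_chain[OF assms(1)] Suc.prems] by simp
qed simp

text \<open>The second coefficient vanishes at \<open>k = n\<close>; this is why the \<open>n\<close>-fold composition is tangential.\<close>

lemma chain_rho:
  fixes g :: "complex ^ 'n::finite \<Rightarrow> real"
  assumes g: "sm W g" and "z \<in> W"
  shows "chain k 0 (\<lambda>z. rho z * g z) z
    = rho z * chain k (- 1) g z + 4 * real k * (real CARD('n) - real k) * chain (k - 1) (- 1) g z"
  using assms(2)
proof (induction k arbitrary: z)
  case (Suc k)
  note o = sm_open[OF g]
  define A B where "A = chain k (- 1) g" and "B = chain (k - 1) (- 1) g"
  define s where "s = 4 * real k * (real CARD('n) - real k)"
  have sA: "sm W A" and sB: "sm W B" unfolding A_def B_def by (rule sm_chain[OF g])+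
  have sB': "sm W (\<lambda>z. s * B z)" by (rule sm_cmult[OF sB])
  have sA': "sm W (\<lambda>z. rho z * A z)" by (rule sm_mult[OF sm_rho[OF o] sA])
  have "chain (Suc k) 0 (\<lambda>z. rho z * g z) z = Qop (- real k) (\<lambda>z. rho z * A z + s * B z) z"
    using Qop_cong[OF o Suc.prems Suc.IH, where w = "- real k"] by (simp add: A_def B_def s_def)
  also have "\<dots> = Qop (- real k) (\<lambda>z. rho z * A z) z + s * Qop (- real k) B z"
    unfolding Qop_add[OF sA' sB' Suc.prems] Qop_cmult[OF sB Suc.prems] ..
  \<comment> \<open>For \<open>k > 0\<close> the operator \<open>Qop (- real k)\<close> is the last
    factor of \<open>A\<close> over \<open>B\<close>. For \<open>k = 0\<close> the truncated index
    \<open>k - 1\<close> is meaningless, but then \<open>s = 0\<close>.\<close>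
  also have "s * Qop (- real k) B z = s * A z"
    by (cases k) (simp_all add: s_def A_def B_def)
  also have "Qop (- real k) (\<lambda>z. rho z * A z) z
      = rho z * Qop (- real k - 1) A z + 4 * (2 * (- real k) + real CARD('n) - 1) * A z"
    by (rule Qop_rho[OF sA Suc.prems])
  also have "Qop (- real k - 1) A z = chain (Suc k) (- 1) g z" 
    unfolding A_def chain.simps by (rule arg_cong[where f = "\<lambda>t. Qop t (chain k (- 1) g) z"]) simp
  finally show ?case by (simp add: A_def s_def algebra_simps)
qed simp

section \<open>Vanishing to finite order along the sphere\<close>

definition radial :: "('a::real_normed_vector \<Rightarrow> real) \<Rightarrow> ('a \<Rightarrow> real)" where
  "radial f z = dv z f z"

text \<open>Vanishing to order \<open>m\<close> on the part of the sphere in \<open>W\<close>; since tangential derivatives of a function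
  vanishing there are zero, it suffices to control the radial ones.\<close>

fun flat :: "nat \<Rightarrow> (complex ^ 'n) set \<Rightarrow> (complex ^ 'n \<Rightarrow> real) \<Rightarrow> bool" where
  "flat 0 W h = True"
| "flat (Suc m) W h = ((\<forall>z\<in>W \<inter> sphereS. h z = 0) \<and> flat m W (radial h))"

lemma radial_expand: "sm W f \<Longrightarrow> z \<in> W \<Longrightarrow> radial f z = (\<Sum>b\<in>Basis. (z \<bullet> b) * dv b f z)"
  unfolding radial_def by (subst dv_sum_Basis[OF sm_differentiable]) auto

lemma sm_radial: "sm W f \<Longrightarrow> sm W (radial f)"
  by (rule sm_cong[OF _ radial_expand[symmetric]])
     (auto intro!: sm_sum sm_mult sm_inner_const sm_ident sm_dv simp: sm_open)

lemma radial_cong: "open S \<Longrightarrow> z \<in> S \<Longrightarrow> (\<And>y. y \<in> S \<Longrightarrow> f y = g y) \<Longrightarrow> radial f z = radial g z"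
  unfolding radial_def by (rule dv_cong)

lemma radial_mult: "sm W f \<Longrightarrow> sm W g \<Longrightarrow> z \<in> W \<Longrightarrow> radial (\<lambda>z. f z * g z) z = f z * radial g z + radial f z * g z"
  unfolding radial_def by (rule dv_mult) (auto intro: sm_differentiable)

lemma radial_add: "sm W f \<Longrightarrow> sm W g \<Longrightarrow> z \<in> W \<Longrightarrow> radial (\<lambda>z. f z + g z) z = radial f z + radial g z"
  unfolding radial_def by (rule dv_add) (auto intro: sm_differentiable)

lemma flat_cong:
  assumes "open W" "\<And>z. z \<in> W \<Longrightarrow> f z = g z" "flat m W f"
  shows "flat m W g"
  using assms(2,3)
proof (induction m arbitrary: f g)
  case (Suc m)
  have "flat m W (radial g)"
    by (rule Suc.IH[of "radial f"]) (use Suc.prems radial_cong[OF assms(1), of _ f g] in auto)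
  then show ?case using Suc.prems by auto
qed simp

lemma flat_mono: "flat (Suc m) W h \<Longrightarrow> flat m W h"
proof (induction m arbitrary: h)
  case (Suc m)
  note u = iffD1[OF flat.simps(2)[of "Suc m" W h] Suc.prems]
  show ?case unfolding flat.simps(2)[of m W h] using u Suc.IH by blast
qed simp

lemma flat_add: "open W \<Longrightarrow> sm W f \<Longrightarrow> sm W g \<Longrightarrow> flat m W f \<Longrightarrow> flat m W g \<Longrightarrow> flat m W (\<lambda>z. f z + g z)"
proof (induction m arbitrary: f g)
  case (Suc m)
  have "flat m W (radial (\<lambda>z. f z + g z))"
    by (rule flat_cong[OF Suc.prems(1) _ Suc.IH[of "radial f" "radial g"]]) (use Suc.prems in \<open>auto simp: radial_add sm_radial\<close>)
  then show ?case using Suc.prems by auto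
qed simp

lemma flat_mult: "sm W a \<Longrightarrow> sm W h \<Longrightarrow> flat m W h \<Longrightarrow> flat m W (\<lambda>z. a z * h z)"
proof (induction m arbitrary: a h)
  case (Suc m)
  note o = sm_open[OF Suc.prems(1)]
  have "flat m W (radial (\<lambda>z. a z * h z))"
  proof (rule flat_cong[OF o])
    show "flat m W (\<lambda>z. a z * radial h z + radial a z * h z)"
      using Suc.prems flat_mono[OF Suc.prems(3)]
      by (intro flat_add[OF o] Suc.IH sm_mult sm_radial) auto
  qed (simp add: radial_mult[OF Suc.prems(1,2)])
  then show ?case using Suc.prems by auto
qed simp

lemma flat_sum:
  fixes W :: "(complex ^ 'n) set"
  shows "open W \<Longrightarrow> (\<And>a. a \<in> A \<Longrightarrow> sm W (f a) \<and> flat m W (f a)) \<Longrightarrow> finite A \<Longrightarrow> flat m W (\<lambda>z. \<Sum>a\<in>A. f a z)"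
proof (induction A rule: infinite_finite_induct)
  case empty
  have "flat m W (\<lambda>z. 0)"
  proof (induction m)
    case (Suc m)
    have "radial (\<lambda>z :: complex ^ 'n. 0) = (\<lambda>z. 0)" by (auto simp: radial_def dv_const)
    then show ?case using Suc by simp
  qed simp
  then show ?case by simp
next
  case (insert x F)
  then have "flat m W (\<lambda>z. f x z + (\<Sum>a\<in>F. f a z))" by (intro flat_add sm_sum) auto
  then show ?case using insert by simp
qed simp

lemma has_real_derivative_curve:
  fixes c :: "real \<Rightarrow> 'a::euclidean_space" and f :: "'a \<Rightarrow> real"
  assumes "(c has_vector_derivative c') (at t)" "f differentiable at (c t)"
  shows "((\<lambda>t. f (c t)) has_real_derivative dv c' f (c t)) (at t)"
proof -
  from diff_chain_at[OF assms(1)[unfolded has_vector_derivative_def] dv_works[OF assms(2)]]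
  show ?thesis
    unfolding has_field_derivative_def o_def dv_scaleR_dir[OF assms(2)] by (simp add: mult_commute_abs)
qed

text \<open>Differentiate \<open>k\<close> along the great circle \<open>c\<close> through
  \<open>p\<close> with initial velocity \<open>v\<close>, which stays on the sphere; the frequency
  \<open>s\<close> is the length of \<open>v\<close>.\<close>

lemma tangential_derivative_zero:
  fixes k :: "complex ^ 'n::finite \<Rightarrow> real"
  assumes k: "sm W k" and 0: "\<And>z. z \<in> W \<inter> sphereS \<Longrightarrow> k z = 0" and p: "p \<in> W" "p \<in> sphereS"
    and v: "v \<bullet> p = 0"
  shows "dv v k p = 0"
proof (cases "v = 0")
  case True
  then show ?thesis using dv_zero_dir[OF sm_differentiable[OF k p(1)]] by simp
next
  case False
  define s where "s = norm v"
  define c where "c t = cos (s * t) *\<^sub>R p + (sin (s * t) / s) *\<^sub>R v" for t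
  have s: "s > 0" using False by (simp add: s_def)
  have np: "p \<bullet> p = 1" using p by (simp add: sphereS_def dot_square_norm)
  have nv: "v \<bullet> v = s\<^sup>2" by (simp add: s_def dot_square_norm)
  have "c t \<bullet> c t = (cos (s * t))\<^sup>2 + (sin (s * t))\<^sup>2" for t
    using s np nv v by (simp add: c_def inner_add_left inner_add_right inner_commute[of p v] power2_eq_square)
  then have "norm (c t) = 1" for t by (simp add: norm_eq_sqrt_inner)
  then have S: "c t \<in> sphereS" for t by (simp add: sphereS_def)
  have c': "(c has_vector_derivative v) (at 0)"
    unfolding c_def has_vector_derivative_def using s
    by (auto intro!: derivative_eq_intros simp: algebra_simps)
  have c0: "c 0 = p" by (simp add: c_def)
  have d: "((\<lambda>t. k (c t)) has_real_derivative dv v k p) (at 0)"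
    using has_real_derivative_curve[OF c', of k] sm_differentiable[OF k p(1)] by (simp add: c0)
  have "isCont c 0" using c' has_vector_derivative_continuous by blast
  then have "\<forall>\<^sub>F t in at 0. c t \<in> W"
    using sm_open[OF k] p c0 unfolding isCont_def by (metis topological_tendstoD)
  then have "\<forall>\<^sub>F t in at 0. k (c t) = 0" by eventually_elim (use 0 S in auto)
  then obtain e where e: "e > 0" "\<And>t. t \<noteq> 0 \<Longrightarrow> dist t 0 < e \<Longrightarrow> k (c t) = 0"
    unfolding eventually_at by auto
  have k0: "k (c 0) = 0" using 0 p c0 by auto
  have "((\<lambda>t. 0) has_real_derivative dv v k p) (at 0)"
    by (rule has_field_derivative_transform_within[OF d e(1)]) (simp, metis e(2) k0)
  then show ?thesis using DERIV_unique DERIV_const by blast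
qed

lemma dv_vanishing:
  fixes k :: "complex ^ 'n::finite \<Rightarrow> real"
  assumes k: "sm W k" and 0: "\<And>z. z \<in> W \<inter> sphereS \<Longrightarrow> k z = 0" and p: "p \<in> W" "p \<in> sphereS"
  shows "dv v k p = (v \<bullet> p) * radial k p"
proof -
  have np: "p \<bullet> p = 1" using p by (simp add: sphereS_def dot_square_norm)
  note d = sm_differentiable[OF k p(1)]
  have "dv (v - (v \<bullet> p) *\<^sub>R p) k p = 0"
    by (rule tangential_derivative_zero[OF assms]) (simp_all add: inner_diff_left np)
  then show ?thesis
    using dv_add_dir[OF d, of "v - (v \<bullet> p) *\<^sub>R p" "(v \<bullet> p) *\<^sub>R p"] dv_scaleR_dir[OF d, of "v \<bullet> p" p]
    by (simp add: radial_def)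
qed

text \<open>The commutator of the Euler field with a constant field is minus the constant field; the
  remaining second order terms agree by symmetry.\<close>

lemma radial_dv:
  fixes h :: "'a::euclidean_space \<Rightarrow> real"
  assumes "sm W h" "z \<in> W"
  shows "radial (dv v h) z = dv v (radial h) z - dv v h z"
proof -
  note o = sm_open[OF assms(1)]
  note d = sm_differentiable[OF _ assms(2)]
  have "dv v (radial h) z = dv v (\<lambda>z. \<Sum>b\<in>Basis. (z \<bullet> b) * dv b h z) z"
    by (rule dv_cong[OF o assms(2) radial_expand[OF assms(1)]])
  also have "\<dots> = (\<Sum>b\<in>Basis. (z \<bullet> b) * dv v (dv b h) z + (v \<bullet> b) * dv b h z)"
  proof (rule dv_eqI)
    have "((\<lambda>z. (z \<bullet> b) * dv b h z) has_derivative (\<lambda>v. (z \<bullet> b) * dv v (dv b h) z + (v \<bullet> b) * dv b h z)) (at z)" for b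
      by (rule has_derivative_mult[OF bounded_linear_imp_has_derivative[OF bounded_linear_inner_left]
          sm_has_derivative[OF sm_dv[OF assms(1)] assms(2)]])
    then show "((\<lambda>z. \<Sum>b\<in>Basis. (z \<bullet> b) * dv b h z) has_derivative
       (\<lambda>v. \<Sum>b\<in>Basis. (z \<bullet> b) * dv v (dv b h) z + (v \<bullet> b) * dv b h z)) (at z)"
      by (rule has_derivative_sum)
  qed
  also have "\<dots> = (\<Sum>b\<in>Basis. (z \<bullet> b) * dv b (dv v h) z) + (\<Sum>b\<in>Basis. (v \<bullet> b) * dv b h z)"
    by (simp add: sum.distrib dv_commute[OF assms, of v])
  also have "(\<Sum>b\<in>Basis. (v \<bullet> b) * dv b h z) = dv v h z"
    using dv_sum_Basis[OF d[OF assms(1)], of v] by simp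
  also have "(\<Sum>b\<in>Basis. (z \<bullet> b) * dv b (dv v h) z) = radial (dv v h) z"
    by (rule radial_expand[OF sm_dv[OF assms(1)] assms(2), symmetric])
  finally show ?thesis by simp
qed

text \<open>By \<open>radial_dv\<close>, the radial derivative of \<open>dv v h\<close> is a
  difference of derivatives of \<open>radial h\<close> and of \<open>h\<close>, both covered by the
  induction; on the sphere \<open>dv v h\<close> is a multiple of \<open>radial h\<close> by
  \<open>dv_vanishing\<close>.\<close>

lemma flat_dv: "sm W h \<Longrightarrow> flat (Suc m) W h \<Longrightarrow> flat m W (dv v h)"
proof (induction m arbitrary: h)
  case (Suc m)
  note o = sm_open[OF Suc.prems(1)]
  have u: "\<forall>z\<in>W \<inter> sphereS. h z = 0" "\<forall>z\<in>W \<inter> sphereS. radial h z = 0" "flat (Suc m) W (radial h)"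
    using Suc.prems(2) by auto
  have "flat m W (\<lambda>z. dv v (radial h) z + (- 1) * dv v h z)"
    using Suc.prems(1) flat_mono[OF Suc.prems(2)]
    by (intro flat_add[OF o] flat_mult Suc.IH[OF sm_radial u(3)] Suc.IH sm_mult sm_const sm_dv sm_radial o) auto
  then have "flat m W (radial (dv v h))"
    by (rule flat_cong[OF o, rotated]) (use radial_dv[OF Suc.prems(1)] in auto)
  moreover have "dv v h z = 0" if "z \<in> W \<inter> sphereS" for z
    using dv_vanishing[OF Suc.prems(1), of z v] u that by auto
  ultimately show ?case by simp
qed simp

lemma flat_Qop:
  assumes h: "sm W h" and v: "flat (Suc (Suc m)) W h"
  shows "flat m W (Qop w h)"
proof -
  note o = sm_open[OF h]
  have v1: "flat (Suc m) W h" by (rule flat_mono[OF v])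
  have v0: "flat m W h" by (rule flat_mono[OF v1])
  have d1: "flat m W (dv b h)" for b by (rule flat_dv[OF h v1])
  have d2: "flat m W (dv b (dv c h))" for b c by (rule flat_dv[OF sm_dv[OF h] flat_dv[OF h v]])
  have fB: "finite (Basis :: (complex ^ 'a) set)" by simp
  have "flat m W (\<lambda>z. (4 * w\<^sup>2 * h z + (- 4 * w) * (\<Sum>b\<in>Basis. (z \<bullet> b) * dv b h z))
    + ((\<Sum>b\<in>Basis. \<Sum>c\<in>Basis. ((z \<bullet> b) * (z \<bullet> c) + (imul z \<bullet> b) * (imul z \<bullet> c)) * dv b (dv c h) z)
    + (- 1) * (\<Sum>b\<in>Basis. dv b (dv b h) z)))"
    by (intro flat_add[OF o] flat_mult flat_sum[OF o _ fB] conjI v0 d1 d2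
        sm_add sm_mult sm_sum sm_const sm_dv sm_inner_const sm_ident sm_imul o h)
  then show ?thesis
    by (rule flat_cong[OF o, rotated]) (simp add: Qop_expand[OF h])
qed

text \<open>Each of the \<open>k\<close> second order factors costs two orders of vanishing, so
  \<open>2 * k + 1\<close> orders leave one for the value itself.\<close>

lemma chain_vanishing: "sm W h \<Longrightarrow> flat (Suc (2 * k)) W h \<Longrightarrow> z \<in> W \<inter> sphereS \<Longrightarrow> chain k w h z = 0"
proof -
  assume h: "sm W h" and v: "flat (Suc (2 * k)) W h" and z: "z \<in> W \<inter> sphereS"
  have "flat (Suc (2 * j)) W (chain (k - j) w h)" if "j \<le> k" for j
    using that
  proof (induction "k - j" arbitrary: j)
    case 0
    then show ?case using v by simp
  next
    case (Suc i)
    then have "i = k - Suc j" "Suc j \<le> k" by auto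
    from Suc.hyps(1)[OF this] have "flat (Suc (2 * Suc j)) W (chain (k - Suc j) w h)" .
    then have "flat (Suc (Suc (Suc (2 * j)))) W (chain (k - Suc j) w h)" by simp
    from flat_Qop[OF sm_chain[OF h] this]
    have "flat (Suc (2 * j)) W (Qop (w - real (k - Suc j)) (chain (k - Suc j) w h))" .
    moreover have "k - j = Suc (k - Suc j)" using \<open>Suc j \<le> k\<close> by simp
    ultimately show ?case by (simp only: chain.simps)
  qed
  from this[of 0] z show ?thesis by simp
qed

text \<open>On the sphere \<open>radial rho\<close> is \<open>- 2\<close>, so each radial derivative
  removes one factor \<open>rho\<close> and contributes \<open>- 2\<close> times its exponent. Thus
  \<open>rho\<close> serves as a transverse coordinate, and powers of it correct leading
  coefficients.\<close>

lemma radial_power_rho: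
  fixes g :: "complex ^ 'n::finite \<Rightarrow> real"
  shows "sm W g \<Longrightarrow> flat m W (\<lambda>z. rho z ^ m * g z) \<and>
    (\<forall>z\<in>W \<inter> sphereS. (radial ^^ m) (\<lambda>z. rho z ^ m * g z) z = fact m * (- 2) ^ m * g z)"
proof (induction m arbitrary: g)
  case (Suc m)
  note o = sm_open[OF Suc.prems]
  note r = sm_rho[OF o]
  define g' where "g' z = - 2 * real (Suc m) * (z \<bullet> z) * g z + rho z * radial g z" for z
  have g': "sm W g'" unfolding g'_def
    by (intro sm_add sm_mult sm_const sm_radial r Suc.prems o sm_bilinear[OF bounded_bilinear_inner] sm_ident)
  have pw: "radial (\<lambda>z. rho z ^ k) z = - 2 * real k * (z \<bullet> z) * rho z ^ (k - 1)" for k and z :: "complex ^ 'n"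
  proof -
    have "((\<lambda>z. rho z ^ k) has_derivative (\<lambda>v. real k * dv v rho z * rho z ^ (k - 1))) (at z)"
      using has_derivative_power[OF sm_has_derivative[OF sm_rho[OF open_UNIV]], of z k] by (simp add: mult_ac)
    from dv_eqI[OF this, of z] show ?thesis by (simp add: radial_def dv_rho)
  qed
  have eq: "radial (\<lambda>z. rho z ^ Suc m * g z) z = rho z ^ m * g' z" if "z \<in> W" for z
    using radial_mult[OF sm_power[OF r, of "Suc m"] Suc.prems that] unfolding pw
    by (simp add: g'_def algebra_simps)
  have "flat m W (radial (\<lambda>z. rho z ^ Suc m * g z))"
    by (rule flat_cong[OF o eq[symmetric]]) (use Suc.IH[OF g'] in auto)
  moreover have "(radial ^^ Suc m) (\<lambda>z. rho z ^ Suc m * g z) z = fact (Suc m) * (- 2) ^ Suc m * g z"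
    if z: "z \<in> W \<inter> sphereS" for z
  proof -
    have it: "(radial ^^ j) f y = (radial ^^ j) f' y" if "\<And>y. y \<in> W \<Longrightarrow> f y = f' y" "y \<in> W" for j f f' and y :: "complex ^ 'n"
      using that(2) by (induction j arbitrary: y) (auto intro!: radial_cong[OF o] simp: that(1))
    have "(radial ^^ Suc m) (\<lambda>z. rho z ^ Suc m * g z) z = (radial ^^ m) (radial (\<lambda>z. rho z ^ Suc m * g z)) z"
      by (simp only: funpow_Suc_right o_def)
    also have "\<dots> = (radial ^^ m) (\<lambda>z. rho z ^ m * g' z) z"
      by (rule it[OF eq]) (use z in auto)
    also have "\<dots> = fact m * (- 2) ^ m * g' z" using Suc.IH[OF g'] z by blast
    also have "g' z = - 2 * real (Suc m) * g z"
      using z by (simp add: g'_def rho_sphere) (simp add: sphereS_def dot_square_norm)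
    finally show ?thesis by (simp add: algebra_simps)
  qed
  ultimately show ?case using rho_sphere by auto
qed simp

text \<open>The definition splits off the condition on \<open>h\<close>; this form splits off the
  condition on the highest radial derivative, the one that a multiple of a power of
  \<open>rho\<close> can remove.\<close>

lemma flat_Suc_iff: "flat (Suc m) W h \<longleftrightarrow> flat m W h \<and> (\<forall>z\<in>W \<inter> sphereS. (radial ^^ m) h z = 0)"
proof (induction m arbitrary: h)
  case (Suc m)
  have "flat (Suc (Suc m)) W h \<longleftrightarrow> (\<forall>z\<in>W \<inter> sphereS. h z = 0) \<and> flat (Suc m) W (radial h)" by (rule flat.simps(2))
  also have "\<dots> \<longleftrightarrow> flat (Suc m) W h \<and> (\<forall>z\<in>W \<inter> sphereS. (radial ^^ m) (radial h) z = 0)"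
    unfolding Suc.IH[of "radial h"] flat.simps(2)[of m W h] by blast
  finally show ?case by (simp only: funpow_Suc_right o_def)
qed auto

lemma sm_radial_pow: "sm W f \<Longrightarrow> sm W ((radial ^^ m) f)"
  by (induction m) (auto intro: sm_radial)

text \<open>Downward induction on the vanishing order: a function vanishing to order \<open>m\<close> differs from one vanishing
  to order \<open>m + 1\<close> by a multiple of \<open>rho\<close>, and multiples of \<open>rho\<close> are killed.\<close>

lemma chain_indep_zero:
  fixes h :: "complex ^ 'n::finite \<Rightarrow> real"
  assumes "sm W h" "\<And>z. z \<in> W \<inter> sphereS \<Longrightarrow> h z = 0" "z \<in> W \<inter> sphereS"
  shows "chain CARD('n) 0 h z = 0"
proof -
  let ?N = "Suc (2 * CARD('n))"
  have "chain CARD('n) 0 h z = 0" if "sm W h" "flat (Suc m) W h" "Suc m \<le> ?N" for m h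
    using that
  proof (induction "?N - Suc m" arbitrary: m h)
    case 0
    then have "Suc m = ?N" by simp
    then show ?case using 0 chain_vanishing[of W h "CARD('n)" z] assms(3) by simp
  next
    case (Suc i)
    note o = sm_open[OF Suc.prems(1)]
    define M where "M = Suc m"
    \<comment> \<open>Minus the reciprocal of the factor in \<open>radial_power_rho\<close>, so that
      adding \<open>rho ^ M * g\<close> cancels the \<open>M\<close>-th radial derivative of
      \<open>h\<close> on the sphere.\<close>
    define c where "c = - inverse (fact M * (- 2) ^ M :: real)"
    define g where "g z = c * (radial ^^ M) h z" for z
    have sg: "sm W g" unfolding g_def by (intro sm_cmult sm_radial_pow Suc.prems)
    define k where "k z = h z + rho z ^ M * g z" for z
    have srg: "sm W (\<lambda>z. rho z ^ M * g z)" by (intro sm_mult sm_power sm_rho o sg)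
    have sk: "sm W k" unfolding k_def by (intro sm_add Suc.prems srg)
    have sk': "sm W (\<lambda>z. rho z ^ m * (- g z))" by (intro sm_mult sm_power sm_rho o sm_uminus sg)
    have it: "(radial ^^ j) (\<lambda>z. f z + f' z) y = (radial ^^ j) f y + (radial ^^ j) f' y"
      if "sm W f" "sm W f'" "y \<in> W" for j f f' and y :: "complex ^ 'n"
      using that(3)
    proof (induction j arbitrary: y)
      case (Suc j)
      then show ?case
        using radial_cong[OF o Suc.prems Suc.IH] radial_add[OF sm_radial_pow[OF that(1)] sm_radial_pow[OF that(2)] Suc.prems] by simp
    qed simp
    have vk: "flat M W k" unfolding k_def
      by (rule flat_add[OF o Suc.prems(1) srg]) (use Suc.prems(2) radial_power_rho[OF sg, of M] M_def in auto)
    have fc: "fact M * (- 2) ^ M * c = - 1" unfolding c_def mult_minus_right by (subst right_inverse) simp_all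
    have "(radial ^^ M) k y = 0" if "y \<in> W \<inter> sphereS" for y
    proof -
      have "(radial ^^ M) k y = (radial ^^ M) h y + fact M * (- 2) ^ M * g y"
        unfolding k_def using it[OF Suc.prems(1) srg, of y M] radial_power_rho[OF sg, of M] that by auto
      also have "\<dots> = (radial ^^ M) h y + (fact M * (- 2) ^ M * c) * (radial ^^ M) h y" by (simp add: g_def)
      finally show ?thesis unfolding fc by simp
    qed
    with vk have "flat (Suc M) W k" by (simp only: flat_Suc_iff[of M]) blast
    then have k0: "chain CARD('n) 0 k z = 0"
      by (intro Suc.hyps(1)[of M] sk) (use Suc.hyps(2) in \<open>auto simp: M_def\<close>)
    have r0: "chain CARD('n) 0 (\<lambda>z. rho z * (rho z ^ m * (- g z))) z = 0"
      unfolding chain_rho[OF sk' IntD1[OF assms(3)]] using assms(3) by (simp add: rho_sphere)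
    have "h = (\<lambda>z. k z + rho z * (rho z ^ m * (- g z)))" by (simp add: k_def M_def algebra_simps)
    then have "chain CARD('n) 0 h z = chain CARD('n) 0 k z + chain CARD('n) 0 (\<lambda>z. rho z * (rho z ^ m * (- g z))) z"
      using chain_add[OF sk sm_mult[OF sm_rho[OF o] sk'], of z] assms(3) by simp
    then show ?case using k0 r0 by simp
  qed
  from this[of h 0] assms show ?thesis by simp
qed

lemma chain_indep:
  fixes f g :: "complex ^ 'n::finite \<Rightarrow> real"
  assumes "sm W f" "sm W g" "\<And>z. z \<in> W \<inter> sphereS \<Longrightarrow> f z = g z" "z \<in> W \<inter> sphereS"
  shows "chain CARD('n) 0 f z = chain CARD('n) 0 g z"
proof -
  have "chain CARD('n) 0 (\<lambda>z. f z + - 1 * g z) z = 0"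
    by (rule chain_indep_zero[OF sm_add[OF assms(1) sm_cmult[OF assms(2)]] _ assms(4)]) (simp add: assms(3))
  also have "chain CARD('n) 0 (\<lambda>z. f z + - 1 * g z) z = chain CARD('n) 0 f z + - 1 * chain CARD('n) 0 g z"
    using assms(4) by (simp only: chain_add[OF assms(1) sm_cmult[OF assms(2)]] chain_cmult[OF assms(2)] Int_iff)
  finally show ?thesis by simp
qed

section \<open>The ambient Laplacian\<close>

lemma sum_option: "(\<Sum>k\<in>UNIV. f k) = f None + (\<Sum>i\<in>UNIV. f (Some i))" for f :: "'n::finite option \<Rightarrow> 'a::comm_monoid_add"
  by (simp add: UNIV_option_conv sum.reindex)

text \<open>The Gram operator of \<open>Lform\<close> for the real inner product: with it, facts on
  the indefinite form become facts on inner products and adjoints.\<close>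

definition flip_sign :: "complex ^ ('n::finite option) \<Rightarrow> complex ^ ('n option)" where
  "flip_sign \<zeta> = (\<chi> k. case k of None \<Rightarrow> \<zeta> $ None | Some i \<Rightarrow> - \<zeta> $ Some i)"

lemma inner_flip_sign: "x \<bullet> flip_sign y = x $ None \<bullet> y $ None - (\<Sum>i\<in>UNIV. x $ Some i \<bullet> y $ Some i)"
  by (simp add: inner_vec_def sum_option flip_sign_def sum_negf)

lemma Lform_flip_sign: "Lform x = x \<bullet> flip_sign x"
  by (simp add: inner_flip_sign Lform_def dot_square_norm)

lemma flip_sign_sym: "x \<bullet> flip_sign y = flip_sign x \<bullet> y"
  by (simp add: inner_vec_def sum_option flip_sign_def sum_negf)

lemma flip_sign_flip_sign [simp]: "flip_sign (flip_sign x) = x"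
  by (simp add: flip_sign_def vec_eq_iff split: option.split)

lemma linear_flip_sign: "linear flip_sign"
  by (rule linearI) (auto simp: flip_sign_def vec_eq_iff split: option.split)

lemma sum_Basis_vec:
  "(\<Sum>b\<in>Basis. f b) = (\<Sum>i\<in>UNIV. \<Sum>u\<in>Basis. f (axis i u :: 'a::euclidean_space ^ 'n::finite))"
proof -
  have B: "(Basis :: ('a ^ 'n) set) = (\<lambda>(i, u). axis i u) ` (UNIV \<times> Basis)"
    by (auto simp: Basis_vec_def)
  have inj: "inj_on (\<lambda>(i, u). axis i u :: 'a ^ 'n) (UNIV \<times> Basis)"
    by (auto simp: inj_on_def axis_eq_axis)
  show ?thesis unfolding B sum.reindex[OF inj] by (simp add: sum.cartesian_product split_def)
qed

lemma Lform_axis: "Lform (axis None u) = (cmod u)\<^sup>2" "Lform (axis (Some i) u) = - (cmod u)\<^sup>2"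
proof -
  have "(\<Sum>j\<in>UNIV. (cmod (axis (Some i) u $ Some j))\<^sup>2) = (\<Sum>j\<in>UNIV. if j = i then (cmod u)\<^sup>2 else 0)"
    by (rule sum.cong) (auto simp: axis_def)
  then show "Lform (axis (Some i) u) = - (cmod u)\<^sup>2" by (simp add: Lform_def axis_def)
qed (simp add: Lform_def axis_def)

lemma flip_sign_Basis: "b \<in> Basis \<Longrightarrow> flip_sign b = Lform b *\<^sub>R b"
proof -
  assume "b \<in> Basis"
  then obtain k u where b: "b = axis k u" "u \<in> Basis" by (auto simp: Basis_vec_def)
  then have "cmod u = 1" by simp
  then have L: "Lform b = (case k of None \<Rightarrow> 1 | Some i \<Rightarrow> - 1)"
    unfolding b(1) by (cases k) (simp_all add: Lform_axis)
  show ?thesis unfolding L unfolding b(1)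
    by (cases k) (auto simp: flip_sign_def axis_def vec_eq_iff split: option.split)
qed

text \<open>On basis vectors \<open>Lform\<close> is 1 or -1, so this is the ultrahyperbolic
  Laplacian of the form in real coordinates.\<close>

definition lap :: "(complex ^ ('n::finite option) \<Rightarrow> real) \<Rightarrow> complex ^ ('n option) \<Rightarrow> real" where
  "lap F \<zeta> = (\<Sum>b\<in>Basis. Lform b * hess F \<zeta> b b)"

lemma lap_cong: "open S \<Longrightarrow> z \<in> S \<Longrightarrow> (\<And>y. y \<in> S \<Longrightarrow> f y = g y) \<Longrightarrow> lap f z = lap g z"
  unfolding lap_def using hess_cong by (metis (no_types, lifting))

lemma hess_compose_linear:
  fixes T :: "'a::euclidean_space \<Rightarrow> 'b::euclidean_space"
  assumes F: "sm U F" and T: "bounded_linear T" and z: "T \<zeta> \<in> U"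
  shows "hess (\<lambda>\<zeta>. F (T \<zeta>)) \<zeta> x y = hess F (T \<zeta>) (T x) (T y)"
proof -
  have o: "open (T -` U)"
    using sm_open[OF F] continuous_open_vimage linear_continuous_at[OF T] by blast
  have dT: "T differentiable at z" "dv v T z = T v" for z v
    using T by (simp_all add: bounded_linear_imp_differentiable dv_eqI[OF bounded_linear_imp_has_derivative])
  have c: "dv v (\<lambda>\<zeta>. G (T \<zeta>)) z = dv (T v) G (T z)" if "sm U G" "T z \<in> U" for G :: "'b \<Rightarrow> 'c" and z v
    using dv_compose[OF dT(1) sm_differentiable[OF that]] dT(2) by simp
  have "hess (\<lambda>\<zeta>. F (T \<zeta>)) \<zeta> x y = dv x (\<lambda>\<zeta>. dv (T y) F (T \<zeta>)) \<zeta>"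
    unfolding hess_def by (rule dv_cong[OF o]) (use z c[OF F] in auto)
  also have "\<dots> = hess F (T \<zeta>) (T x) (T y)"
    unfolding hess_def by (rule c[OF sm_dv[OF F] z])
  finally show ?thesis .
qed

text \<open>With \<open>J = flip_sign\<close> the second hypothesis reads
  \<open>T J T* = \<kappa> J\<close>, and the sum on the left is the bilinear form of
  \<open>T J T*\<close> at \<open>c\<close> and \<open>d\<close>.\<close>

lemma sum_Lform_Basis:
  assumes "linear T" "\<And>x. T (flip_sign (adjoint T x)) = \<kappa> *\<^sub>R flip_sign x"
  shows "(\<Sum>b\<in>Basis. Lform b * ((T b \<bullet> c) * (T b \<bullet> d))) = \<kappa> * (flip_sign c \<bullet> d)"
proof -
  let ?A = "adjoint T"
  have a: "T x \<bullet> y = x \<bullet> ?A y" for x y by (simp add: adjoint_works[OF assms(1)] inner_commute)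
  have "Lform b * ((T b \<bullet> c) * (T b \<bullet> d)) = (flip_sign (?A c) \<bullet> b) * (?A d \<bullet> b)" if "b \<in> Basis" for b
  proof -
    have "Lform b * ((T b \<bullet> c) * (T b \<bullet> d)) = (Lform b * (?A c \<bullet> b)) * (?A d \<bullet> b)"
      unfolding a by (simp add: inner_commute[of b])
    also have "Lform b * (?A c \<bullet> b) = flip_sign (?A c) \<bullet> b"
      using flip_sign_sym[of "?A c" b] flip_sign_Basis[OF that] by simp
    finally show ?thesis .
  qed
  then have "(\<Sum>b\<in>Basis. Lform b * ((T b \<bullet> c) * (T b \<bullet> d))) = (\<Sum>b\<in>Basis. (flip_sign (?A c) \<bullet> b) * (?A d \<bullet> b))" by simp
  also have "\<dots> = flip_sign (?A c) \<bullet> ?A d" by (rule euclidean_inner[symmetric])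
  also have "\<dots> = T (flip_sign (?A c)) \<bullet> d" by (simp add: a)
  finally show ?thesis by (simp add: assms(2))
qed

text \<open>The factor \<open>\<kappa>\<close> serves two uses: isometries of the form
  (\<open>\<kappa> = 1\<close>) give equivariance, and complex scalars \<open>c\<close>
  (\<open>\<kappa> = |c|^2\<close>) carry a computation from the slice
  \<open>\<zeta>\<^sub>0 = 1\<close> to the whole cone.\<close>

lemma lap_compose:
  fixes T :: "complex ^ ('n::finite option) \<Rightarrow> complex ^ ('n option)"
  assumes F: "sm U F" and T: "linear T" "\<And>x. T (flip_sign (adjoint T x)) = \<kappa> *\<^sub>R flip_sign x" and z: "T \<zeta> \<in> U"
  shows "lap (\<lambda>\<zeta>. F (T \<zeta>)) \<zeta> = \<kappa> * lap F (T \<zeta>)"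
proof -
  have bl: "bounded_linear T" using T(1) by (rule linear_conv_bounded_linear[THEN iffD1])
  define H where "H c d = hess F (T \<zeta>) c d" for c d
  have "lap (\<lambda>\<zeta>. F (T \<zeta>)) \<zeta> = (\<Sum>b\<in>Basis. \<Sum>c\<in>Basis. \<Sum>d\<in>Basis. H c d * (Lform b * ((T b \<bullet> c) * (T b \<bullet> d))))"
    unfolding lap_def hess_compose_linear[OF F bl z] hess_expand[OF F z, of "T _"] H_def
    by (simp add: sum_distrib_left mult_ac)
  also have "\<dots> = (\<Sum>c\<in>Basis. \<Sum>d\<in>Basis. \<Sum>b\<in>Basis. H c d * (Lform b * ((T b \<bullet> c) * (T b \<bullet> d))))"
    by (subst sum.swap, rule sum.cong[OF refl], rule sum.swap)
  also have "\<dots> = (\<Sum>c\<in>Basis. \<Sum>d\<in>Basis. H c d * (\<kappa> * (flip_sign c \<bullet> d)))"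
    unfolding sum_distrib_left[symmetric] sum_Lform_Basis[OF T] ..
  also have "\<dots> = (\<Sum>c\<in>Basis. \<kappa> * (Lform c * H c c))"
  proof (rule sum.cong[OF refl])
    fix c :: "complex ^ ('n option)" assume c: "c \<in> Basis"
    have "(\<Sum>d\<in>Basis. H c d * (\<kappa> * (flip_sign c \<bullet> d))) = (\<Sum>d\<in>Basis. if d = c then \<kappa> * (Lform c * H c c) else 0)"
      by (rule sum.cong) (auto simp: flip_sign_Basis[OF c] inner_Basis[OF c])
    then show "(\<Sum>d\<in>Basis. H c d * (\<kappa> * (flip_sign c \<bullet> d))) = \<kappa> * (Lform c * H c c)"
      using c by (simp add: sum.delta)
  qed
  finally show ?thesis unfolding lap_def H_def by (simp add: sum_distrib_left)
qed

lemma linear_smult: "linear (\<lambda>x :: complex ^ 'n. c *s x)"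
  by (rule linearI) (simp_all add: vec_eq_iff algebra_simps scaleR_conv_of_real[where 'a = complex])

lemma smult_conformal:
  fixes x :: "complex ^ ('n::finite option)"
  shows "c *s flip_sign (adjoint ((*s) c) x) = (cmod c)\<^sup>2 *\<^sub>R flip_sign x"
proof -
  have "adjoint ((*s) c) = (\<lambda>x :: complex ^ ('n option). cnj c *s x)"
    by (rule adjoint_unique) (simp add: inner_vec_complex mult_ac)
  moreover have "c * (cnj c * a) = (cmod c)\<^sup>2 *\<^sub>R a" for a
    by (simp only: scaleR_conv_of_real[where 'a = complex] complex_norm_square mult.assoc)
  ultimately show ?thesis
    by (simp add: flip_sign_def vec_eq_iff split: option.split)
qed

lemma Lform_polarization:
  fixes T :: "complex ^ ('n::finite option) \<Rightarrow> complex ^ ('n option)"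
  assumes T: "linear T" and L: "\<And>x. Lform (T x) = Lform x"
  shows "T x \<bullet> flip_sign (T y) = x \<bullet> flip_sign y"
proof -
  have pol: "2 * (x \<bullet> flip_sign y) = Lform (x + y) - Lform x - Lform y" for x y :: "complex ^ ('n option)"
    using flip_sign_sym[of y x] unfolding Lform_flip_sign linear_add[OF linear_flip_sign] inner_add_left inner_add_right
    by (simp add: inner_commute)
  show "T x \<bullet> flip_sign (T y) = x \<bullet> flip_sign y" 
    using pol[of "T x" "T y"] pol[of x y] by (simp add: L linear_add[OF T, symmetric])
qed

text \<open>Preservation of the form says \<open>T* J T = J\<close>, so \<open>J T* J\<close> is a
  left inverse of \<open>T\<close>. In finite dimension it is also a right inverse, which is the
  form that \<open>lap_compose\<close> asks for.\<close>

lemma preserving_conformal: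
  fixes T :: "complex ^ ('n::finite option) \<Rightarrow> complex ^ ('n option)"
  assumes T: "linear T" and L: "\<And>x. Lform (T x) = Lform x"
  shows "T (flip_sign (adjoint T x)) = 1 *\<^sub>R flip_sign x"
proof -
  let ?A = "adjoint T"
  have a: "x \<bullet> T y = ?A x \<bullet> y" for x y using adjoint_works[OF T, of y x] by (simp add: inner_commute)
  have "T x \<bullet> flip_sign (T y) = x \<bullet> flip_sign y" for x y by (rule Lform_polarization[OF T L])
  then have "x \<bullet> ?A (flip_sign (T y)) = x \<bullet> flip_sign y" for x y
    by (simp add: adjoint_works[OF T])
  then have "?A (flip_sign (T y)) = flip_sign y" for y by (rule vector_eq_ldot[THEN iffD1, OF allI])
  then have inv: "flip_sign (?A (flip_sign (T y))) = y" for y by simp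
  have lin: "linear (\<lambda>y. flip_sign (?A (flip_sign y)))"
    using linear_compose[OF linear_compose[OF linear_flip_sign adjoint_linear[OF T]] linear_flip_sign] by (simp add: o_def)
  have "T \<circ> (\<lambda>y. flip_sign (?A (flip_sign y))) = id"
    by (rule linear_inverse_left[THEN iffD1, OF lin T]) (auto simp: inv)
  then have "T (flip_sign (?A (flip_sign (flip_sign x)))) = flip_sign x" by (metis comp_apply id_apply)
  then show ?thesis by simp
qed

section \<open>Affine coordinates on the cone and homogeneous extensions\<close>

definition aff :: "complex ^ ('n::finite option) \<Rightarrow> complex ^ 'n" where
  "aff \<zeta> = (\<chi> i. \<zeta> $ Some i / \<zeta> $ None)"

lemma homog_ext_aff: "homog_ext p f \<zeta> = ((cmod (\<zeta> $ None))\<^sup>2) powi p * f (aff \<zeta>)"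
  by (simp add: homog_ext_def aff_def)

lemma lift1_nth [simp]: "lift1 z $ None = 1" "lift1 z $ Some i = z $ i"
  by (simp_all add: lift1_def)

lemma aff_lift1 [simp]: "aff (lift1 z) = z"
  by (simp add: aff_def vec_eq_iff)

lemma aff_smult: "c \<noteq> 0 \<Longrightarrow> aff (c *s \<zeta>) = aff \<zeta>"
  by (simp add: aff_def vec_eq_iff)

lemma smult_lift1_aff: "\<zeta> $ None \<noteq> 0 \<Longrightarrow> \<zeta> $ None *s lift1 (aff \<zeta>) = \<zeta>"
  by (auto simp: vec_eq_iff aff_def lift1_def split: option.split)

definition cone :: "(complex ^ 'n::finite) set \<Rightarrow> (complex ^ ('n option)) set" where
  "cone W = {\<zeta>. \<zeta> $ None \<noteq> 0} \<inter> aff -` W"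

lemma lift1_cone: "lift1 z \<in> cone W \<longleftrightarrow> z \<in> W"
  by (simp add: cone_def)

lemma sm_inverse_complex:
  fixes f :: "'a::euclidean_space \<Rightarrow> complex"
  assumes "sm S f" "\<And>x. x \<in> S \<Longrightarrow> f x \<noteq> 0"
  shows "sm S (\<lambda>x. inverse (f x))"
proof (rule sm_cong)
  show "sm S (\<lambda>x. inverse ((norm (f x))\<^sup>2) *\<^sub>R cnj (f x))"
    by (intro sm_scaleR sm_inverse_real sm_norm_sq sm_cnj assms(1)) (use assms(2) in auto)
  show "inverse ((norm (f x))\<^sup>2) *\<^sub>R cnj (f x) = inverse (f x)" if "x \<in> S" for x
    unfolding scaleR_conv_of_real[where 'a = complex] of_real_inverse complex_norm_square using assms(2)[OF that]
    by (simp add: field_simps)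
qed

lemma open_None: "open {\<zeta> :: complex ^ ('n::finite option). \<zeta> $ None \<noteq> 0}"
  by (intro open_Collect_neq continuous_intros)

lemma sm_aff: "sm {\<zeta> :: complex ^ ('n::finite option). \<zeta> $ None \<noteq> 0} aff"
  by (rule sm_vec[OF open_None])
     (auto simp: aff_def divide_inverse intro!: sm_mult sm_inverse_complex sm_vec_nth sm_ident open_None)

lemma open_cone: "open W \<Longrightarrow> open (cone W)"
  unfolding cone_def by (rule continuous_open_preimage[OF sm_continuous_on[OF sm_aff] open_None])

lemma sm_homog_ext:
  assumes "sm W f"
  shows "sm (cone W) (homog_ext p f)"
proof -
  note o = open_cone[OF sm_open[OF assms]]
  show ?thesis unfolding homog_ext_aff[abs_def]
    by (intro sm_mult sm_powi sm_norm_sq sm_vec_nth sm_ident o sm_compose[OF assms] sm_subset[OF sm_aff])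
       (auto simp: cone_def)
qed

lemma hess_line:
  fixes F :: "'a::euclidean_space \<Rightarrow> real"
  assumes F: "sm U F" and x: "x \<in> U"
    and 1: "\<forall>\<^sub>F t in nhds 0. ((\<lambda>t. F (x + t *\<^sub>R v)) has_real_derivative \<psi> t) (at t)"
    and 2: "(\<psi> has_real_derivative c) (at 0)"
  shows "hess F x v v = c"
proof -
  have ln: "((\<lambda>t. x + t *\<^sub>R v) has_vector_derivative v) (at t)" for t
    by (auto intro!: derivative_eq_intros)
  have d: "((\<lambda>t. G (x + t *\<^sub>R v)) has_real_derivative dv v G (x + t *\<^sub>R v)) (at t)"
    if "sm U G" "x + t *\<^sub>R v \<in> U" for G :: "'a \<Rightarrow> real" and t
    by (rule has_real_derivative_curve[OF ln sm_differentiable[OF that]])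
  have "open ((\<lambda>t. x + t *\<^sub>R v) -` U)"
    by (intro continuous_open_vimage sm_open[OF F] continuous_intros)
  then have "\<forall>\<^sub>F t in nhds 0. x + t *\<^sub>R v \<in> U"
    using x eventually_nhds_in_open[of "(\<lambda>t. x + t *\<^sub>R v) -` U" 0] by simp
  with 1 have "\<forall>\<^sub>F t in nhds 0. dv v F (x + t *\<^sub>R v) = \<psi> t"
    by eventually_elim (use d[OF F] DERIV_unique in blast)
  from DERIV_cong_ev[OF refl this refl] 2
  have "((\<lambda>t. dv v F (x + t *\<^sub>R v)) has_real_derivative c) (at 0)" by simp
  moreover have "((\<lambda>t. dv v F (x + t *\<^sub>R v)) has_real_derivative hess F x v v) (at 0)"
    using d[OF sm_dv[OF F], of 0 v] x by (simp add: hess_def)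
  ultimately show ?thesis using DERIV_unique by blast
qed

text \<open>A line in the direction of \<open>\<zeta>\<^sub>0\<close> projects to a curve in affine
  coordinates traversed at varying velocity, so the acceleration \<open>c''\<close> contributes a
  first order term.\<close>

lemma second_derivative_curve:
  fixes f :: "'a::euclidean_space \<Rightarrow> real"
  assumes f: "sm W f" and c0: "c 0 \<in> W" and c: "\<And>t. t \<in> I \<Longrightarrow> (c has_vector_derivative c' t) (at t)"
    and I: "open I" "0 \<in> I" and c': "(c' has_vector_derivative c'') (at 0)"
  shows "((\<lambda>t. dv (c' t) f (c t)) has_real_derivative (dv c'' f (c 0) + hess f (c 0) (c' 0) (c' 0))) (at 0)"
proof -
  have chain: "continuous_on I c"
    using c has_vector_derivative_continuous continuous_at_imp_continuous_on by blast
  then have "open (I \<inter> c -` W)" by (rule continuous_open_preimage[OF _ I(1) sm_open[OF f]])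
  then have ev: "\<forall>\<^sub>F t in nhds 0. t \<in> I \<inter> c -` W"
    by (rule eventually_nhds_in_open) (use I c0 in auto)
  have "((\<lambda>t. \<Sum>b\<in>Basis. (c' t \<bullet> b) * dv b f (c t)) has_real_derivative
      (\<Sum>b\<in>Basis. (c'' \<bullet> b) * dv b f (c 0) + dv (c' 0) (dv b f) (c 0) * (c' 0 \<bullet> b))) (at 0)"
  proof (rule DERIV_sum)
    fix b :: 'a assume "b \<in> Basis"
    have "((\<lambda>t. c' t \<bullet> b) has_real_derivative (c'' \<bullet> b)) (at 0)"
      using bounded_linear.has_vector_derivative[OF bounded_linear_inner_left c']
      by (simp add: has_real_derivative_iff_has_vector_derivative)
    moreover have "((\<lambda>t. dv b f (c t)) has_real_derivative dv (c' 0) (dv b f) (c 0)) (at 0)"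
      by (rule has_real_derivative_curve[OF c[OF I(2)] sm_differentiable[OF sm_dv[OF f] c0]])
    ultimately show "((\<lambda>t. (c' t \<bullet> b) * dv b f (c t)) has_real_derivative
      (c'' \<bullet> b) * dv b f (c 0) + dv (c' 0) (dv b f) (c 0) * (c' 0 \<bullet> b)) (at 0)"
      by (rule DERIV_mult)
  qed
  also have "(\<Sum>b\<in>Basis. (c'' \<bullet> b) * dv b f (c 0) + dv (c' 0) (dv b f) (c 0) * (c' 0 \<bullet> b))
      = (\<Sum>b\<in>Basis. (c'' \<bullet> b) *\<^sub>R dv b f (c 0)) + (\<Sum>b\<in>Basis. (c' 0 \<bullet> b) *\<^sub>R dv b (dv (c' 0) f) (c 0))"
    by (simp add: sum.distrib dv_commute[OF f c0, of "c' 0"] mult.commute)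
  also have "\<dots> = dv c'' f (c 0) + hess f (c 0) (c' 0) (c' 0)"
    unfolding hess_def dv_sum_Basis[OF sm_differentiable[OF f c0], of c'', symmetric]
      dv_sum_Basis[OF sm_differentiable[OF sm_dv[OF f] c0], of "c' 0", symmetric] ..
  finally have *: "((\<lambda>t. \<Sum>b\<in>Basis. (c' t \<bullet> b) * dv b f (c t)) has_real_derivative
      (dv c'' f (c 0) + hess f (c 0) (c' 0) (c' 0))) (at 0)" .
  have "\<forall>\<^sub>F t in nhds 0. dv (c' t) f (c t) = (\<Sum>b\<in>Basis. (c' t \<bullet> b) * dv b f (c t))"
    using ev
  proof eventually_elim
    case (elim t)
    then have "f differentiable at (c t)" using sm_differentiable[OF f] by auto
    from dv_sum_Basis[OF this, of "c' t"] show ?case by simp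
  qed
  from DERIV_cong_ev[OF refl this refl] * show ?thesis by simp
qed

lemma one_plus_unit_nonzero: "cmod u = 1 \<Longrightarrow> \<bar>t\<bar> < 1 \<Longrightarrow> 1 + of_real t * u \<noteq> (0::complex)"
proof
  assume u: "cmod u = 1" "\<bar>t\<bar> < 1" "1 + of_real t * u = 0"
  then have "of_real t * u = - 1" by (simp add: eq_neg_iff_add_eq_0 add.commute)
  then have "cmod (of_real t * u) = 1" by simp
  with u show False by (simp add: norm_mult)
qed

text \<open>Along \<open>lift1 z + t *\<^sub>R axis None u\<close> the extension is
  \<open>|1 + t * u|^(2 * p) * f (z / (1 + t * u))\<close>, that is \<open>a t * f (c t)\<close>;
  the formula is the second derivative of this product at \<open>t = 0\<close>.\<close>

lemma hess_homog_ext_None: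
  fixes f :: "complex ^ 'n::finite \<Rightarrow> real"
  assumes f: "sm W f" and z: "z \<in> W" and u: "cmod u = 1"
  shows "hess (homog_ext p f) (lift1 z) (axis None u) (axis None u)
    = (4 * of_int p * (of_int p - 1) * (Re u)\<^sup>2 + 2 * of_int p) * f z - 4 * of_int p * Re u * dv (u *s z) f z
      + 2 * dv ((u * u) *s z) f z + hess f z (u *s z) (u *s z)"
proof -
  let ?x = "lift1 z" and ?v = "axis None u :: complex ^ ('n option)"
  define r where "r t = 1 + 2 * t * Re u + t\<^sup>2" for t
  define a a' where "a t = r t powi p" and "a' t = of_int p * r t powi (p - 1) * (2 * Re u + 2 * t)" for t
  define k k' where "k t = inverse (1 + of_real t * u)" and "k' t = - (u * (inverse (1 + of_real t * u))\<^sup>2)" for t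
  define c c' where "c t = k t *s z" and "c' t = k' t *s z" for t
  \<comment> \<open>For \<open>|t| < 1\<close> and \<open>|u| = 1\<close> the coordinate
    \<open>1 + t * u\<close> cannot vanish.\<close>
  define I where "I = {-1 <..< 1 :: real}"
  have I: "open I" "0 \<in> I" by (auto simp: I_def)
  have nz: "1 + of_real t * u \<noteq> 0" if "t \<in> I" for t
    using one_plus_unit_nonzero[OF u, of t] that by (auto simp: I_def abs_less_iff)
  have r: "(cmod (1 + of_real t * u))\<^sup>2 = r t" for t
  proof -
    have "(Re u)\<^sup>2 + (Im u)\<^sup>2 = 1" using u cmod_power2[of u] by simp
    then have "t\<^sup>2 * ((Re u)\<^sup>2 + (Im u)\<^sup>2) = t\<^sup>2" by simp
    then show ?thesis unfolding cmod_power2 r_def by (simp add: algebra_simps power2_eq_square)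
  qed
  have r0: "r t \<noteq> 0" if "t \<in> I" for t using nz[OF that] r[of t] by auto
  have F: "homog_ext p f (?x + t *\<^sub>R ?v) = a t * f (c t)" if "t \<in> I" for t
  proof -
    have N: "(?x + t *\<^sub>R ?v) $ None = 1 + of_real t * u" by (simp add: axis_def) (simp add: scaleR_conv_of_real[where 'a = complex])
    have "aff (?x + t *\<^sub>R ?v) = c t"
      by (simp add: aff_def N c_def k_def vec_eq_iff) (simp add: axis_def divide_inverse mult.commute scaleR_conv_of_real[where 'a = complex])
    then show ?thesis unfolding homog_ext_aff N r a_def by simp
  qed
  have rD: "(r has_real_derivative (2 * Re u + 2 * t)) (at t)" for t
    unfolding r_def by (auto intro!: derivative_eq_intros)
  have pD: "((\<lambda>t. r t powi q) has_real_derivative of_int q * r t powi (q - 1) * (2 * Re u + 2 * t)) (at t)"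
    if "t \<in> I" for t q
    using DERIV_power_int[OF rD disjI2[OF r0[OF that]], of q] by simp
  have kD: "(k has_vector_derivative k' t) (at t)" if "t \<in> I" for t
    unfolding k_def k'_def
    by (rule has_vector_derivative_real_field) (use nz[OF that] in \<open>auto intro!: derivative_eq_intros simp: power2_eq_square\<close>)
  have k'D: "(k' has_vector_derivative 2 * u * u) (at 0)"
    unfolding k'_def
    by (rule has_vector_derivative_real_field) (auto intro!: derivative_eq_intros simp: power2_eq_square)
  have bl: "bounded_linear (\<lambda>w. w *s z)"
    by (rule linear_conv_bounded_linear[THEN iffD1], rule linearI) (simp_all add: vec_eq_iff algebra_simps scaleR_conv_of_real[where 'a = complex])
  have cD: "(c has_vector_derivative c' t) (at t)" if "t \<in> I" for t
    unfolding c_def c'_def by (rule bounded_linear.has_vector_derivative[OF bl kD[OF that]])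
  have c'D: "(c' has_vector_derivative (2 * u * u) *s z) (at 0)"
    unfolding c'_def by (rule bounded_linear.has_vector_derivative[OF bl k'D])
  have c0: "c 0 = z" by (simp add: c_def k_def)
  have c'0: "c' 0 = - (u *s z)" by (simp add: c'_def k'_def vec_eq_iff)
  have evI: "\<forall>\<^sub>F t in nhds 0. t \<in> I \<inter> c -` W"
    by (rule eventually_nhds_in_open, rule continuous_open_preimage[OF _ I(1) sm_open[OF f]])
       (use cD has_vector_derivative_continuous continuous_at_imp_continuous_on I c0 z in blast)+
  define \<psi> where "\<psi> t = a' t * f (c t) + dv (c' t) f (c t) * a t" for t
  have 1: "\<forall>\<^sub>F t in nhds 0. ((\<lambda>t. homog_ext p f (?x + t *\<^sub>R ?v)) has_real_derivative \<psi> t) (at t)"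
    using evI
  proof eventually_elim
    case (elim t)
    then have t: "t \<in> I" "c t \<in> W" by auto
    have m: "((\<lambda>t. a t * f (c t)) has_real_derivative \<psi> t) (at t)"
      unfolding \<psi>_def a_def a'_def
      by (rule DERIV_mult[OF pD[OF t(1)] has_real_derivative_curve[OF cD[OF t(1)] sm_differentiable[OF f t(2)]]])
    have ev: "\<forall>\<^sub>F s in nhds t. homog_ext p f (?x + s *\<^sub>R ?v) = a s * f (c s)"
      using eventually_nhds_in_open[OF I(1) t(1)] by eventually_elim (rule F)
    show ?case unfolding DERIV_cong_ev[OF refl ev refl] by (rule m)
  qed
  have a'D: "(a' has_real_derivative
      (of_int p * (of_int (p - 1) * r 0 powi (p - 1 - 1) * (2 * Re u + 2 * 0)) * (2 * Re u + 2 * 0) + 2 * (of_int p * r 0 powi (p - 1)))) (at 0)"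
    unfolding a'_def
    by (rule DERIV_mult[OF DERIV_cmult[OF pD[OF I(2)]]]) (auto intro!: derivative_eq_intros)
  have c0W: "c 0 \<in> W" using c0 z by simp
  note fD = has_real_derivative_curve[OF cD[OF I(2)] sm_differentiable[OF f c0W]]
  have 2: "(\<psi> has_real_derivative
     ((of_int p * (of_int (p - 1) * r 0 powi (p - 1 - 1) * (2 * Re u + 2 * 0)) * (2 * Re u + 2 * 0) + 2 * (of_int p * r 0 powi (p - 1))) * f (c 0)
       + dv (c' 0) f (c 0) * a' 0 +
      ((dv ((2 * u * u) *s z) f (c 0) + hess f (c 0) (c' 0) (c' 0)) * a 0
       + of_int p * r 0 powi (p - 1) * (2 * Re u + 2 * 0) * dv (c' 0) f (c 0)))) (at 0)"
    unfolding \<psi>_def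
    by (rule DERIV_add[OF DERIV_mult[OF a'D fD] DERIV_mult[OF
          second_derivative_curve[OF f c0W cD I c'D] pD[OF I(2), of p, folded a_def]]])
  have d: "f differentiable at z" "\<And>v. dv v f differentiable at z"
    using sm_differentiable[OF f z] sm_differentiable[OF sm_dv[OF f] z] by auto
  have neg: "dv (- y) f x = - dv y f x" if "x \<in> W" for x y
    using dv_minus_dir[OF sm_differentiable[OF f that]] .
  have hneg: "hess f z (- y) (- y) = hess f z y y" for y
  proof -
    have "hess f z (- y) (- y) = - dv y (dv (- y) f) z"
      unfolding hess_def by (rule dv_minus_dir[OF d(2)])
    also have "dv y (dv (- y) f) z = dv y (\<lambda>x. - dv y f x) z"
      by (rule dv_cong[OF sm_open[OF f] z neg])
    also have "dv y (\<lambda>x. - dv y f x) z = - hess f z y y"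
      unfolding hess_def by (rule dv_linear_compose[OF bounded_linear_minus[OF bounded_linear_ident] d(2)])
    finally show ?thesis by simp
  qed
  have "(2 * u * u) *s z = 2 *\<^sub>R ((u * u) *s z)" by (simp add: vec_eq_iff scaleR_conv_of_real[where 'a = complex])
  then have dbl: "dv ((2 * u * u) *s z) f z = 2 * dv ((u * u) *s z) f z"
    using dv_scaleR_dir[OF d(1), of 2 "(u * u) *s z"] by simp
  have r00: "r 0 = 1" by (simp add: r_def)
  show ?thesis
    unfolding hess_line[OF sm_homog_ext[OF f] _ 1 2, unfolded lift1_cone, OF z]
    unfolding c0 c'0 hneg dbl neg[OF z] a_def a'_def r00
    by (simp add: algebra_simps power2_eq_square)
qed

lemma hess_homog_ext_Some:
  fixes f :: "complex ^ 'n::finite \<Rightarrow> real"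
  assumes f: "sm W f" and z: "z \<in> W"
  shows "hess (homog_ext p f) (lift1 z) (axis (Some i) u) (axis (Some i) u) = hess f z (axis i u) (axis i u)"
proof -
  have F: "homog_ext p f (lift1 z + t *\<^sub>R axis (Some i) u) = f (z + t *\<^sub>R axis i u)" for t
  proof -
    have N: "(lift1 z + t *\<^sub>R axis (Some i) u) $ None = 1" by (simp add: axis_def)
    have "aff (lift1 z + t *\<^sub>R axis (Some i) u) = z + t *\<^sub>R axis i u"
      by (simp add: aff_def N vec_eq_iff) (simp add: axis_def)
    then show ?thesis unfolding homog_ext_aff N by simp
  qed
  have ln: "((\<lambda>t. z + t *\<^sub>R axis i u) has_vector_derivative axis i u) (at t)" for t
    by (auto intro!: derivative_eq_intros)
  have d: "((\<lambda>t. G (z + t *\<^sub>R axis i u)) has_real_derivative dv (axis i u) G (z + t *\<^sub>R axis i u)) (at t)"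
    if "sm W G" "z + t *\<^sub>R axis i u \<in> W" for G :: "complex ^ 'n \<Rightarrow> real" and t
    by (rule has_real_derivative_curve[OF ln sm_differentiable[OF that]])
  have "open ((\<lambda>t. z + t *\<^sub>R axis i u) -` W)"
    by (intro continuous_open_vimage sm_open[OF f] continuous_intros)
  then have ev: "\<forall>\<^sub>F t in nhds 0. z + t *\<^sub>R axis i u \<in> W"
    using z eventually_nhds_in_open[of "(\<lambda>t. z + t *\<^sub>R axis i u) -` W" 0] by simp
  show ?thesis
  proof (rule hess_line[OF sm_homog_ext[OF f]])
    show "lift1 z \<in> cone W" using z by (simp add: lift1_cone)
    show "\<forall>\<^sub>F t in nhds 0. ((\<lambda>t. homog_ext p f (lift1 z + t *\<^sub>R axis (Some i) u)) has_real_derivative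
        dv (axis i u) f (z + t *\<^sub>R axis i u)) (at t)"
      unfolding F using ev by eventually_elim (rule d[OF f])
    show "((\<lambda>t. dv (axis i u) f (z + t *\<^sub>R axis i u)) has_real_derivative hess f z (axis i u) (axis i u)) (at 0)"
      using d[OF sm_dv[OF f], of 0] z by (simp add: hess_def)
  qed
qed

text \<open>The two real directions of \<open>\<zeta>\<^sub>0\<close> contribute
  \<open>2 * dv z f z\<close> and \<open>- 2 * dv z f z\<close>, which cancel, and their multiples
  of \<open>f z\<close> add up to \<open>4 * p^2\<close>. The directions of the other coordinates
  give the Euclidean Laplacian with a minus sign.\<close>

lemma lap_homog_ext_lift1:
  fixes f :: "complex ^ 'n::finite \<Rightarrow> real"
  assumes f: "sm W f" and z: "z \<in> W"
  shows "lap (homog_ext p f) (lift1 z) = Qop (of_int p) f z"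
proof -
  note d = sm_differentiable[OF f z]
  have B: "(\<Sum>u\<in>Basis. g u) = g 1 + g \<i>" for g :: "complex \<Rightarrow> real"
    by (simp add: Basis_complex_def)
  have "lap (homog_ext p f) (lift1 z)
    = (hess (homog_ext p f) (lift1 z) (axis None 1) (axis None 1) + hess (homog_ext p f) (lift1 z) (axis None \<i>) (axis None \<i>))
      - (\<Sum>i\<in>UNIV. \<Sum>u\<in>Basis. hess f z (axis i u) (axis i u))"
    unfolding lap_def sum_Basis_vec sum_option B Lform_axis hess_homog_ext_Some[OF f z]
    by (simp add: sum_negf sum_subtractf sum.distrib)
  also have "(\<Sum>i\<in>UNIV. \<Sum>u\<in>Basis. hess f z (axis i u) (axis i u)) = (\<Sum>b\<in>Basis. hess f z b b)"
    by (rule sum_Basis_vec[symmetric])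
  also have "hess (homog_ext p f) (lift1 z) (axis None 1) (axis None 1) = (4 * of_int p * (of_int p - 1) + 2 * of_int p) * f z
    - 4 * of_int p * dv z f z + 2 * dv z f z + hess f z z z"
    by (simp add: hess_homog_ext_None[OF f z])
  also have "hess (homog_ext p f) (lift1 z) (axis None \<i>) (axis None \<i>) = 2 * of_int p * f z - 2 * dv z f z + hess f z (imul z) (imul z)"
  proof -
    have "(\<i> * \<i>) *s z = - z" by (simp add: vec_eq_iff)
    then show ?thesis unfolding hess_homog_ext_None[OF f z, of \<i>, simplified] imul_def[symmetric]
      by (simp add: dv_minus_dir[OF d])
  qed
  finally show ?thesis by (simp add: Qop_def algebra_simps power2_eq_square)
qed

lemma homog_ext_smult: "c \<noteq> 0 \<Longrightarrow> homog_ext p f (c *s \<zeta>) = ((cmod c)\<^sup>2) powi p * homog_ext p f \<zeta>"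
  by (simp add: homog_ext_aff aff_smult norm_mult power_mult_distrib power_int_mult_distrib)

text \<open>Scaling by \<open>c = \<zeta>\<^sub>0\<close> reduces to the slice
  \<open>\<zeta>\<^sub>0 = 1\<close>: the extension scales by \<open>|c|^(2 * p)\<close> and the
  Laplacian by \<open>|c|^2\<close>, so the result has weight \<open>p - 1\<close>.\<close>

lemma lap_homog_ext:
  fixes f :: "complex ^ 'n::finite \<Rightarrow> real"
  assumes f: "sm W f" and z: "\<zeta> \<in> cone W"
  shows "lap (homog_ext p f) \<zeta> = homog_ext (p - 1) (Qop (of_int p) f) \<zeta>"
proof -
  define c z where "c = \<zeta> $ None" and "z = aff \<zeta>"
  have c: "c \<noteq> 0" and zW: "z \<in> W" and zeta: "\<zeta> = c *s lift1 z"
    using z smult_lift1_aff[of \<zeta>] by (auto simp: c_def z_def cone_def)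
  have sF: "sm (cone W) (homog_ext p f)" by (rule sm_homog_ext[OF f])
  have l: "lift1 z \<in> cone W" using zW by (simp add: lift1_cone)
  have "lap (\<lambda>\<zeta>. homog_ext p f (c *s \<zeta>)) (lift1 z) = (cmod c)\<^sup>2 * lap (homog_ext p f) \<zeta>"
    using lap_compose[OF sF linear_smult smult_conformal] z unfolding zeta by blast
  also have "lap (\<lambda>\<zeta>. homog_ext p f (c *s \<zeta>)) (lift1 z) = ((cmod c)\<^sup>2) powi p * lap (homog_ext p f) (lift1 z)"
    unfolding homog_ext_smult[OF c] lap_def hess_linear_compose[OF bounded_linear_mult_right sF l]
    by (simp add: sum_distrib_left mult_ac)
  also have "lap (homog_ext p f) (lift1 z) = Qop (of_int p) f z" by (rule lap_homog_ext_lift1[OF f zW])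
  finally have "lap (homog_ext p f) \<zeta> = ((cmod c)\<^sup>2) powi p / (cmod c)\<^sup>2 * Qop (of_int p) f z"
    using c by (simp add: field_simps)
  then show ?thesis using c by (simp add: homog_ext_aff c_def[symmetric] z_def[symmetric] power_int_diff)
qed

text \<open>The induction runs on the cone, where every factor of \<open>chain\<close> is the
  ambient Laplacian and commutes with the isometry \<open>T\<close>; in affine coordinates
  \<open>T\<close> would be fractional linear with a weight factor. \<open>W\<close> is the locus
  whose image stays in the affine chart.\<close>

lemma chain_transform:
  fixes f :: "complex ^ 'n::finite \<Rightarrow> real" and T :: "complex ^ ('n option) \<Rightarrow> complex ^ ('n option)"
  assumes f: "sm UNIV f" and T: "linear T" "\<And>c x. T (c *s x) = c *s T x" and L: "\<And>x. Lform (T x) = Lform x"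
    and W: "W = {z. T (lift1 z) $ None \<noteq> 0}" and oW: "open W" and g: "sm W g"
    and eq: "\<And>z. z \<in> W \<Longrightarrow> g z = f (aff (T (lift1 z)))"
    and z: "z \<in> W"
  shows "chain k 0 g z = homog_ext (- int k) (chain k 0 f) (T (lift1 z))"
proof -
  have T0: "T \<zeta> \<in> cone UNIV" if "\<zeta> \<in> cone W" for \<zeta>
  proof -
    have n: "\<zeta> $ None \<noteq> 0" "aff \<zeta> \<in> W" using that by (auto simp: cone_def)
    have "T \<zeta> = \<zeta> $ None *s T (lift1 (aff \<zeta>))" using T(2) smult_lift1_aff[OF n(1)] by metis
    then show ?thesis using n by (simp add: cone_def W)
  qed
  have "homog_ext (- int k) (chain k 0 g) \<zeta> = homog_ext (- int k) (chain k 0 f) (T \<zeta>)" if "\<zeta> \<in> cone W" for \<zeta>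
    using that
  proof (induction k arbitrary: \<zeta>)
    case 0
    then have n: "\<zeta> $ None \<noteq> 0" "aff \<zeta> \<in> W" by (auto simp: cone_def)
    have "aff (T \<zeta>) = aff (T (lift1 (aff \<zeta>)))"
      using T(2) smult_lift1_aff[OF n(1)] aff_smult[OF n(1)] by metis
    then show ?case using eq[OF n(2)] by (simp add: homog_ext_aff)
  next
    case (Suc k)
    have "lap (homog_ext (- int k) (chain k 0 g)) \<zeta> = lap (\<lambda>\<zeta>. homog_ext (- int k) (chain k 0 f) (T \<zeta>)) \<zeta>"
      by (rule lap_cong[OF open_cone[OF oW] Suc.prems Suc.IH])
    also have "\<dots> = 1 * lap (homog_ext (- int k) (chain k 0 f)) (T \<zeta>)"
      by (rule lap_compose[OF sm_homog_ext[OF sm_chain[OF f]] T(1) preserving_conformal[OF T(1) L] T0[OF Suc.prems]])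
    moreover have "- int (Suc k) = - int k - 1" by simp
    ultimately show ?case
      unfolding lap_homog_ext[OF sm_chain[OF g] Suc.prems] lap_homog_ext[OF sm_chain[OF f] T0[OF Suc.prems]] chain.simps
      by (simp only:) simp
  qed
  from this[of "lift1 z"] show ?thesis using z by (simp add: lift1_cone homog_ext_aff[of _ _ "lift1 z"])
qed

section \<open>Isometries acting on the sphere\<close>

lemma sm_lift1: "open S \<Longrightarrow> sm S (lift1 :: complex ^ 'n::finite \<Rightarrow> complex ^ ('n option))"
proof (rule sm_vec)
  assume o: "open S"
  show "sm S (\<lambda>x :: complex ^ 'n. lift1 x $ k)" for k
    using sm_const[OF o, of "1 :: complex"] sm_vec_nth[OF sm_ident[OF o]] by (cases k) simp_all
qed

lemma Lform_smult: "Lform (c *s x) = (cmod c)\<^sup>2 * Lform x"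
  by (simp add: Lform_def norm_mult power_mult_distrib right_diff_distrib sum_distrib_left)

lemma Lform_lift1: "Lform (lift1 z) = rho z"
  unfolding Lform_def rho_def inner_vec_def lift1_nth dot_square_norm by simp

lemma sphere_iff_rho: "z \<in> sphereS \<longleftrightarrow> rho z = 0"
  by (simp add: rho_def sphereS_def norm_eq_1)

text \<open>The form is negative definite on \<open>\<zeta>\<^sub>0 = 0\<close>, so a null vector
  with \<open>\<zeta>\<^sub>0 = 0\<close> is zero; but \<open>T\<close> kills no nonzero vector,
  since it preserves a nondegenerate form.\<close>

lemma transform_None_nonzero:
  fixes T :: "complex ^ ('n::finite option) \<Rightarrow> complex ^ ('n option)"
  assumes T: "linear T" and L: "\<And>x. Lform (T x) = Lform x" and z: "z \<in> sphereS"
  shows "T (lift1 z) $ None \<noteq> 0"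
proof
  assume 0: "T (lift1 z) $ None = 0"
  have "Lform (T (lift1 z)) = 0" using z by (simp add: L Lform_lift1 sphere_iff_rho)
  with 0 have "(\<Sum>i\<in>UNIV. (cmod (T (lift1 z) $ Some i))\<^sup>2) = 0" by (simp add: Lform_def)
  then have "T (lift1 z) $ Some i = 0" for i by (simp add: sum_nonneg_eq_0_iff)
  with 0 have "T (lift1 z) = 0" unfolding vec_eq_iff split_option_all by simp
  then have "x \<bullet> flip_sign (lift1 z) = 0" for x
    using Lform_polarization[OF T L, of x "lift1 z"] by (simp add: linear_0[OF linear_flip_sign])
  from this[of "flip_sign (lift1 z)"] have "flip_sign (lift1 z) = 0" by simp
  then have "flip_sign (lift1 z) $ None = 0" by simp
  then show False by (simp add: flip_sign_def)
qed

lemma transform_sphere: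
  fixes T :: "complex ^ ('n::finite option) \<Rightarrow> complex ^ ('n option)"
  assumes T: "linear T" and L: "\<And>x. Lform (T x) = Lform x" and z: "z \<in> sphereS"
  shows "aff (T (lift1 z)) \<in> sphereS"
proof -
  note n = transform_None_nonzero[OF assms]
  have "0 = Lform (T (lift1 z))" using z by (simp add: L Lform_lift1 sphere_iff_rho)
  also have "\<dots> = Lform (T (lift1 z) $ None *s lift1 (aff (T (lift1 z))))" by (simp only: smult_lift1_aff[OF n])
  finally show ?thesis using n by (simp add: Lform_smult Lform_lift1 sphere_iff_rho)
qed

text \<open>\<open>1 / d\<close> may have poles off the sphere. Adding \<open>rho^2\<close> to the
  denominator \<open>|d|^2\<close> removes them and changes nothing on the sphere.\<close>

lemma exists_reciprocal:
  fixes d :: "complex ^ 'n::finite \<Rightarrow> complex"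
  assumes d: "sm UNIV d" and nz: "\<And>z. z \<in> sphereS \<Longrightarrow> d z \<noteq> 0"
  obtains \<kappa> where "sm UNIV \<kappa>" "\<And>z. z \<in> sphereS \<Longrightarrow> \<kappa> z * d z = 1"
proof
  define q where "q z = (norm (d z))\<^sup>2 + (rho z)\<^sup>2" for z
  have q: "q z \<noteq> 0" for z
    using nz[of z] by (auto simp: q_def sphere_iff_rho add_nonneg_eq_0_iff)
  show "sm UNIV (\<lambda>z. inverse (q z) *\<^sub>R cnj (d z))"
    using q unfolding q_def[abs_def]
    by (intro sm_scaleR sm_inverse_real sm_add sm_norm_sq sm_power sm_rho sm_cnj d) auto
  show "inverse (q z) *\<^sub>R cnj (d z) * d z = 1" if "z \<in> sphereS" for z
  proof -
    have "cnj (d z) * d z = complex_of_real (q z)"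
      using that complex_norm_square[of "d z"] by (simp add: q_def sphere_iff_rho mult.commute)
    then show ?thesis using q[of z] by (simp add: scaleR_conv_of_real mult.assoc)
  qed
qed

text \<open>\<open>smoothS\<close> asks for an extension to the whole space, where the fractional
  linear map may have poles; its denominator is replaced by a global smooth function with the same
  reciprocal on the sphere.\<close>

lemma transform_extension:
  fixes T :: "complex ^ ('n::finite option) \<Rightarrow> complex ^ ('n option)"
  assumes T: "linear T" and L: "\<And>x. Lform (T x) = Lform x" and F: "sm UNIV F"
  obtains G where "sm UNIV G" "\<And>z. z \<in> sphereS \<Longrightarrow> G z = F (aff (T (lift1 z)))"
proof -
  have bl: "bounded_linear T" using T by (rule linear_conv_bounded_linear[THEN iffD1])
  have sT: "sm S (\<lambda>z. T (lift1 z))" if "open S" for S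
    by (rule sm_linear_compose[OF bl sm_lift1[OF that]])
  obtain \<kappa> where k: "sm UNIV \<kappa>" "\<And>z. z \<in> sphereS \<Longrightarrow> \<kappa> z * (T (lift1 z) $ None) = 1"
    by (rule exists_reciprocal[OF sm_vec_nth[OF sT[OF open_UNIV]] transform_None_nonzero[OF T L]], assumption) (rule that)
  show ?thesis
  proof
    show "sm UNIV (\<lambda>z. F (\<chi> i. T (lift1 z) $ Some i * \<kappa> z))"
      by (rule sm_compose[OF F sm_vec]) (auto intro!: sm_mult k sm_vec_nth sT)
    show "F (\<chi> i. T (lift1 z) $ Some i * \<kappa> z) = F (aff (T (lift1 z)))" if "z \<in> sphereS" for z
    proof -
      have "\<kappa> z = inverse (T (lift1 z) $ None)"
        using k(2)[OF that] inverse_unique[of "T (lift1 z) $ None" "\<kappa> z"] by (simp add: mult.commute)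
      then show ?thesis by (simp add: aff_def divide_inverse)
    qed
  qed
qed

lemma linear_mv: "linear (\<lambda>x. (A :: complex ^ 'm::finite ^ 'k) *v x)"
  by (rule linearI) (simp_all add: matrix_vector_right_distrib vec_eq_iff matrix_vector_mult_def scaleR_sum_right distrib_left sum.distrib)

lemma SU1n_matrix_inv:
  assumes "g \<in> SU1n"
  shows "g ** matrix_inv g = mat 1" "matrix_inv g ** g = mat 1" "Lform (matrix_inv g *v \<zeta>) = Lform \<zeta>"
proof -
  have "invertible g" using assms by (simp add: SU1n_def invertible_det_nz)
  then show 1: "g ** matrix_inv g = mat 1" "matrix_inv g ** g = mat 1"
    using someI_ex[of "\<lambda>B. g ** B = mat 1 \<and> B ** g = mat 1"] unfolding matrix_inv_def invertible_def by auto
  have "Lform (g *v (matrix_inv g *v \<zeta>)) = Lform (matrix_inv g *v \<zeta>)" using assms by (simp add: SU1n_def)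
  then show "Lform (matrix_inv g *v \<zeta>) = Lform \<zeta>" by (simp add: matrix_vector_mul_assoc 1)
qed

section \<open>Differential operators with smooth coefficients\<close>

lemma dd_Cons: "dd (v # vs) F = dv v (dd vs F)"
  by (simp add: dv_def)

lemma sm_dd: "smooth F \<Longrightarrow> sm UNIV (dd vs F)"
  by (induction vs) (auto simp: smooth_eq_sm dd_Cons simp del: dd.simps(2) intro: sm_dv)

text \<open>Unlike in \<open>diffopS\<close>, the formula is required at every point and not only on
  the sphere, so that operators of this kind can be differentiated and composed.\<close>

definition diff_op :: "((complex ^ 'n::finite \<Rightarrow> real) \<Rightarrow> (complex ^ 'n \<Rightarrow> real)) \<Rightarrow> bool" where
  "diff_op P \<longleftrightarrow> (\<exists>ts :: ((complex ^ 'n \<Rightarrow> real) \<times> (complex ^ 'n) list) list.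
     (\<forall>(a, vs) \<in> set ts. smooth a \<and> set vs \<subseteq> Basis) \<and>
     (\<forall>F. smooth F \<longrightarrow> (\<forall>z. P F z = (\<Sum>(a, vs) \<leftarrow> ts. a z * dd vs F z))))"

lemma sm_sum_list:
  "open S \<Longrightarrow> (\<And>x. x \<in> set ts \<Longrightarrow> sm S (f x)) \<Longrightarrow> sm S (\<lambda>z. \<Sum>x\<leftarrow>ts. f x z)"
  by (induction ts) (simp_all add: sm_const sm_add)

lemma dv_sum_list:
  "(\<And>x. x \<in> set ts \<Longrightarrow> f x differentiable at z) \<Longrightarrow> dv v (\<lambda>z. \<Sum>x\<leftarrow>ts. f x z) z = (\<Sum>x\<leftarrow>ts. dv v (f x) z)
   \<and> (\<lambda>z. \<Sum>x\<leftarrow>ts. f x z) differentiable at z"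
  by (induction ts) (simp_all add: dv_const dv_add)

lemma diff_op_smooth: "diff_op P \<Longrightarrow> smooth F \<Longrightarrow> sm UNIV (P F)"
proof -
  assume "diff_op P" and F: "smooth F"
  then obtain ts where ts: "\<forall>(a, vs) \<in> set ts. smooth a \<and> set vs \<subseteq> Basis"
    "\<And>z. P F z = (\<Sum>(a, vs) \<leftarrow> ts. a z * dd vs F z)" unfolding diff_op_def by blast
  have "sm UNIV (\<lambda>z. \<Sum>x\<leftarrow>ts. case x of (a, vs) \<Rightarrow> a z * dd vs F z)"
    using ts(1) by (intro sm_sum_list) (auto simp: smooth_eq_sm intro!: sm_mult sm_dd F)
  then show ?thesis by (rule sm_cong) (simp add: ts(2))
qed

lemma diff_op_id: "diff_op (\<lambda>F. F)"
  unfolding diff_op_def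
  by (rule exI[of _ "[(\<lambda>_. 1, [])]"]) (simp add: smooth_eq_sm sm_const)

lemma diff_op_add:
  assumes "diff_op P" "diff_op Q"
  shows "diff_op (\<lambda>F z. P F z + Q F z)"
proof -
  obtain ts ts' where
    "\<forall>(a, vs) \<in> set ts. smooth a \<and> set vs \<subseteq> Basis" "\<forall>F. smooth F \<longrightarrow> (\<forall>z. P F z = (\<Sum>(a, vs) \<leftarrow> ts. a z * dd vs F z))"
    "\<forall>(a, vs) \<in> set ts'. smooth a \<and> set vs \<subseteq> Basis" "\<forall>F. smooth F \<longrightarrow> (\<forall>z. Q F z = (\<Sum>(a, vs) \<leftarrow> ts'. a z * dd vs F z))"
    using assms unfolding diff_op_def by blast
  then show ?thesis unfolding diff_op_def by (intro exI[of _ "ts @ ts'"]) auto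
qed

lemma diff_op_mult:
  assumes a: "sm UNIV a" and "diff_op P"
  shows "diff_op (\<lambda>F z. a z * P F z)"
proof -
  obtain ts where ts: "\<forall>(a, vs) \<in> set ts. smooth a \<and> set vs \<subseteq> Basis"
    "\<forall>F. smooth F \<longrightarrow> (\<forall>z. P F z = (\<Sum>(a, vs) \<leftarrow> ts. a z * dd vs F z))"
    using assms unfolding diff_op_def by blast
  define ts' where "ts' = map (\<lambda>(b, vs). (\<lambda>z. a z * b z, vs)) ts"
  have "(\<Sum>(b, vs) \<leftarrow> ts'. b z * dd vs F z) = a z * (\<Sum>(b, vs) \<leftarrow> ts. b z * dd vs F z)" for F z
    unfolding ts'_def by (induction ts) (auto simp: algebra_simps)
  moreover have "\<forall>(b, vs) \<in> set ts'. smooth b \<and> set vs \<subseteq> Basis"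
    using ts(1) a by (auto simp: ts'_def smooth_eq_sm intro!: sm_mult)
  ultimately show ?thesis unfolding diff_op_def using ts(2) by (intro exI[of _ ts']) simp
qed

lemma diff_op_dv:
  fixes P :: "(complex ^ 'n::finite \<Rightarrow> real) \<Rightarrow> (complex ^ 'n \<Rightarrow> real)"
  assumes v: "v \<in> Basis" and "diff_op P"
  shows "diff_op (\<lambda>F. dv v (P F))"
proof -
  obtain ts where ts: "\<forall>(a, vs) \<in> set ts. smooth a \<and> set vs \<subseteq> Basis"
    "\<forall>F. smooth F \<longrightarrow> (\<forall>z. P F z = (\<Sum>(a, vs) \<leftarrow> ts. a z * dd vs F z))"
    using assms unfolding diff_op_def by blast
  define ts' where "ts' = map (\<lambda>(b, vs). (b, v # vs)) ts @ map (\<lambda>(b, vs). (dv v b, vs)) ts"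
  have "dv v (P F) z = (\<Sum>(b, vs) \<leftarrow> ts'. b z * dd vs F z)" if F: "smooth F" for F z
  proof -
    have d: "a differentiable at z" "dd vs F differentiable at z" if "(a, vs) \<in> set ts" for a vs
    proof -
      have "sm UNIV a" using ts(1) that by (auto simp: smooth_eq_sm)
      then show "a differentiable at z" by (rule sm_differentiable) simp
      show "dd vs F differentiable at z" by (rule sm_differentiable[OF sm_dd[OF F] UNIV_I])
    qed
    have "dv v (P F) z = dv v (\<lambda>z. \<Sum>x\<leftarrow>ts. case x of (a, vs) \<Rightarrow> a z * dd vs F z) z"
      by (rule dv_cong[OF open_UNIV UNIV_I]) (use ts(2) F in simp)
    also have "\<dots> = (\<Sum>x\<leftarrow>ts. dv v (\<lambda>z. case x of (a, vs) \<Rightarrow> a z * dd vs F z) z)"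
      by (rule dv_sum_list[THEN conjunct1]) (use d in \<open>auto simp: split_def intro!: differentiable_mult\<close>)
    also have "\<dots> = (\<Sum>x\<leftarrow>ts. case x of (a, vs) \<Rightarrow> a z * dd (v # vs) F z + dv v a z * dd vs F z)"
      unfolding dd_Cons
      by (rule arg_cong[where f = sum_list], rule map_cong[OF refl]) (use d in \<open>auto simp: dv_mult\<close>)
    also have "\<dots> = (\<Sum>(b, vs) \<leftarrow> ts'. b z * dd vs F z)"
      unfolding ts'_def by (induction ts) (auto simp: algebra_simps simp del: dd.simps)
    finally show ?thesis .
  qed
  moreover have "\<forall>(b, vs) \<in> set ts'. smooth b \<and> set vs \<subseteq> Basis"
    using ts(1) v by (fastforce simp: ts'_def smooth_eq_sm intro: sm_dv)
  ultimately show ?thesis unfolding diff_op_def by (intro exI[of _ ts']) simp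
qed

lemma diff_op_cong:
  "diff_op P \<Longrightarrow> (\<And>F z. smooth F \<Longrightarrow> Q F z = P F z) \<Longrightarrow> diff_op Q"
  unfolding diff_op_def by simp

lemma diff_op_sum:
  assumes "finite A" "\<And>a. a \<in> A \<Longrightarrow> diff_op (P a)"
  shows "diff_op (\<lambda>F z. \<Sum>a\<in>A. P a F z)"
  using assms
proof (induction A rule: finite_induct)
  case empty
  then show ?case using diff_op_mult[OF sm_const[OF open_UNIV, of 0] diff_op_id] by simp
next
  case (insert a A)
  then show ?case by (simp add: diff_op_add)
qed

lemma diff_op_Qop:
  fixes P :: "(complex ^ 'n::finite \<Rightarrow> real) \<Rightarrow> (complex ^ 'n \<Rightarrow> real)"
  assumes P: "diff_op P"
  shows "diff_op (\<lambda>F. Qop w (P F))"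
proof (rule diff_op_cong)
  have "diff_op (\<lambda>F z. ((4 * w\<^sup>2) * P F z + (- 4 * w) * (\<Sum>b\<in>Basis. (z \<bullet> b) * dv b (P F) z))
    + ((\<Sum>b\<in>Basis. \<Sum>c\<in>Basis. ((z \<bullet> b) * (z \<bullet> c) + (imul z \<bullet> b) * (imul z \<bullet> c)) * dv b (dv c (P F)) z)
    + (- 1) * (\<Sum>b\<in>Basis. dv b (dv b (P F)) z)))"
    by (intro diff_op_add diff_op_mult diff_op_sum diff_op_dv P finite_Basis
        sm_const sm_add sm_mult sm_inner_const sm_ident sm_imul open_UNIV)
  then show "diff_op (\<lambda>F z. 4 * w\<^sup>2 * P F z - 4 * w * (\<Sum>b\<in>Basis. (z \<bullet> b) * dv b (P F) z)
    + (\<Sum>b\<in>Basis. \<Sum>c\<in>Basis. ((z \<bullet> b) * (z \<bullet> c) + (imul z \<bullet> b) * (imul z \<bullet> c)) * dv b (dv c (P F)) z)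
    - (\<Sum>b\<in>Basis. dv b (dv b (P F)) z))" by (simp add: add_diff_eq)
qed (rule Qop_expand[OF diff_op_smooth[OF P] UNIV_I])

lemma diff_op_chain: "diff_op (chain k w)"
proof (induction k)
  case 0
  show ?case by (rule diff_op_cong[OF diff_op_id]) simp
next
  case (Suc k)
  show ?case by (rule diff_op_cong[OF diff_op_Qop[OF Suc, where w = "w - real k"]]) simp
qed

section \<open>Existence\<close>

text \<open>\<open>diffopS\<close> feeds in functions that are known only on the sphere, so an
  extension is chosen; by \<open>chain_indep\<close> the value on the sphere does not depend on the
  choice.\<close>

definition CR_op :: "(complex ^ 'n::finite \<Rightarrow> real) \<Rightarrow> (complex ^ 'n \<Rightarrow> real)" where
  "CR_op f = chain CARD('n) 0 (SOME F. smooth F \<and> (\<forall>z\<in>sphereS. f z = F z))"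

lemma CR_op_eq:
  fixes f :: "complex ^ 'n::finite \<Rightarrow> real"
  assumes F: "smooth F" "\<And>z. z \<in> sphereS \<Longrightarrow> f z = F z" and z: "z \<in> sphereS"
  shows "CR_op f z = chain CARD('n) 0 F z"
proof -
  define F' where "F' = (SOME F. smooth F \<and> (\<forall>z\<in>sphereS. f z = F z))"
  have "smooth F' \<and> (\<forall>z\<in>sphereS. f z = F' z)"
    unfolding F'_def by (rule someI[of _ F]) (use F in auto)
  then have "chain CARD('n) 0 F' z = chain CARD('n) 0 F z"
    using F z by (intro chain_indep[of UNIV]) (auto simp: smooth_eq_sm)
  then show ?thesis by (simp add: CR_op_def F'_def)
qed

lemma diffopS_CR_op: "diffopS (CR_op :: (complex ^ 'n::finite \<Rightarrow> real) \<Rightarrow> _)"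
proof -
  obtain ts :: "((complex ^ 'n \<Rightarrow> real) \<times> (complex ^ 'n) list) list" where ts:
    "\<forall>(a, vs) \<in> set ts. smooth a \<and> set vs \<subseteq> Basis"
    "\<And>F z. smooth F \<Longrightarrow> chain CARD('n) 0 F z = (\<Sum>(a, vs) \<leftarrow> ts. a z * dd vs F z)"
    using diff_op_chain[of "CARD('n)" 0] unfolding diff_op_def by blast
  have "CR_op F z = (\<Sum>(a, vs) \<leftarrow> ts. a z * dd vs F z)" if "smooth F" "z \<in> sphereS" for F z
    using CR_op_eq[OF that(1) refl that(2)] ts(2)[OF that(1)] by simp
  moreover have "CR_op f z = CR_op F z" if "smooth F" "\<forall>z\<in>sphereS. f z = F z" "z \<in> sphereS"
    for f F and z :: "complex ^ 'n"
    using CR_op_eq[of F f z] CR_op_eq[of F F z] that by simp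
  ultimately show ?thesis unfolding diffopS_def using ts(1) by blast
qed

text \<open>Two extensions of the transformed function meet here: \<open>G\<close> is global but
  unrelated to \<open>F\<close> off the sphere, while the composite of \<open>F\<close> with the
  fractional linear map is equivariant but lives only on \<open>W\<close>. Independence of the
  extension on \<open>W\<close> identifies their images.\<close>

lemma CR_invariant_CR_op: "CR_invariant_op (CR_op :: (complex ^ 'n::finite \<Rightarrow> real) \<Rightarrow> _)"
  unfolding CR_invariant_op_def
proof (intro conjI ballI allI impI)
  show "diffopS (CR_op :: (complex ^ 'n \<Rightarrow> real) \<Rightarrow> _)" by (rule diffopS_CR_op)
next
  fix g :: "complex ^ ('n option) ^ ('n option)" and f :: "complex ^ 'n \<Rightarrow> real" and z :: "complex ^ 'n"
  assume g: "g \<in> SU1n" and f: "smoothS f" and z: "z \<in> sphereS"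
  obtain F where F: "smooth F" "\<And>z. z \<in> sphereS \<Longrightarrow> f z = F z" using f unfolding smoothS_def by blast
  define T where "T = (\<lambda>x. matrix_inv g *v x)"
  have T: "linear T" unfolding T_def by (rule linear_mv)
  have L: "Lform (T x) = Lform x" for x unfolding T_def by (rule SU1n_matrix_inv[OF g])
  have Ts: "T (c *s x) = c *s T x" for c x unfolding T_def by (rule vector_scalar_commute)
  have bl: "bounded_linear T" using T by (rule linear_conv_bounded_linear[THEN iffD1])
  have smF: "sm UNIV F" using F by (simp add: smooth_eq_sm)
  obtain G where G: "sm UNIV G" "\<And>z. z \<in> sphereS \<Longrightarrow> G z = F (aff (T (lift1 z)))"
    using transform_extension[OF T L smF] by blast
  define W where "W = {z. T (lift1 z) $ None \<noteq> 0}"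
  have sT: "sm UNIV (\<lambda>z. T (lift1 z))" by (rule sm_linear_compose[OF bl sm_lift1[OF open_UNIV]])
  have oW: "open W" unfolding W_def
    using sm_continuous_on[OF sm_vec_nth[OF sT]] by (intro open_Collect_neq continuous_on_const)
  have gW: "sm W (\<lambda>z. F (aff (T (lift1 z))))"
    by (rule sm_compose[OF smF sm_compose[OF sm_aff sm_subset[OF sT oW]]]) (auto simp: W_def)
  have zW: "z \<in> W" using transform_None_nonzero[OF T L z] by (simp add: W_def)
  have act: "actE 0 g f y = G y" if "y \<in> sphereS" for y
    using G(2)[OF that] F(2)[OF transform_sphere[OF T L that]]
    by (simp add: actE_def homog_ext_aff T_def)
  have "CR_op (actE 0 g f) z = chain CARD('n) 0 G z"
    by (rule CR_op_eq[OF _ act z]) (simp add: smooth_eq_sm G)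
  also have "\<dots> = chain CARD('n) 0 (\<lambda>z. F (aff (T (lift1 z)))) z"
    by (rule chain_indep[OF sm_subset[OF G(1) oW] gW]) (use G(2) z zW in auto)
  also have "\<dots> = homog_ext (- int CARD('n)) (chain CARD('n) 0 F) (T (lift1 z))"
    by (rule chain_transform[OF smF T Ts L W_def oW gW refl zW])
  also have "\<dots> = homog_ext (- int CARD('n)) (CR_op f) (T (lift1 z))"
    unfolding homog_ext_aff using CR_op_eq[OF F transform_sphere[OF T L z]] by simp
  finally show "CR_op (actE 0 g f) z = actE (- int CARD('n)) g (CR_op f) z"
    by (simp add: actE_def T_def)
qed

text \<open>The function has degree one in \<open>z\<close> and in \<open>cnj z\<close>, and its
  Euclidean Laplacian vanishes since \<open>i \<noteq> j\<close>. Hence \<open>Qop w\<close>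
  multiplies it by \<open>4 * (w - 1)^2\<close>, which is nonzero at each of the parameters
  \<open>0, -1, -2, ...\<close>.\<close>

lemma CR_op_nonzero:
  assumes "CARD('n::finite) \<ge> 2"
  shows "\<exists>f. smoothS f \<and> (\<exists>z\<in>sphereS. CR_op f (z :: complex ^ 'n) \<noteq> 0)"
proof -
  obtain i j :: 'n where ij: "i \<noteq> j"
    using assms card_le_Suc0_iff_eq[of "UNIV :: 'n set"] by auto
  define f :: "complex ^ 'n \<Rightarrow> real" where "f z = z $ i \<bullet> z $ j" for z
  have f: "sm UNIV f" unfolding f_def
    by (intro sm_bilinear[OF bounded_bilinear_inner] sm_vec_nth sm_ident open_UNIV)
  have d: "dv v f = (\<lambda>z. z $ i \<bullet> v $ j + v $ i \<bullet> z $ j)" for v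
  proof
    fix z
    note D = bounded_linear_imp_has_derivative[OF bounded_linear_vec_nth]
    show "dv v f z = z $ i \<bullet> v $ j + v $ i \<bullet> z $ j"
      unfolding f_def by (rule dv_eqI[OF has_derivative_inner[OF D D]])
  qed
  have h: "hess f z x y = x $ i \<bullet> y $ j + y $ i \<bullet> x $ j" for z x y
  proof -
    have "bounded_linear (\<lambda>z. z $ i \<bullet> y $ j + y $ i \<bullet> z $ j)"
      by (intro bounded_linear_add bounded_linear_compose[OF bounded_linear_inner_left bounded_linear_vec_nth]
          bounded_linear_compose[OF bounded_linear_inner_right bounded_linear_vec_nth])
    from dv_eqI[OF bounded_linear_imp_has_derivative[OF this], of x z] show ?thesis
      unfolding hess_def d .
  qed
  have "(\<Sum>b\<in>Basis. hess f z b b) = 0" for z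
    unfolding h using ij by (intro sum.neutral) (auto simp: Basis_vec_def axis_def)
  then have Q: "Qop w f z = 4 * (w - 1)\<^sup>2 * f z" for w z
    unfolding Qop_def d h by (simp add: f_def imul_def inner_complex_def algebra_simps power2_eq_square)
  have chain: "chain k 0 f z = (\<Prod>l<k. 4 * (real l + 1)\<^sup>2) * f z" for k z
  proof (induction k arbitrary: z)
    case (Suc k)
    have "chain (Suc k) 0 f z = Qop (- real k) (\<lambda>z. (\<Prod>l<k. 4 * (real l + 1)\<^sup>2) * f z) z"
      using Qop_cong[OF open_UNIV UNIV_I Suc] by simp
    also have "\<dots> = (\<Prod>l<k. 4 * (real l + 1)\<^sup>2) * (4 * (- real k - 1)\<^sup>2 * f z)"
      unfolding Qop_cmult[OF f UNIV_I] Q ..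
    finally show ?case by (simp add: power2_eq_square algebra_simps)
  qed simp
  define z :: "complex ^ 'n" where "z = (1 / sqrt 2) *\<^sub>R (axis i 1 + axis j 1)"
  have "z \<bullet> z = 1" using ij
    by (simp add: z_def inner_add_left inner_add_right inner_axis_axis)
  then have z: "z \<in> sphereS" by (simp add: sphereS_def norm_eq_1)
  have "f z = 1 / 2" using ij by (simp add: f_def z_def axis_def)
  moreover have "CR_op f z = chain CARD('n) 0 f z" by (rule CR_op_eq[OF _ refl z]) (simp add: smooth_eq_sm f)
  ultimately have "CR_op f z \<noteq> 0" unfolding chain by simp
  moreover have "smoothS f" using f unfolding smoothS_def smooth_eq_sm by blast
  ultimately show ?thesis using z by blast
qed

section \<open>Order of vanishing and Taylor polynomials\<close>

fun vanishes :: "nat \<Rightarrow> 'a::euclidean_space \<Rightarrow> ('a \<Rightarrow> 'b::real_normed_vector) \<Rightarrow> bool" where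
  "vanishes 0 p F = True"
| "vanishes (Suc m) p F = (F p = 0 \<and> (\<forall>v\<in>Basis. vanishes m p (dv v F)))"

lemma dd_snoc: "dd (vs @ [v]) F = dd vs (dv v F)"
  by (induction vs) (simp_all add: dv_def)

lemma vanishes_dd: "vanishes m p F \<Longrightarrow> length vs < m \<Longrightarrow> set vs \<subseteq> Basis \<Longrightarrow> dd vs F p = 0"
proof (induction vs arbitrary: m F rule: rev_induct)
  case Nil
  then show ?case by (cases m) auto
next
  case (snoc v vs)
  then obtain m' where "m = Suc m'" by (cases m) auto
  then show ?case using snoc by (simp only: dd_snoc) (auto intro!: snoc.IH[of m'])
qed

lemma dv_fun_add: "sm UNIV f \<Longrightarrow> sm UNIV g \<Longrightarrow> dv v (\<lambda>x. f x + g x) = (\<lambda>x. dv v f x + dv v g x)"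
  by (rule ext, rule dv_add) (auto intro: sm_differentiable)

lemma dv_fun_linear: "bounded_linear h \<Longrightarrow> sm UNIV f \<Longrightarrow> dv v (\<lambda>x. h (f x)) = (\<lambda>x. h (dv v f x))"
  by (rule ext, rule dv_linear_compose) (auto intro: sm_differentiable)

lemma dv_fun_mult:
  fixes f g :: "'a::euclidean_space \<Rightarrow> 'b::real_normed_algebra"
  shows "sm UNIV f \<Longrightarrow> sm UNIV g \<Longrightarrow> dv v (\<lambda>x. f x * g x) = (\<lambda>x. f x * dv v g x + dv v f x * g x)"
  by (rule ext, rule dv_mult) (auto intro: sm_differentiable)

lemma vanishes_add: "sm UNIV f \<Longrightarrow> sm UNIV g \<Longrightarrow> vanishes m p f \<Longrightarrow> vanishes m p g \<Longrightarrow> vanishes m p (\<lambda>x. f x + g x)"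
proof (induction m arbitrary: f g)
  case (Suc m)
  have "vanishes m p (\<lambda>x. dv v f x + dv v g x)" if "v \<in> Basis" for v
    by (rule Suc.IH[OF sm_dv[OF Suc.prems(1)] sm_dv[OF Suc.prems(2)]]) (use Suc.prems that in auto)
  then show ?case using Suc.prems by (simp add: dv_fun_add)
qed simp

lemma vanishes_linear: "bounded_linear h \<Longrightarrow> sm UNIV f \<Longrightarrow> vanishes m p f \<Longrightarrow> vanishes m p (\<lambda>x. h (f x))"
proof (induction m arbitrary: f)
  case (Suc m)
  have "vanishes m p (\<lambda>x. h (dv v f x))" if "v \<in> Basis" for v
    by (rule Suc.IH[OF Suc.prems(1) sm_dv[OF Suc.prems(2)]]) (use Suc.prems that in auto)
  then show ?case using Suc.prems linear_simps(3)[OF Suc.prems(1)] by (simp add: dv_fun_linear)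
qed simp

lemma vanishes_mult:
  fixes f g :: "'a::euclidean_space \<Rightarrow> 'b::real_normed_algebra"
  shows "sm UNIV f \<Longrightarrow> sm UNIV g \<Longrightarrow> vanishes m p f \<Longrightarrow> vanishes k p g \<Longrightarrow> N \<le> m + k \<Longrightarrow> vanishes N p (\<lambda>x. f x * g x)"
proof (induction N arbitrary: f g m k)
  case (Suc N)
  note f = Suc.prems(1) and g = Suc.prems(2)
  have 0: "f p * g p = 0"
  proof (cases m)
    case 0
    then obtain k' where "k = Suc k'" using Suc.prems by (cases k) auto
    then show ?thesis using Suc.prems by simp
  next
    case (Suc m')
    then show ?thesis using \<open>vanishes m p f\<close> by simp
  qed
  have "vanishes N p (\<lambda>x. f x * dv v g x + dv v f x * g x)" if v: "v \<in> Basis" for v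
  proof (rule vanishes_add)
    show "sm UNIV (\<lambda>x. f x * dv v g x)" "sm UNIV (\<lambda>x. dv v f x * g x)"
      by (intro sm_mult sm_dv f g)+
    show "vanishes N p (\<lambda>x. f x * dv v g x)"
      by (rule Suc.IH[OF f sm_dv[OF g] Suc.prems(3), of "k - 1"]) (use Suc.prems v in \<open>cases k; auto\<close>)+
    show "vanishes N p (\<lambda>x. dv v f x * g x)"
      by (rule Suc.IH[OF sm_dv[OF f] g _ Suc.prems(4), of "m - 1"]) (use Suc.prems v in \<open>cases m; auto\<close>)+
  qed
  then show ?case using 0 by (simp add: dv_fun_mult[OF f g])
qed simp

lemma vanishes_power:
  fixes f :: "'a::euclidean_space \<Rightarrow> 'b::real_normed_algebra_1"
  assumes "sm UNIV f" "f p = 0"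
  shows "vanishes m p (\<lambda>x. f x ^ m)"
proof (induction m)
  case (Suc m)
  have "vanishes 1 p f" using assms by simp
  from vanishes_mult[OF assms(1) sm_power[OF assms(1)] this Suc, of "Suc m"] show ?case by (simp del: vanishes.simps)
qed simp

text \<open>\<open>k!\<close> times the homogeneous Taylor term of degree \<open>k\<close>: the
  recursion sums over ordered tuples of basis vectors, which avoids multi-indices.\<close>

fun taylor :: "nat \<Rightarrow> 'a::euclidean_space \<Rightarrow> ('a \<Rightarrow> real) \<Rightarrow> 'a \<Rightarrow> real" where
  "taylor 0 p F y = F p"
| "taylor (Suc k) p F y = (\<Sum>v\<in>Basis. ((y - p) \<bullet> v) * taylor k p (dv v F) y)"

lemma sm_taylor: "sm UNIV (taylor k p F)"
proof (induction k arbitrary: F)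
  case 0
  have "taylor 0 p F = (\<lambda>y. F p)" by auto
  then show ?case by (simp add: sm_const)
next
  case (Suc k)
  have "taylor (Suc k) p F = (\<lambda>y. \<Sum>v\<in>Basis. ((y - p) \<bullet> v) * taylor k p (dv v F) y)" by auto
  then show ?case
    by (simp only:) (intro sm_sum sm_mult sm_inner_const sm_diff sm_ident sm_const open_UNIV Suc)
qed

lemma dv_taylor:
  fixes F :: "'a::euclidean_space \<Rightarrow> real"
  assumes "w \<in> Basis"
  shows "sm UNIV F \<Longrightarrow> dv w (taylor (Suc k) p F) = (\<lambda>y. real (Suc k) * taylor k p (dv w F) y)"
proof (induction k arbitrary: F)
  case F: 0
  have "dv w (taylor (Suc 0) p F) y = taylor 0 p (dv w F) y" for y
  proof -
    have "taylor (Suc 0) p F = (\<lambda>y. \<Sum>v\<in>Basis. ((y - p) \<bullet> v) * dv v F p)" by auto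
    moreover have "((\<lambda>y. \<Sum>v\<in>Basis. ((y - p) \<bullet> v) * dv v F p) has_derivative (\<lambda>h. \<Sum>v\<in>Basis. (h \<bullet> v) * dv v F p)) (at y)"
      by (auto intro!: derivative_eq_intros)
    ultimately have "dv w (taylor (Suc 0) p F) y = (\<Sum>v\<in>Basis. (w \<bullet> v) * dv v F p)"
      using dv_eqI[of "\<lambda>y. \<Sum>v\<in>Basis. ((y - p) \<bullet> v) * dv v F p"] by simp
    also have "\<dots> = dv w F p" using dv_sum_Basis[OF sm_differentiable[OF F UNIV_I], of w] by simp
    finally show ?thesis by simp
  qed
  then show ?case by (simp add: fun_eq_iff del: taylor.simps)
next
  case (Suc k)
  have "dv w (taylor (Suc (Suc k)) p F) y = real (Suc (Suc k)) * taylor (Suc k) p (dv w F) y" for y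
  proof -
    have "taylor (Suc (Suc k)) p F = (\<lambda>y. \<Sum>v\<in>Basis. ((y - p) \<bullet> v) * taylor (Suc k) p (dv v F) y)" by auto
    moreover have "((\<lambda>y. \<Sum>v\<in>Basis. ((y - p) \<bullet> v) * taylor (Suc k) p (dv v F) y) has_derivative
       (\<lambda>h. \<Sum>v\<in>Basis. ((y - p) \<bullet> v) * dv h (taylor (Suc k) p (dv v F)) y + (h \<bullet> v) * taylor (Suc k) p (dv v F) y)) (at y)"
    proof (rule has_derivative_sum)
      fix v :: 'a
      have "((\<lambda>y. (y - p) \<bullet> v) has_derivative (\<lambda>h. h \<bullet> v)) (at y)" by (auto intro!: derivative_eq_intros)
      from has_derivative_mult[OF this sm_has_derivative[OF sm_taylor UNIV_I]]
      show "((\<lambda>y. ((y - p) \<bullet> v) * taylor (Suc k) p (dv v F) y) has_derivative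
        (\<lambda>h. ((y - p) \<bullet> v) * dv h (taylor (Suc k) p (dv v F)) y + (h \<bullet> v) * taylor (Suc k) p (dv v F) y)) (at y)" .
    qed
    ultimately have "dv w (taylor (Suc (Suc k)) p F) y
      = (\<Sum>v\<in>Basis. ((y - p) \<bullet> v) * dv w (taylor (Suc k) p (dv v F)) y + (w \<bullet> v) * taylor (Suc k) p (dv v F) y)"
      using dv_eqI[of "\<lambda>y. \<Sum>v\<in>Basis. ((y - p) \<bullet> v) * taylor (Suc k) p (dv v F) y"] by simp
    also have "\<dots> = (\<Sum>v\<in>Basis. real (Suc k) * (((y - p) \<bullet> v) * taylor k p (dv v (dv w F)) y))
        + (\<Sum>v\<in>Basis. (w \<bullet> v) * taylor (Suc k) p (dv v F) y)"
    proof -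
      have "dv w (dv v F) = dv v (dv w F)" for v
        using dv_commute[OF Suc.prems UNIV_I] by blast
      then show ?thesis
        unfolding Suc.IH[OF sm_dv[OF Suc.prems]] by (simp add: sum.distrib mult_ac del: taylor.simps)
    qed
    also have "(\<Sum>v\<in>Basis. (w \<bullet> v) * taylor (Suc k) p (dv v F) y) = taylor (Suc k) p (dv w F) y"
    proof -
      have "(\<Sum>v\<in>Basis. (w \<bullet> v) * taylor (Suc k) p (dv v F) y) = (\<Sum>v\<in>Basis. if v = w then taylor (Suc k) p (dv w F) y else 0)"
        by (rule sum.cong) (auto simp: inner_Basis assms simp del: taylor.simps)
      then show ?thesis using assms by (simp add: sum.delta del: taylor.simps)
    qed
    also have "(\<Sum>v\<in>Basis. real (Suc k) * (((y - p) \<bullet> v) * taylor k p (dv v (dv w F)) y)) = real (Suc k) * taylor (Suc k) p (dv w F) y"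
      unfolding taylor.simps sum_distrib_left ..
    finally show ?thesis by (simp add: algebra_simps del: taylor.simps)
  qed
  then show ?case by blast
qed

text \<open>The derivative of the Taylor remainder is the remainder, one order lower, of the
  derivative: by \<open>dv_taylor\<close> the factor \<open>Suc k\<close> turns
  \<open>fact (Suc k)\<close> into \<open>fact k\<close>.\<close>

lemma vanishes_taylor:
  fixes F :: "'a::euclidean_space \<Rightarrow> real"
  shows "sm UNIV F \<Longrightarrow> vanishes M p (\<lambda>y. F y + (\<Sum>k<M. (- 1 / fact k) * taylor k p F y))"
proof (induction M arbitrary: F)
  case (Suc M)
  have t0: "taylor (Suc k) p F p = 0" for k F by simp
  have sF: "sm UNIV (\<lambda>y. \<Sum>k<Suc M. (- 1 / fact k) * taylor k p F y)" for F
    by (intro sm_sum sm_cmult sm_taylor open_UNIV)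
  have "F p + (\<Sum>k<Suc M. (- 1 / fact k) * taylor k p F p) = 0"
    unfolding sum.lessThan_Suc_shift t0 by simp
  moreover have "vanishes M p (dv w (\<lambda>y. F y + (\<Sum>k<Suc M. (- 1 / fact k) * taylor k p F y)))" if w: "w \<in> Basis" for w
  proof -
    have "dv w (\<lambda>y. F y + (\<Sum>k<Suc M. (- 1 / fact k) * taylor k p F y))
      = (\<lambda>y. dv w F y + (\<Sum>k<M. (- 1 / fact k) * taylor k p (dv w F) y))"
    proof
      fix y
      have d: "((\<lambda>y. F y + (\<Sum>k<Suc M. (- 1 / fact k) * taylor k p F y)) has_derivative
          (\<lambda>h. dv h F y + (\<Sum>k<Suc M. (- 1 / fact k) * dv h (taylor k p F) y))) (at y)"
        by (intro has_derivative_add has_derivative_sum has_derivative_mult_right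
            sm_has_derivative[OF Suc.prems UNIV_I] sm_has_derivative[OF sm_taylor UNIV_I])
      have z: "dv w (taylor 0 p F) y = 0"
      proof -
        have "taylor 0 p F = (\<lambda>y. F p)" by auto
        then show ?thesis by (simp add: dv_const)
      qed
      have eq: "(- 1 / fact (Suc k)) * dv w (taylor (Suc k) p F) y = (- 1 / fact k) * taylor k p (dv w F) y" for k
        unfolding dv_taylor[OF w Suc.prems] by (simp add: field_simps del: of_nat_Suc)
      have "dv w (\<lambda>y. F y + (\<Sum>k<Suc M. (- 1 / fact k) * taylor k p F y)) y
          = dv w F y + (\<Sum>k<Suc M. (- 1 / fact k) * dv w (taylor k p F) y)"
        by (rule dv_eqI[OF d])
      also have "(\<Sum>k<Suc M. (- 1 / fact k) * dv w (taylor k p F) y) = (\<Sum>k<M. (- 1 / fact k) * taylor k p (dv w F) y)"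
        unfolding sum.lessThan_Suc_shift z eq by simp
      finally show "dv w (\<lambda>y. F y + (\<Sum>k<Suc M. (- 1 / fact k) * taylor k p F y)) y
          = dv w F y + (\<Sum>k<M. (- 1 / fact k) * taylor k p (dv w F) y)" .
    qed
    then show ?thesis using Suc.IH[OF sm_dv[OF Suc.prems]] by simp
  qed
  ultimately show ?case by simp
qed simp

section \<open>The group SU(1,n) up to phases\<close>

definition hform :: "complex ^ ('n::finite option) \<Rightarrow> complex ^ ('n option) \<Rightarrow> complex" where
  "hform x y = x $ None * cnj (y $ None) - (\<Sum>i\<in>UNIV. x $ Some i * cnj (y $ Some i))"

lemma Re_hform: "Re (hform x y) = x \<bullet> flip_sign y"
  by (simp add: hform_def inner_flip_sign inner_complex_def)

lemma Im_hform: "Im (hform x y) = Re (hform ((- \<i>) *s x) y)"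
proof -
  have "hform ((- \<i>) *s x) y = (- \<i>) * hform x y"
    by (simp add: hform_def right_diff_distrib sum_distrib_left mult.assoc sum_negf)
  then show ?thesis by simp
qed

text \<open>The real part is the polarized \<open>Lform\<close>. The imaginary part is the real part
  with \<open>x\<close> replaced by \<open>- \<i> * x\<close>, and there complex linearity of
  \<open>T\<close> enters.\<close>

lemma hform_preserved:
  fixes T :: "complex ^ ('n::finite option) \<Rightarrow> complex ^ ('n option)"
  assumes T: "linear T" "\<And>c x. T (c *s x) = c *s T x" and L: "\<And>x. Lform (T x) = Lform x"
  shows "hform (T x) (T y) = hform x y"
proof (rule complex_eqI)
  show "Re (hform (T x) (T y)) = Re (hform x y)"
    by (simp only: Re_hform Lform_polarization[OF T(1) L])
  show "Im (hform (T x) (T y)) = Im (hform x y)"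
    by (simp only: Im_hform T(2)[symmetric]) (simp only: Re_hform Lform_polarization[OF T(1) L])
qed

lemma det_cnj: "det (\<chi> i j. cnj (A $ i $ j)) = cnj (det (A :: complex ^ 'n ^ 'n::finite))"
  by (simp add: det_def)

definition smat :: "complex \<Rightarrow> complex ^ 'n ^ 'n::finite" where
  "smat c = (\<chi> i j. if i = j then c else 0)"

lemma det_smat: "det (smat c :: complex ^ 'n ^ 'n::finite) = c ^ CARD('n)"
  by (subst det_diagonal) (auto simp: smat_def)

lemma smat_mult: "smat c *v x = c *s x"
  by (simp add: smat_def vec_eq_iff matrix_vector_mult_def if_distrib[of "\<lambda>t. t * _"] cong: if_cong)

text \<open>Take determinants in \<open>H ** (J ** A) = J\<close>, where \<open>H\<close> is the
  conjugate transpose of \<open>A\<close> and \<open>J\<close> the diagonal matrix of signs. The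
  identity is invariance of \<open>hform\<close> on pairs of basis vectors.\<close>

lemma norm_det_preserving:
  fixes A :: "complex ^ ('n::finite option) ^ ('n option)"
  assumes L: "\<And>x. Lform (A *v x) = Lform x"
  shows "cmod (det A) = 1"
proof -
  define J :: "complex ^ ('n option) ^ ('n option)" where
    "J = (\<chi> i j. if i = j then (case i of None \<Rightarrow> 1 | Some _ \<Rightarrow> - 1) else 0)"
  define H where "H = transpose (\<chi> i j. cnj (A $ i $ j))"
  have J: "det J \<noteq> 0"
    unfolding J_def by (subst det_diagonal) (auto simp: prod_zero_iff split: option.splits)
  have Jk: "(J ** A) $ k $ j = (case k of None \<Rightarrow> A $ None $ j | Some i \<Rightarrow> - A $ Some i $ j)" for k j
    by (simp add: J_def matrix_matrix_mult_def if_distrib[of "\<lambda>t. t * _"] cong: if_cong split: option.split)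
  have ax: "(A *v axis j 1) $ k = A $ k $ j" for j k
    by (simp add: matrix_vector_mult_def axis_def if_distrib cong: if_cong)
  have Hk: "(H ** X) $ i $ j = (\<Sum>k\<in>UNIV. cnj (A $ k $ i) * X $ k $ j)" for X :: "complex ^ ('n option) ^ ('n option)" and i j
    by (simp add: matrix_matrix_mult_def H_def transpose_def)
  have e1: "(H ** (J ** A)) $ i $ j = hform (A *v axis j 1) (A *v axis i 1)" for i j
    unfolding Hk hform_def sum_option Jk ax by (simp add: sum_negf mult.commute)
  have e2: "hform (A *v axis j 1) (A *v axis i 1) = hform (axis j 1) (axis i 1)" for i j
    by (rule hform_preserved[OF linear_mv vector_scalar_commute L])
  have e3: "hform (axis j 1) (axis i 1) = J $ i $ j" for i j
  proof -
    have "(\<Sum>k\<in>UNIV. axis j 1 $ Some k * cnj (axis i 1 $ Some k)) = (case i of None \<Rightarrow> 0 | Some m \<Rightarrow> (if i = j then 1 else 0 :: complex))"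
    proof (cases i)
      case (Some m)
      have "(\<Sum>k\<in>UNIV. axis j 1 $ Some k * cnj (axis i 1 $ Some k)) = (\<Sum>k\<in>UNIV. if k = m then (if i = j then 1 else 0 :: complex) else 0)"
        by (rule sum.cong) (auto simp: axis_def Some)
      then show ?thesis using Some by simp
    qed (simp add: axis_def)
    then show ?thesis by (auto simp: hform_def J_def axis_def split: option.split)
  qed
  have "H ** (J ** A) = J" unfolding vec_eq_iff e1 e2 e3 by simp
  then have "det H * (det J * det A) = det J" by (metis det_mul)
  then have "cnj (det A) * det A = 1" using J by (simp add: H_def det_transpose det_cnj)
  then have "complex_of_real ((cmod (det A))\<^sup>2) = 1"
    using complex_norm_square[of "det A"] by (simp add: mult.commute)
  then have "(cmod (det A))\<^sup>2 = 1" by (simp only: of_real_eq_1_iff)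
  then show ?thesis by (simp add: power2_eq_1_iff) (smt (verit) norm_ge_zero)
qed

lemma unit_root: "cmod d = 1 \<Longrightarrow> 0 < N \<Longrightarrow> \<exists>c. cmod c = 1 \<and> c ^ N * d = 1"
proof -
  assume d: "cmod d = 1" and N: "0 < N"
  define c where "c = cis (- Arg d / real N)"
  have "c ^ N = cis (real N * (- Arg d / real N))" unfolding c_def by (simp add: Complex.DeMoivre)
  also have "\<dots> = cis (- Arg d)" using N by simp
  finally have "c ^ N * d = cis (- Arg d) * rcis (cmod d) (Arg d)" by (simp add: rcis_cmod_Arg)
  then have "c ^ N * d = 1" using d by (simp add: rcis_def cis_mult)
  moreover have "cmod c = 1" by (simp add: c_def)
  ultimately show ?thesis by blast
qed

text \<open>Multiplying by a phase makes the determinant one and is not seen by homogeneous functions.\<close>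

lemma exists_SU1n:
  fixes T :: "complex ^ ('n::finite option) \<Rightarrow> complex ^ ('n option)"
  assumes T: "linear T" "\<And>c x. T (c *s x) = c *s T x" and L: "\<And>x. Lform (T x) = Lform x"
  obtains g c where "g \<in> SU1n" "cmod c = 1" "\<And>x. matrix_inv g *v x = c *s T x"
proof -
  define A where "A = matrix T"
  have "Vector_Spaces.linear (*s) (*s) T"
    using linear_add[OF T(1)] T(2) by unfold_locales (auto simp: vec.scale_right_distrib)
  then have A: "A *v x = T x" for x unfolding A_def by (rule matrix_works)
  have "cmod (det A) = 1" by (rule norm_det_preserving) (simp add: A L)
  then obtain c where c: "cmod c = 1" "c ^ CARD('n option) * det A = 1" using unit_root[of "det A" "CARD('n option)"] by auto
  define B where "B = smat c ** A"
  have B: "B *v x = c *s T x" for x by (simp add: B_def matrix_vector_mul_assoc[symmetric] smat_mult A)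
  have "det B = 1" using c by (simp add: B_def det_mul det_smat)
  then have BG: "B \<in> SU1n" by (simp add: SU1n_def B Lform_smult L c)
  \<comment> \<open>The action uses \<open>matrix_inv g\<close>, so \<open>g\<close> has to be the
    inverse of the matrix that represents \<open>T\<close> up to a phase.\<close>
  define g where "g = matrix_inv B"
  note i = SU1n_matrix_inv[OF BG]
  have "det B * det g = 1" using i(1) unfolding g_def by (metis det_mul det_I)
  then have gG: "g \<in> SU1n" using i(3) \<open>det B = 1\<close> by (simp add: SU1n_def g_def)
  have "matrix_inv g = (B ** g) ** matrix_inv g" using i(1) by (simp add: g_def)
  also have "\<dots> = B" using SU1n_matrix_inv(1)[OF gG] by (simp add: matrix_mul_assoc[symmetric])
  finally have "matrix_inv g *v x = c *s T x" for x using B by simp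
  with gG c(1) show ?thesis using that by blast
qed

text \<open>Invariance restated for any complex linear isometry of the form and any smooth
  \<open>G\<close> agreeing on the sphere with the transformed function; determinants and
  \<open>matrix_inv\<close> do not appear after this.\<close>

lemma CR_invariant_transform:
  fixes T :: "complex ^ ('n::finite option) \<Rightarrow> complex ^ ('n option)"
  assumes D: "CR_invariant_op D"
    and T: "linear T" "\<And>c x. T (c *s x) = c *s T x" and L: "\<And>x. Lform (T x) = Lform x"
    and F: "sm UNIV F" and G: "sm UNIV G" "\<And>z. z \<in> sphereS \<Longrightarrow> G z = F (aff (T (lift1 z)))"
    and z: "z \<in> sphereS"
  shows "D G z = homog_ext (- int CARD('n)) (D F) (T (lift1 z))"
proof -
  obtain g c where g: "g \<in> SU1n" and c: "cmod c = 1" and gT: "\<And>x. matrix_inv g *v x = c *s T x"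
    using exists_SU1n[OF T L] by blast
  have c0: "c \<noteq> 0" using c by auto
  have ext: "homog_ext p f (c *s x) = homog_ext p f x" for p f and x :: "complex ^ ('n option)"
    unfolding homog_ext_smult[OF c0] by (simp add: c)
  have act: "actE p g f y = homog_ext p f (T (lift1 y))" for p f y
    by (simp add: actE_def gT ext)
  have dS: "diffopS D" using D by (simp add: CR_invariant_op_def)
  have "smoothS F" using F unfolding smoothS_def smooth_eq_sm by blast
  then have "D (actE 0 g F) z = actE (- int CARD('n)) g (D F) z"
    using D g z unfolding CR_invariant_op_def by blast
  moreover have "D (actE 0 g F) z = D G z"
  proof -
    have "\<forall>y\<in>sphereS. actE 0 g F y = G y" using G(2) by (simp add: act homog_ext_aff)
    then show ?thesis using dS G(1) z unfolding diffopS_def smooth_eq_sm by blast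
  qed
  ultimately show ?thesis by (simp add: act)
qed

text \<open>Extend \<open>U\<close> by the identity on \<open>\<zeta>\<^sub>0\<close>; the weight
  factor is then 1.\<close>

lemma CR_invariant_unitary:
  fixes U :: "complex ^ 'n::finite \<Rightarrow> complex ^ 'n"
  assumes D: "CR_invariant_op D"
    and U: "linear U" "\<And>c x. U (c *s x) = c *s U x" and N: "\<And>x. norm (U x) = norm x"
    and F: "sm UNIV F" and z: "z \<in> sphereS"
  shows "D (\<lambda>z. F (U z)) z = D F (U z)"
proof -
  define T :: "complex ^ ('n option) \<Rightarrow> complex ^ ('n option)" where
    "T x = (\<chi> k. case k of None \<Rightarrow> x $ None | Some i \<Rightarrow> U (\<chi> j. x $ Some j) $ i)" for x
  have T: "linear T"
  proof (rule linearI)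
    have e: "(\<chi> j. (x + y) $ Some j) = (\<chi> j. x $ Some j) + (\<chi> j. y $ Some j)" for x y :: "complex ^ ('n option)"
      by (simp add: vec_eq_iff)
    show "T (x + y) = T x + T y" for x y
      unfolding T_def e linear_add[OF U(1)] by (simp add: vec_eq_iff split: option.split)
    have e': "(\<chi> j. (c *\<^sub>R x) $ Some j) = c *\<^sub>R (\<chi> j. x $ Some j)" for c and x :: "complex ^ ('n option)"
      by (simp add: vec_eq_iff)
    show "T (c *\<^sub>R x) = c *\<^sub>R T x" for c x
      unfolding T_def e' linear_cmul[OF U(1)] by (simp add: vec_eq_iff split: option.split)
  qed
  have Ts: "T (c *s x) = c *s T x" for c x
  proof -
    have e: "(\<chi> j. (c *s x) $ Some j) = c *s (\<chi> j. x $ Some j)" by (simp add: vec_eq_iff)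
    show ?thesis unfolding T_def e U(2) by (simp add: vec_eq_iff split: option.split)
  qed
  have sq: "(\<Sum>i\<in>UNIV. (cmod (x $ i))\<^sup>2) = (norm x)\<^sup>2" for x :: "complex ^ 'n"
    unfolding power2_norm_eq_inner inner_vec_def ..
  have L: "Lform (T x) = Lform x" for x
    using sq[of "U (\<chi> j. x $ Some j)"] sq[of "\<chi> j. x $ Some j"] by (simp add: Lform_def T_def N)
  have a: "aff (T (lift1 z)) = U z" "T (lift1 z) $ None = 1" for z
    by (simp_all add: aff_def T_def vec_eq_iff)
  have sU: "sm UNIV (\<lambda>z. F (U z))"
    by (rule sm_compose[OF F sm_bounded_linear[OF linear_conv_bounded_linear[THEN iffD1, OF U(1)] open_UNIV]]) simp
  show ?thesis
    using CR_invariant_transform[OF D T Ts L F sU _ z] by (simp add: a homog_ext_aff)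
qed

section \<open>Hermitian products and complex reflections\<close>

definition herm :: "complex ^ 'n::finite \<Rightarrow> complex ^ 'n \<Rightarrow> complex" where
  "herm z a = (\<Sum>i\<in>UNIV. z $ i * cnj (a $ i))"

lemma Re_herm: "Re (herm z a) = z \<bullet> a"
  by (simp add: herm_def inner_vec_complex)

lemma herm_add: "herm (x + y) a = herm x a + herm y a" "herm a (x + y) = herm a x + herm a y"
  by (simp_all add: herm_def algebra_simps sum.distrib)

lemma herm_smult: "herm (c *s x) a = c * herm x a" "herm a (c *s x) = cnj c * herm a x"
  by (simp_all add: herm_def sum_distrib_left mult_ac)

lemma herm_diff: "herm (x - y) a = herm x a - herm y a" "herm a (x - y) = herm a x - herm a y"
  by (simp_all add: herm_def algebra_simps sum_subtractf)

lemma herm_scaleR: "herm (c *\<^sub>R x) a = of_real c * herm x a" "herm a (c *\<^sub>R x) = of_real c * herm a x"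
  by (simp_all add: herm_def sum_distrib_left mult_ac scaleR_conv_of_real[where 'a = complex])

lemma herm_cnj: "cnj (herm x y) = herm y x"
  by (simp add: herm_def mult.commute)

lemma herm_self: "herm x x = of_real ((norm x)\<^sup>2)"
proof -
  have "Im (herm x x) = 0" using herm_cnj[of x x] by (simp add: complex_eq_iff)
  then show ?thesis by (simp add: complex_eq_iff Re_herm dot_square_norm)
qed

lemma herm_axis: "herm z (axis i 1) = z $ i" "herm (axis i 1) z = cnj (z $ i)"
  by (simp_all add: herm_def axis_def if_distrib[of "\<lambda>t. t * _"] if_distrib[of "\<lambda>t. _ * t"] if_distrib[of cnj] cong: if_cong)

text \<open>For a unit vector \<open>a\<close> this is the unitary map with eigenvalue
  \<open>w\<close> on the complex line of \<open>a\<close> and 1 on its orthogonal complement.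
  General phases yield orthogonality relations, and \<open>w = - 1\<close> moves one unit vector to
  another.\<close>

definition refl_phase :: "complex ^ 'n::finite \<Rightarrow> complex \<Rightarrow> complex ^ 'n \<Rightarrow> complex ^ 'n" where
  "refl_phase a w z = z + ((w - 1) * herm z a) *s a"

lemma linear_refl_phase: "linear (refl_phase a w)"
  by (rule linearI) (simp_all add: refl_phase_def herm_add herm_scaleR vec_eq_iff algebra_simps scaleR_conv_of_real[where 'a = complex])

lemma refl_phase_smult: "refl_phase a w (c *s x) = c *s refl_phase a w x"
  by (simp add: refl_phase_def herm_smult vec_eq_iff algebra_simps)

lemma herm_refl_phase: "herm (refl_phase a w z) y = herm z y + (w - 1) * herm z a * herm a y"
  by (simp add: refl_phase_def herm_add herm_smult)

lemma norm_refl_phase: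
  assumes "norm a = 1" "cmod w = 1"
  shows "norm (refl_phase a w z) = norm z"
proof -
  have a: "herm a a = 1" using assms by (simp add: herm_self)
  have w: "w * cnj w = 1" using complex_norm_square[of w] assms by simp
  have "herm (refl_phase a w z) (refl_phase a w z) = herm z z
      + (w * cnj w - 1) * (herm z a * herm a z)"
  proof -
    have h: "herm a z = cnj (herm z a)" by (simp add: herm_cnj)
    have 1: "herm z (refl_phase a w z) = herm z z + cnj ((w - 1) * herm z a) * herm z a"
      "herm a (refl_phase a w z) = herm a z + cnj ((w - 1) * herm z a)"
      by (simp_all add: refl_phase_def herm_add herm_smult a)
    show ?thesis unfolding herm_refl_phase[of a w z "refl_phase a w z"] 1 h by (simp add: algebra_simps)
  qed
  then have "herm (refl_phase a w z) (refl_phase a w z) = herm z z" by (simp add: w)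
  then have "complex_of_real ((norm (refl_phase a w z))\<^sup>2) = complex_of_real ((norm z)\<^sup>2)" by (simp only: herm_self)
  then have "(norm (refl_phase a w z))\<^sup>2 = (norm z)\<^sup>2" by (simp only: of_real_eq_iff)
  then show ?thesis by simp
qed

text \<open>Two distinct unit vectors whose Hermitian product is real are exchanged by the
  reflection in their difference. The phase \<open>c\<close> makes the product of
  \<open>c *s p\<close> and \<open>p'\<close> real and nonnegative. The last clause ensures that
  vectors orthogonal to both are fixed.\<close>

lemma exists_reflection:
  fixes p p' :: "complex ^ 'n::finite"
  assumes p: "norm p = 1" "norm p' = 1"
  obtains a w c where "norm a = 1" "cmod w = 1" "cmod c = 1" "refl_phase a w p' = c *s p"
    "\<And>z. herm (refl_phase a w z) p' = herm z (c *s p)" "\<And>e. herm e p = 0 \<Longrightarrow> herm e p' = 0 \<Longrightarrow> herm e a = 0"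
proof -
  define h where "h = herm p p'"
  define c where "c = (if h = 0 then 1 else cnj h / of_real (cmod h))"
  have c: "cmod c = 1" by (simp add: c_def norm_divide)
  define q where "q = c *s p"
  have "herm q p' = of_real (cmod h)"
  proof (cases "h = 0")
    case False
    then show ?thesis using complex_norm_square[of h]
      by (simp add: q_def herm_smult h_def[symmetric] c_def field_simps power2_eq_square)
  qed (simp add: q_def herm_smult h_def[symmetric])
  then have qp: "herm q p' = of_real (cmod h)" "herm p' q = of_real (cmod h)"
    using herm_cnj[of q p'] by auto
  have cc: "c * cnj c = 1" using complex_norm_square[of c] c by simp
  have pp: "herm p p = 1" "herm p' p' = 1" using p by (simp_all add: herm_self)
  have qq: "herm q q = 1" using pp cc by (simp add: q_def herm_smult mult.commute)
  show ?thesis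
  proof (cases "q = p'")
    case True
    have [simp]: "refl_phase p 1 z = z" for z by (simp add: refl_phase_def)
    \<comment> \<open>The difference is zero here, so the identity is used, written as a reflection
      with \<open>w = 1\<close> in an arbitrary unit vector.\<close>
    show ?thesis by (rule that[of p 1 c]) (use c p True q_def in auto)
  next
    case False
    define d where "d = q - p'"
    have d0: "norm d \<noteq> 0" using False by (simp add: d_def)
    define a where "a = (1 / norm d) *\<^sub>R d"
    have dd: "herm d d = 2 * (1 - of_real (cmod h))"
      by (simp add: d_def herm_diff qq pp qp)
    then have nd: "complex_of_real ((norm d)\<^sup>2) = 2 * (1 - of_real (cmod h))" by (simp only: herm_self)
    have key: "(- 2) * herm z a * herm a y = - (2 / of_real ((norm d)\<^sup>2)) * (herm z d * herm d y)" for z y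
      by (simp add: a_def herm_scaleR power2_eq_square)
    have h1: "2 * (1 - complex_of_real (cmod h)) \<noteq> 0" using d0 nd by (metis of_real_eq_0_iff zero_eq_power2)
    have R: "(- 1 - 1) * herm z a * herm a p' = herm z d" for z
    proof -
      have "(- 1 - 1) * herm z a * herm a p' = - (2 / (2 * (1 - of_real (cmod h)))) * (herm z d * (of_real (cmod h) - 1))"
        unfolding nd[symmetric] using key[of z p'] by (simp add: d_def herm_diff(1)[of q p' p'] qp pp)
      also have "\<dots> = herm z d" using h1 by (simp add: field_simps)
      finally show ?thesis .
    qed
    have hz: "herm (refl_phase a (- 1) z) p' = herm z q" for z
      unfolding herm_refl_phase R by (simp add: d_def herm_diff)
    have "((- 1 - 1) * herm p' a) *s a = d"
    proof -
      have "((- 1 - 1) * herm p' a) *s a = ((- 2) * herm p' d / of_real ((norm d)\<^sup>2)) *s d"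
        by (simp add: a_def herm_scaleR vec_eq_iff power2_eq_square scaleR_conv_of_real[where 'a = complex])
      also have "(- 2) * herm p' d / of_real ((norm d)\<^sup>2) = 1"
        unfolding nd using h1 by (simp add: d_def herm_diff qp pp field_simps)
      finally show ?thesis by simp
    qed
    then have "refl_phase a (- 1) p' = q" by (simp add: refl_phase_def d_def)
    moreover have "norm a = 1" using d0 by (simp add: a_def)
    moreover have "herm e a = 0" if "herm e p = 0" "herm e p' = 0" for e
      using that by (simp add: a_def d_def q_def herm_scaleR herm_diff herm_smult)
    ultimately show ?thesis using hz c by (intro that[of a "- 1" c]) (auto simp: q_def)
  qed
qed

section \<open>Uniqueness\<close>

lemma real_poly_coeffs_zero:
  fixes c :: "nat \<Rightarrow> complex"
  assumes "\<And>t::real. (\<Sum>j\<le>m. of_real t ^ j * c j) = 0" "j \<le> m"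
  shows "c j = 0"
proof -
  have "(\<Sum>j\<le>m. Re (c j) * t ^ j) = Re (\<Sum>j\<le>m. of_real t ^ j * c j)" for t :: real
    by (simp add: of_real_power[symmetric] mult.commute del: of_real_power)
  then have "\<forall>j\<le>m. Re (c j) = 0" using polyfun_eq_0[of "\<lambda>j. Re (c j)" m] assms(1) by simp
  moreover have "(\<Sum>j\<le>m. Im (c j) * t ^ j) = Im (\<Sum>j\<le>m. of_real t ^ j * c j)" for t :: real
    by (simp add: of_real_power[symmetric] mult.commute del: of_real_power)
  then have "\<forall>j\<le>m. Im (c j) = 0" using polyfun_eq_0[of "\<lambda>j. Im (c j)" m] assms(1) by simp
  ultimately show ?thesis using assms(2) by (simp add: complex_eq_iff)
qed

lemma dd_linear:
  assumes "sm UNIV F" "sm UNIV G"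
  shows "dd vs (\<lambda>x. F x + c * G x) = (\<lambda>x. dd vs F x + c * dd vs G x)"
proof (induction vs)
  case (Cons v vs)
  have s: "sm UNIV (dd vs F)" "sm UNIV (dd vs G)" using sm_dd assms by (auto simp: smooth_eq_sm)
  show ?case unfolding dd_Cons Cons dv_fun_add[OF s(1) sm_cmult[OF s(2)]] dv_fun_linear[OF bounded_linear_mult_right s(2)] ..
qed simp

text \<open>Here \<open>k\<close> plays the role of \<open>1 / (1 + q * w)\<close>: one step of the
  geometric expansion trades a factor \<open>k\<close> for a term with an additional factor
  \<open>w\<close>.\<close>

lemma geometric_step:
  fixes k :: "'a::comm_ring_1"
  assumes "k = 1 - q * w * k"
  shows "A * k ^ Suc m = A * k ^ m + (- q) * (w * A * k ^ Suc m)"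
proof -
  have "A * k ^ Suc m = A * k ^ m * k" by (simp add: mult_ac)
  also have "\<dots> = A * k ^ m * (1 - q * w * k)" using assms by (rule arg_cong)
  finally show ?thesis by (simp add: algebra_simps)
qed

text \<open>The index \<open>i0\<close> names the coordinate called \<open>z\<^sub>1\<close> in the
  overview; its unit vector is the base point \<open>e\<close>.\<close>

locale inv_op =
  fixes D :: "(complex ^ 'n::finite \<Rightarrow> real) \<Rightarrow> (complex ^ 'n \<Rightarrow> real)" and i0 :: 'n
  assumes inv: "CR_invariant_op D"
begin

section \<open>The functional at the base point\<close>

definition e where "e = (axis i0 1 :: complex ^ 'n)"

lemma e_sphere: "e \<in> sphereS"
  by (simp add: e_def sphereS_def)

lemma e_nth: "e $ j = (if j = i0 then 1 else 0)"
  by (simp add: e_def axis_def)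

lemma diffopS: "diffopS D"
  using inv by (simp add: CR_invariant_op_def)

lemma D_cong: "sm UNIV F \<Longrightarrow> (\<And>z. z \<in> sphereS \<Longrightarrow> f z = F z) \<Longrightarrow> z \<in> sphereS \<Longrightarrow> D f z = D F z"
  using diffopS unfolding diffopS_def smooth_eq_sm by blast

lemma D_linear:
  assumes "sm UNIV F" "sm UNIV G" "z \<in> sphereS"
  shows "D (\<lambda>x. F x + c * G x) z = D F z + c * D G z"
proof -
  obtain ts where ts: "\<And>F z. sm UNIV F \<Longrightarrow> z \<in> sphereS \<Longrightarrow> D F z = (\<Sum>(a, vs) \<leftarrow> ts. a z * dd vs F z)"
    using diffopS unfolding diffopS_def smooth_eq_sm by blast
  have "(\<Sum>(a, vs) \<leftarrow> ts. a z * (dd vs F z + c * dd vs G z))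
     = (\<Sum>(a, vs) \<leftarrow> ts. a z * dd vs F z) + c * (\<Sum>(a, vs) \<leftarrow> ts. a z * dd vs G z)"
    by (induction ts) (auto simp: algebra_simps)
  then show ?thesis using ts assms by (simp add: sm_add sm_cmult dd_linear)
qed

lemma D_order:
  obtains M where "\<And>F. sm UNIV F \<Longrightarrow> vanishes M e F \<Longrightarrow> D F e = 0"
proof -
  obtain ts where ts: "\<forall>(a, vs) \<in> set ts. set vs \<subseteq> Basis"
    "\<And>F. sm UNIV F \<Longrightarrow> D F e = (\<Sum>(a, vs) \<leftarrow> ts. a e * dd vs F e)"
    using diffopS e_sphere unfolding diffopS_def smooth_eq_sm by fast
  \<comment> \<open>One more than the length of the longest word of derivatives. For an empty list
    the maximum is an unspecified number, but then the sum is empty.\<close>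
  define M where "M = Suc (Max ((\<lambda>(a, vs). length vs) ` set ts))"
  have "D F e = 0" if F: "sm UNIV F" "vanishes M e F" for F
  proof -
    have "dd vs F e = 0" if "(a, vs) \<in> set ts" for a vs
    proof (rule vanishes_dd[OF F(2)])
      show "length vs < M" unfolding M_def less_Suc_eq_le
        by (rule Max_ge) (use that in force)+
      show "set vs \<subseteq> Basis" using ts(1) that by auto
    qed
    then have "(\<Sum>(a, vs) \<leftarrow> ts. a e * dd vs F e) = (\<Sum>x \<leftarrow> ts. 0)"
      by (intro arg_cong[where f = sum_list] map_cong) auto
    then show ?thesis using ts(2)[OF F(1)] by simp
  qed
  then show ?thesis using that by blast
qed

text \<open>The complex linear extension of the real functional: powers of \<open>u\<close> and
  phases call for complex functions, while \<open>D\<close> acts on real ones.\<close>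

definition ev :: "(complex ^ 'n \<Rightarrow> complex) \<Rightarrow> complex" where
  "ev F = Complex (D (\<lambda>z. Re (F z)) e) (D (\<lambda>z. Im (F z)) e)"

lemma ev_cong: "sm UNIV G \<Longrightarrow> (\<And>z. z \<in> sphereS \<Longrightarrow> F z = G z) \<Longrightarrow> ev F = ev G"
  unfolding ev_def
  using D_cong[OF sm_Re, of G "\<lambda>z. Re (F z)" e] D_cong[OF sm_Im, of G "\<lambda>z. Im (F z)" e] e_sphere by simp

lemma ev_linear:
  assumes F: "sm UNIV F" and G: "sm UNIV G"
  shows "ev (\<lambda>z. F z + c * G z) = ev F + c * ev G"
proof -
  note s = sm_Re[OF F] sm_Im[OF F] sm_Re[OF G] sm_Im[OF G]
  have "D (\<lambda>z. Re (F z + c * G z)) e = D (\<lambda>z. (Re (F z) + Re c * Re (G z)) + (- Im c) * Im (G z)) e"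
    by (simp add: algebra_simps)
  also have "\<dots> = D (\<lambda>z. Re (F z)) e + Re c * D (\<lambda>z. Re (G z)) e - Im c * D (\<lambda>z. Im (G z)) e"
    using D_linear[OF sm_add[OF s(1) sm_cmult[OF s(3), of "Re c"]] s(4) e_sphere, of "- Im c"]
      D_linear[OF s(1,3) e_sphere, of "Re c"] by simp
  finally have 1: "D (\<lambda>z. Re (F z + c * G z)) e = D (\<lambda>z. Re (F z)) e + Re c * D (\<lambda>z. Re (G z)) e - Im c * D (\<lambda>z. Im (G z)) e" .
  have "D (\<lambda>z. Im (F z + c * G z)) e = D (\<lambda>z. (Im (F z) + Re c * Im (G z)) + Im c * Re (G z)) e"
    by (simp add: algebra_simps)
  also have "\<dots> = D (\<lambda>z. Im (F z)) e + Re c * D (\<lambda>z. Im (G z)) e + Im c * D (\<lambda>z. Re (G z)) e"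
    using D_linear[OF sm_add[OF s(2) sm_cmult[OF s(4), of "Re c"]] s(3) e_sphere, of "Im c"]
      D_linear[OF s(2,4) e_sphere, of "Re c"] by simp
  finally show ?thesis using 1 by (simp add: ev_def complex_eq_iff)
qed

lemma ev_0: "ev (\<lambda>z. 0) = 0"
  using ev_linear[of "\<lambda>z. 0" "\<lambda>z. 0" 1] by (simp add: sm_const)

lemma ev_cmult: "sm UNIV F \<Longrightarrow> ev (\<lambda>z. c * F z) = c * ev F"
  using ev_linear[of "\<lambda>z. 0" F c] by (simp add: sm_const ev_0)

lemma ev_add: "sm UNIV F \<Longrightarrow> sm UNIV G \<Longrightarrow> ev (\<lambda>z. F z + G z) = ev F + ev G"
  using ev_linear[of F G 1] by simp

lemma ev_sum: "finite A \<Longrightarrow> (\<And>a. a \<in> A \<Longrightarrow> sm UNIV (F a)) \<Longrightarrow> ev (\<lambda>z. \<Sum>a\<in>A. F a z) = (\<Sum>a\<in>A. ev (F a))"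
proof (induction A rule: finite_induct)
  case (insert a A)
  then have "ev (\<lambda>z. F a z + (\<Sum>a\<in>A. F a z)) = ev (F a) + ev (\<lambda>z. \<Sum>a\<in>A. F a z)"
    by (intro ev_add sm_sum) auto
  then show ?case using insert by simp
qed (simp add: ev_0)

lemma ev_order:
  obtains M where "\<And>F. sm UNIV F \<Longrightarrow> vanishes M e F \<Longrightarrow> ev F = 0"
proof -
  obtain M where M: "\<And>F. sm UNIV F \<Longrightarrow> vanishes M e F \<Longrightarrow> D F e = 0" using D_order by blast
  have "ev F = 0" if "sm UNIV F" "vanishes M e F" for F
    unfolding ev_def using M[OF sm_Re[OF that(1)] vanishes_linear[OF bounded_linear_Re that]]
      M[OF sm_Im[OF that(1)] vanishes_linear[OF bounded_linear_Im that]] by (simp add: complex_eq_iff)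
  then show ?thesis using that by blast
qed

lemma ev_transform:
  fixes T :: "complex ^ ('n option) \<Rightarrow> complex ^ ('n option)"
  assumes T: "linear T" "\<And>c x. T (c *s x) = c *s T x" and L: "\<And>x. Lform (T x) = Lform x"
    and fix_e: "aff (T (lift1 e)) = e"
    and F: "sm UNIV F" and G: "sm UNIV G" "\<And>z. z \<in> sphereS \<Longrightarrow> G z = F (aff (T (lift1 z)))"
  shows "ev G = of_real (((cmod (T (lift1 e) $ None))\<^sup>2) powi (- int CARD('n))) * ev F"
proof -
  have "D (\<lambda>z. h (G z)) e = ((cmod (T (lift1 e) $ None))\<^sup>2) powi (- int CARD('n)) * D (\<lambda>z. h (F z)) e"
    if "bounded_linear h" for h :: "complex \<Rightarrow> real"
    using CR_invariant_transform[OF inv T L sm_linear_compose[OF that F] sm_linear_compose[OF that G(1)] _ e_sphere] G(2)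
    by (simp add: homog_ext_aff fix_e)
  from this[OF bounded_linear_Re] this[OF bounded_linear_Im] show ?thesis
    by (simp only: ev_def) (simp add: complex_eq_iff del: of_real_power_int)
qed

lemma ev_unitary:
  fixes U :: "complex ^ 'n \<Rightarrow> complex ^ 'n"
  assumes "linear U" "\<And>c x. U (c *s x) = c *s U x" "\<And>x. norm (U x) = norm x" "U e = e" "sm UNIV F"
  shows "ev (\<lambda>z. F (U z)) = ev F"
  using CR_invariant_unitary[OF inv assms(1-3) sm_Re[OF assms(5)] e_sphere]
    CR_invariant_unitary[OF inv assms(1-3) sm_Im[OF assms(5)] e_sphere] assms(4)
  by (simp add: ev_def)

section \<open>Powers of \<open>u\<close> under dilations and central translations\<close>

definition u :: "complex ^ 'n \<Rightarrow> complex" where "u z = 1 - z $ i0"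

lemma sm_u: "sm UNIV u"
  unfolding u_def by (intro sm_diff sm_const sm_vec_nth sm_ident open_UNIV)

lemma u_e: "u e = 0"
  by (simp add: u_def e_nth)

definition Z :: "nat \<Rightarrow> nat \<Rightarrow> complex ^ 'n \<Rightarrow> complex" where
  "Z a b z = u z ^ a * cnj (u z) ^ b"

lemma sm_Z: "sm UNIV (Z a b)"
  unfolding Z_def by (intro sm_mult sm_power sm_cnj sm_u)

definition \<gamma> :: "nat \<Rightarrow> nat \<Rightarrow> complex" where "\<gamma> a b = ev (Z a b)"

text \<open>\<open>\<kappa> x\<close> stands for \<open>1 / (1 + q x * u)\<close>, the factor by which a one-parameter group fixing \<open>e\<close> distorts \<open>u\<close>.\<close>

definition E :: "(real \<Rightarrow> complex ^ 'n \<Rightarrow> complex) \<Rightarrow> nat \<Rightarrow> nat \<Rightarrow> nat \<Rightarrow> nat \<Rightarrow> real \<Rightarrow> complex" where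
  "E \<kappa> i j k l x = ev (\<lambda>z. u z ^ i * cnj (u z) ^ j * \<kappa> x z ^ k * cnj (\<kappa> x z) ^ l)"

text \<open>Formally \<open>\<kappa> = 1 / (1 + q * u)\<close> has derivative
  \<open>- q' * u\<close> at \<open>x0\<close>. To avoid differentiating inside \<open>D\<close>,
  the factors \<open>\<kappa>\<close> are expanded one by one with \<open>geometric_step\<close>;
  each step multiplies the new term by \<open>u\<close> or \<open>cnj u\<close>, and
  \<open>ev\<close> kills everything of degree at least \<open>M\<close>. No regularity of
  \<open>\<kappa>\<close> in the parameter is assumed.\<close>

lemma E_derivative:
  assumes q0: "q x0 = 0" and q': "(q has_vector_derivative q') (at x0)"
    and k: "\<And>x. sm UNIV (\<kappa> x)" "\<And>x z. z \<in> sphereS \<Longrightarrow> \<kappa> x z * (1 + q x * u z) = 1"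
  shows "(E \<kappa> i j k l has_vector_derivative - (of_nat k * q' * \<gamma> (Suc i) j + of_nat l * cnj q' * \<gamma> i (Suc j))) (at x0)
    \<and> E \<kappa> i j k l x0 = \<gamma> i j"
proof -
  obtain M where M: "\<And>F. sm UNIV F \<Longrightarrow> vanishes M e F \<Longrightarrow> ev F = 0" using ev_order by blast
  have s: "sm UNIV (\<lambda>z. u z ^ i * cnj (u z) ^ j * \<kappa> x z ^ k * cnj (\<kappa> x z) ^ l)" for i j k l x
    by (intro sm_mult sm_power sm_cnj sm_u k)
  have v: "vanishes M e (\<lambda>z. u z ^ i * cnj (u z) ^ j * G z)" if "M \<le> i + j" "sm UNIV G" for i j G
  proof (rule vanishes_mult[OF _ that(2), where m = "i + j" and k = 0])
    show "vanishes (i + j) e (\<lambda>z. u z ^ i * cnj (u z) ^ j)"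
      by (rule vanishes_mult[OF sm_power[OF sm_u] sm_power[OF sm_cnj[OF sm_u]] vanishes_power[OF sm_u u_e] vanishes_power[OF sm_cnj[OF sm_u]]])
         (simp_all add: u_e)
  qed (use that in \<open>auto intro!: sm_mult sm_power sm_cnj sm_u\<close>)
  have top: "E \<kappa> i j k l x = 0" if "M \<le> i + j" for i j k l x
  proof -
    have "vanishes M e (\<lambda>z. u z ^ i * cnj (u z) ^ j * (\<kappa> x z ^ k * cnj (\<kappa> x z) ^ l))"
      by (rule v[OF that]) (intro sm_mult sm_power sm_cnj k)
    then have "vanishes M e (\<lambda>z. u z ^ i * cnj (u z) ^ j * \<kappa> x z ^ k * cnj (\<kappa> x z) ^ l)"
      by (simp only: mult.assoc)
    then show ?thesis unfolding E_def by (rule M[OF s])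
  qed
  have gtop: "\<gamma> i j = 0" if "M \<le> i + j" for i j
  proof -
    have "vanishes M e (\<lambda>z. u z ^ i * cnj (u z) ^ j * 1)" by (rule v[OF that]) (intro sm_const open_UNIV)
    then have "vanishes M e (Z i j)" by (simp add: Z_def[abs_def])
    then show ?thesis unfolding \<gamma>_def by (rule M[OF sm_Z])
  qed
  have E0: "E \<kappa> i j k l x0 = \<gamma> i j" for i j k l
    unfolding E_def \<gamma>_def
    by (rule ev_cong[OF sm_Z]) (use k(2)[of _ x0] in \<open>simp add: q0 Z_def\<close>)
  have rk: "E \<kappa> i j (Suc k) l x = E \<kappa> i j k l x + (- q x) * E \<kappa> (Suc i) j (Suc k) l x" for i j k l x
    unfolding E_def ev_linear[OF s s, symmetric]
  proof (rule ev_cong)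
    fix z :: "complex ^ 'n" assume z: "z \<in> sphereS"
    have "\<kappa> x z = 1 - q x * u z * \<kappa> x z" using k(2)[OF z, of x] by (simp add: algebra_simps)
    note g = geometric_step[OF this, of "u z ^ i * cnj (u z) ^ j * cnj (\<kappa> x z) ^ l" k]
    show "u z ^ i * cnj (u z) ^ j * \<kappa> x z ^ Suc k * cnj (\<kappa> x z) ^ l
      = u z ^ i * cnj (u z) ^ j * \<kappa> x z ^ k * cnj (\<kappa> x z) ^ l
        + (- q x) * (u z ^ Suc i * cnj (u z) ^ j * \<kappa> x z ^ Suc k * cnj (\<kappa> x z) ^ l)"
      by (rule box_equals[OF g]) (simp_all only: power_Suc mult_ac)
  qed (intro sm_add sm_mult sm_const sm_power sm_cnj sm_u k open_UNIV)
  have rl: "E \<kappa> i j k (Suc l) x = E \<kappa> i j k l x + (- cnj (q x)) * E \<kappa> i (Suc j) k (Suc l) x" for i j k l x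
    unfolding E_def ev_linear[OF s s, symmetric]
  proof (rule ev_cong)
    fix z :: "complex ^ 'n" assume z: "z \<in> sphereS"
    have "\<kappa> x z = 1 - q x * u z * \<kappa> x z" using k(2)[OF z, of x] by (simp add: algebra_simps)
    then have "cnj (\<kappa> x z) = cnj (1 - q x * u z * \<kappa> x z)" by simp
    then have "cnj (\<kappa> x z) = 1 - cnj (q x) * cnj (u z) * cnj (\<kappa> x z)" by simp
    note g = geometric_step[OF this, of "u z ^ i * cnj (u z) ^ j * \<kappa> x z ^ k" l]
    show "u z ^ i * cnj (u z) ^ j * \<kappa> x z ^ k * cnj (\<kappa> x z) ^ Suc l
      = u z ^ i * cnj (u z) ^ j * \<kappa> x z ^ k * cnj (\<kappa> x z) ^ l
        + (- cnj (q x)) * (u z ^ i * cnj (u z) ^ Suc j * \<kappa> x z ^ k * cnj (\<kappa> x z) ^ Suc l)"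
      by (rule box_equals[OF g]) (simp_all only: power_Suc mult_ac)
  qed (intro sm_add sm_mult sm_const sm_power sm_cnj sm_u k open_UNIV)
  define P where "P i j k l \<longleftrightarrow> (E \<kappa> i j k l has_vector_derivative
     - (of_nat k * q' * \<gamma> (Suc i) j + of_nat l * cnj q' * \<gamma> i (Suc j))) (at x0)" for i j k l
  have nq: "((\<lambda>x. - q x) has_vector_derivative - q') (at x0)"
    by (rule has_vector_derivative_minus[OF q'])
  have cq: "((\<lambda>x. - cnj (q x)) has_vector_derivative - cnj q') (at x0)"
    by (intro has_vector_derivative_minus bounded_linear.has_vector_derivative[OF bounded_linear_cnj q'])
  \<comment> \<open>The outer induction is on the number \<open>d\<close> of degrees missing to
    \<open>M\<close>, the inner one on the number \<open>k + l\<close> of factors still to be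
    expanded.\<close>
  have "P i j k l" if "M \<le> i + j + d" for d i j k l
    using that
  proof (induction d arbitrary: i j k l)
    case (0 i j k l)
    have "E \<kappa> i j k l = (\<lambda>x. 0)" using top[of i j] 0 by auto
    then show ?case using gtop[of "Suc i" j] gtop[of i "Suc j"] 0 by (simp add: P_def)
  next
    case (Suc d i j k l)
    note outer = Suc.IH Suc.prems
    show ?case
    proof (induction "k + l" arbitrary: k l)
      case (0 k l)
      have "E \<kappa> i j 0 0 = (\<lambda>x. \<gamma> i j)" by (rule ext) (simp add: E_def \<gamma>_def Z_def[abs_def])
      then show ?case using 0 by (simp add: P_def)
    next
      case (Suc m k l)
      show ?case
      proof (cases k)
        case (Suc k')
        have P1: "P i j k' l" by (rule Suc.hyps(1)) (use Suc.hyps(2) Suc in simp)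
        have P2: "P (Suc i) j (Suc k') l" by (rule outer(1)) (use outer(2) in simp)
        have "((\<lambda>x. E \<kappa> i j k' l x + (- q x) * E \<kappa> (Suc i) j (Suc k') l x) has_vector_derivative
          - (of_nat k' * q' * \<gamma> (Suc i) j + of_nat l * cnj q' * \<gamma> i (Suc j))
          + ((- q x0) * (- (of_nat (Suc k') * q' * \<gamma> (Suc (Suc i)) j + of_nat l * cnj q' * \<gamma> (Suc i) (Suc j)))
             + (- q') * E \<kappa> (Suc i) j (Suc k') l x0)) (at x0)"
          by (intro has_vector_derivative_add has_vector_derivative_mult nq P1[unfolded P_def] P2[unfolded P_def])
        moreover have "E \<kappa> i j (Suc k') l = (\<lambda>x. E \<kappa> i j k' l x + (- q x) * E \<kappa> (Suc i) j (Suc k') l x)"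
          by (rule ext, rule rk)
        ultimately show ?thesis unfolding Suc P_def E0 q0 by (simp add: algebra_simps)
      next
        case 0
        then obtain l' where l': "l = Suc l'" using Suc.hyps(2) by (cases l) auto
        have P1: "P i j k l'" by (rule Suc.hyps(1)) (use Suc.hyps(2) l' in simp)
        have P2: "P i (Suc j) k (Suc l')" by (rule outer(1)) (use outer(2) in simp)
        have "((\<lambda>x. E \<kappa> i j k l' x + (- cnj (q x)) * E \<kappa> i (Suc j) k (Suc l') x) has_vector_derivative
          - (of_nat k * q' * \<gamma> (Suc i) j + of_nat l' * cnj q' * \<gamma> i (Suc j))
          + ((- cnj (q x0)) * (- (of_nat k * q' * \<gamma> (Suc i) (Suc j) + of_nat (Suc l') * cnj q' * \<gamma> i (Suc (Suc j))))
             + (- cnj q') * E \<kappa> i (Suc j) k (Suc l') x0)) (at x0)"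
          by (intro has_vector_derivative_add has_vector_derivative_mult cq P1[unfolded P_def] P2[unfolded P_def])
        moreover have "E \<kappa> i j k (Suc l') = (\<lambda>x. E \<kappa> i j k l' x + (- cnj (q x)) * E \<kappa> i (Suc j) k (Suc l') x)"
          by (rule ext, rule rl)
        ultimately show ?thesis unfolding l' P_def E0 q0 by (simp add: algebra_simps)
      qed
    qed
  qed
  then show ?thesis using E0 unfolding P_def by (metis add.commute le_add1)
qed

text \<open>In the null coordinates \<open>p = \<zeta>\<^sub>0 + \<zeta>\<^sub>1\<close>, \<open>m = \<zeta>\<^sub>0 - \<zeta>\<^sub>1\<close> the form \<open>L\<close> is \<open>Re (p * cnj m) - \<dots>\<close>; the maps
  below are the dilations (\<open>s = 0\<close>) and the central translations (\<open>r = 1\<close>) fixing the line \<open>m = 0\<close> of \<open>e\<close>.\<close>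

definition shear :: "real \<Rightarrow> real \<Rightarrow> complex ^ ('n option) \<Rightarrow> complex ^ ('n option)" where
  "shear r s x = (let p = x $ None + x $ Some i0; m = x $ None - x $ Some i0;
      p' = of_real r * p + \<i> * of_real (s / r) * m; m' = m / of_real r in
      (\<chi> k. case k of None \<Rightarrow> (p' + m') / 2 | Some i \<Rightarrow> if i = i0 then (p' - m') / 2 else x $ Some i))"

lemma linear_shear: "linear (shear r s)"
  by (rule linearI)
     (auto simp: shear_def Let_def vec_eq_iff algebra_simps add_divide_distrib diff_divide_distrib scaleR_conv_of_real[where 'a = complex] split: option.split)

lemma shear_smult: "shear r s (c *s x) = c *s shear r s x"
  by (auto simp: shear_def Let_def vec_eq_iff algebra_simps add_divide_distrib diff_divide_distrib split: option.split)

lemma norm_sq_half_sum_diff: "(cmod ((p + m) / 2))\<^sup>2 - (cmod ((p - m) / 2))\<^sup>2 = Re (p * cnj m)"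
  unfolding cmod_power2 by (simp add: power2_eq_square field_simps)

lemma Lform_split: "Lform x = (cmod (x $ None))\<^sup>2 - (cmod (x $ Some i0))\<^sup>2 - (\<Sum>i\<in>UNIV - {i0}. (cmod (x $ Some i))\<^sup>2)"
  unfolding Lform_def by (subst sum.remove[of _ i0]) auto

lemma Lform_shear:
  assumes "r \<noteq> 0"
  shows "Lform (shear r s x) = Lform x"
proof -
  define p m where "p = x $ None + x $ Some i0" and "m = x $ None - x $ Some i0"
  define p' m' where "p' = of_real r * p + \<i> * of_real (s / r) * m" and "m' = m / of_real r"
  have T: "shear r s x $ None = (p' + m') / 2" "shear r s x $ Some i0 = (p' - m') / 2"
    "\<And>i. i \<noteq> i0 \<Longrightarrow> shear r s x $ Some i = x $ Some i"
    by (simp_all add: shear_def Let_def p'_def m'_def p_def m_def)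
  have x: "x $ None = (p + m) / 2" "x $ Some i0 = (p - m) / 2" by (simp_all add: p_def m_def)
  have mm: "m * cnj m = of_real ((cmod m)\<^sup>2)" by (simp only: complex_norm_square)
  \<comment> \<open>The central translation adds an imaginary multiple of \<open>|m|^2\<close>,
    which the real part does not see.\<close>
  have "p' * cnj m' = p * cnj m + \<i> * of_real (s / (r * r)) * (m * cnj m)"
    using assms by (simp add: p'_def m'_def field_simps)
  then have "Re (p' * cnj m') = Re (p * cnj m)" unfolding mm by simp
  then have "(cmod ((p' + m') / 2))\<^sup>2 - (cmod ((p' - m') / 2))\<^sup>2 = (cmod ((p + m) / 2))\<^sup>2 - (cmod ((p - m) / 2))\<^sup>2"
    by (simp only: norm_sq_half_sum_diff)
  moreover have "(\<Sum>i\<in>UNIV - {i0}. (cmod (shear r s x $ Some i))\<^sup>2) = (\<Sum>i\<in>UNIV - {i0}. (cmod (x $ Some i))\<^sup>2)"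
    by (rule sum.cong) (auto simp: T(3))
  ultimately show ?thesis unfolding Lform_split T x by simp
qed

text \<open>On \<open>lift1 z\<close> the null coordinates are \<open>p = 2 - u z\<close> and
  \<open>m = u z\<close>; inserted into \<open>shear r s\<close> they give this coefficient of
  \<open>u z\<close> in the new \<open>\<zeta>\<^sub>0\<close>, after a factor \<open>r\<close> is
  taken out.\<close>

definition shear_coeff :: "real \<Rightarrow> real \<Rightarrow> complex" where
  "shear_coeff r s = ((1 + \<i> * of_real s) / of_real (r\<^sup>2) - 1) / 2"

lemma shear_lift1_None:
  assumes "r \<noteq> 0"
  shows "shear r s (lift1 z) $ None = of_real r * (1 + shear_coeff r s * u z)"
  using assms by (simp add: shear_def Let_def shear_coeff_def u_def field_simps power2_eq_square)

text \<open>The new \<open>\<zeta>\<^sub>0 - \<zeta>\<^sub>1\<close> is \<open>u z / r\<close>, and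
  division by the new \<open>\<zeta>\<^sub>0\<close> gives the result. Only \<open>u\<close> itself
  occurs on the right, which is why the numbers \<open>\<gamma> a b\<close> satisfy relations among
  themselves.\<close>

lemma u_shear:
  assumes "r \<noteq> 0" "z \<in> sphereS" "k * (1 + shear_coeff r s * u z) = 1"
  shows "u (aff (shear r s (lift1 z))) = of_real (inverse (r\<^sup>2)) * (u z * k)"
proof -
  let ?N = "shear r s (lift1 z) $ None"
  have nz: "?N \<noteq> 0" using assms shear_lift1_None[OF assms(1)] by auto
  have "?N - shear r s (lift1 z) $ Some i0 = u z / of_real r"
    using assms(1) by (simp add: shear_def Let_def u_def field_simps)
  moreover have "u (aff (shear r s (lift1 z))) = (?N - shear r s (lift1 z) $ Some i0) / ?N"
    using nz by (simp add: u_def aff_def diff_divide_distrib)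
  ultimately have "u (aff (shear r s (lift1 z))) = u z / of_real r / ?N" by simp
  also have "\<dots> = of_real (inverse (r\<^sup>2)) * (u z * (1 / (1 + shear_coeff r s * u z)))"
    unfolding shear_lift1_None[OF assms(1)] using assms(1) by (simp add: field_simps power2_eq_square)
  also have "1 / (1 + shear_coeff r s * u z) = k"
    using assms(3) by (metis nonzero_eq_divide_eq mult_zero_right zero_neq_one)
  finally show ?thesis .
qed

lemma shear_kappa:
  assumes r: "r \<noteq> 0"
  obtains k where "sm UNIV k" "\<And>z. z \<in> sphereS \<Longrightarrow> k z * (1 + shear_coeff r s * u z) = 1"
proof (rule exists_reciprocal[of "\<lambda>z. 1 + shear_coeff r s * u z"])
  show "sm UNIV (\<lambda>z. 1 + shear_coeff r s * u z)" by (intro sm_add sm_const sm_cmult sm_u open_UNIV)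
  show "1 + shear_coeff r s * u z \<noteq> 0" if "z \<in> sphereS" for z
    using transform_None_nonzero[OF linear_shear Lform_shear[OF r] that] shear_lift1_None[OF r] by auto
qed (use that in blast)

text \<open>The power \<open>r ^ (2 * n)\<close> comes from the weight of the target and
  \<open>r ^ (2 * (a + b))\<close> from the factor \<open>1 / r^2\<close> in \<open>u_shear\<close>;
  both are moved to the side where the exponent is nonnegative.\<close>

lemma ev_shear:
  assumes r: "r \<noteq> 0" and k: "sm UNIV k" "\<And>z. z \<in> sphereS \<Longrightarrow> k z * (1 + shear_coeff r s * u z) = 1"
  shows "of_real (r ^ (2 * CARD('n))) * ev (\<lambda>z. u z ^ a * cnj (u z) ^ b * k z ^ a * cnj (k z) ^ b)
    = of_real (r ^ (2 * (a + b))) * \<gamma> a b"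
proof -
  let ?c = "of_real (inverse (r\<^sup>2)) :: complex"
  let ?H = "\<lambda>z. u z ^ a * cnj (u z) ^ b * k z ^ a * cnj (k z) ^ b"
  have sH: "sm UNIV ?H" by (intro sm_mult sm_power sm_cnj sm_u k)
  have fe: "aff (shear r s (lift1 e)) = e"
    using r by (simp add: vec_eq_iff aff_def shear_def Let_def e_nth)
  have Ne: "shear r s (lift1 e) $ None = of_real r" using shear_lift1_None[OF r, of s e] by (simp add: u_e)
  have "ev (\<lambda>z. ?c ^ (a + b) * ?H z) = of_real (((cmod (shear r s (lift1 e) $ None))\<^sup>2) powi (- int CARD('n))) * ev (Z a b)"
  proof (rule ev_transform[OF linear_shear shear_smult Lform_shear[OF r] fe sm_Z])
    show "sm UNIV (\<lambda>z. ?c ^ (a + b) * ?H z)" by (rule sm_cmult[OF sH])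
    show "?c ^ (a + b) * ?H z = Z a b (aff (shear r s (lift1 z)))" if z: "z \<in> sphereS" for z
      unfolding Z_def u_shear[OF r z k(2)[OF z]] by (simp add: power_add power_mult_distrib mult_ac)
  qed
  then have *: "?c ^ (a + b) * ev ?H = of_real ((r\<^sup>2) powi (- int CARD('n))) * \<gamma> a b"
    unfolding ev_cmult[OF sH] Ne by (simp add: \<gamma>_def)
  have 1: "complex_of_real (r ^ (2 * CARD('n))) * of_real ((r\<^sup>2) powi (- int CARD('n))) = 1"
  proof -
    have "r ^ (2 * CARD('n)) * ((r\<^sup>2) powi (- int CARD('n))) = 1"
      using r by (simp add: power_int_minus power_mult)
    then show ?thesis by (metis of_real_1 of_real_mult)
  qed
  have 2: "complex_of_real (r ^ (2 * (a + b))) * ?c ^ (a + b) = 1"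
  proof -
    have "r ^ (2 * (a + b)) * inverse (r\<^sup>2) ^ (a + b) = 1"
      unfolding power_mult power_inverse using r by simp
    then show ?thesis by (simp only: of_real_power[symmetric] of_real_mult[symmetric] of_real_1)
  qed
  have "of_real (r ^ (2 * CARD('n))) * ev ?H = (of_real (r ^ (2 * (a + b))) * ?c ^ (a + b)) * (of_real (r ^ (2 * CARD('n))) * ev ?H)"
    unfolding 2 by simp
  also have "\<dots> = of_real (r ^ (2 * (a + b))) * of_real (r ^ (2 * CARD('n))) * (?c ^ (a + b) * ev ?H)" by (simp only: mult_ac)
  also have "\<dots> = of_real (r ^ (2 * (a + b))) * ((of_real (r ^ (2 * CARD('n))) * of_real ((r\<^sup>2) powi (- int CARD('n)))) * \<gamma> a b)"
    unfolding * by (simp only: mult_ac)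
  finally show ?thesis unfolding 1 by simp
qed

text \<open>For \<open>r = 1\<close> the transformed monomial has the value
  \<open>\<gamma> a b\<close> for every \<open>s\<close>, so its derivative at \<open>s = 0\<close>
  vanishes. There \<open>shear_coeff\<close> has slope \<open>\<i> / 2\<close>; its conjugate has
  the opposite sign, hence the two terms balance.\<close>

lemma gamma_rel1: "of_nat a * \<gamma> (Suc a) b = of_nat b * \<gamma> a (Suc b)"
proof -
  have "\<exists>k. sm UNIV k \<and> (\<forall>z\<in>sphereS. k z * (1 + shear_coeff 1 s * u z) = 1)" for s
    using shear_kappa[of 1 s] by (metis one_neq_zero)
  then obtain \<kappa> where k: "\<And>s. sm UNIV (\<kappa> s)" "\<And>s z. z \<in> sphereS \<Longrightarrow> \<kappa> s z * (1 + shear_coeff 1 s * u z) = 1" by metis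
  have qd: "((\<lambda>s. shear_coeff 1 s) has_vector_derivative \<i> / 2) (at 0)"
    unfolding shear_coeff_def by (auto intro!: derivative_eq_intros simp: has_vector_derivative_def scaleR_conv_of_real)
  have "(E \<kappa> a b a b has_vector_derivative - (of_nat a * (\<i> / 2) * \<gamma> (Suc a) b + of_nat b * cnj (\<i> / 2) * \<gamma> a (Suc b))) (at 0)"
    using E_derivative[of "shear_coeff 1" 0 "\<i> / 2" \<kappa>, OF _ qd k] by (simp add: shear_coeff_def)
  moreover have "E \<kappa> a b a b = (\<lambda>x. \<gamma> a b)"
    unfolding E_def using ev_shear[OF one_neq_zero k] by auto
  ultimately have "- (of_nat a * (\<i> / 2) * \<gamma> (Suc a) b + of_nat b * cnj (\<i> / 2) * \<gamma> a (Suc b)) = 0"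
    using vector_derivative_unique_at has_vector_derivative_const by metis
  then have "(\<i> / 2) * (of_nat a * \<gamma> (Suc a) b - of_nat b * \<gamma> a (Suc b)) = 0"
    by (simp add: algebra_simps)
  then show ?thesis by simp
qed

text \<open>Differentiate \<open>ev_shear\<close> along the dilations at \<open>r = 1\<close>, where
  \<open>shear_coeff\<close> has slope \<open>- 1\<close>; the powers of \<open>r\<close> contribute
  \<open>2 * (a + b)\<close> and \<open>2 * n\<close>.\<close>

lemma gamma_rel2: "of_nat a * \<gamma> (Suc a) b + of_nat b * \<gamma> a (Suc b) = 2 * (of_nat (a + b) - of_nat CARD('n)) * \<gamma> a b"
proof -
  \<comment> \<open>The value at \<open>r = 0\<close> is set to 0 so that a suitable
    \<open>\<kappa>\<close> exists for every real \<open>r\<close>; the derivative is taken at 1,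
    far from it.\<close>
  let ?q = "\<lambda>r. if r = 0 then 0 else shear_coeff r 0"
  have "\<exists>k. sm UNIV k \<and> (\<forall>z\<in>sphereS. k z * (1 + ?q r * u z) = 1)" for r
  proof (cases "r = 0")
    case True
    then show ?thesis by (intro exI[of _ "\<lambda>z. 1"]) (simp add: sm_const)
  next
    case False
    then show ?thesis using shear_kappa[OF False, of 0] by (simp only: if_False) metis
  qed
  then obtain \<kappa> where k: "\<And>r. sm UNIV (\<kappa> r)" "\<And>r z. z \<in> sphereS \<Longrightarrow> \<kappa> r z * (1 + ?q r * u z) = 1" by metis
  have rd: "((\<lambda>r::real. ((1 / r\<^sup>2) - 1) / 2) has_real_derivative - 1) (at 1)"
    by (auto intro!: derivative_eq_intros)
  have "((\<lambda>r. complex_of_real (((1 / r\<^sup>2) - 1) / 2)) has_vector_derivative of_real (- 1)) (at 1)"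
    using rd by (intro has_vector_derivative_of_real) (simp add: has_real_derivative_iff_has_vector_derivative)
  then have "((\<lambda>r. shear_coeff r 0) has_vector_derivative - 1) (at 1)"
    by (simp add: shear_coeff_def)
  then have qd: "(?q has_vector_derivative - 1) (at 1)"
    by (rule has_vector_derivative_transform_within_open[of _ _ _ "{0<..}"]) auto
  define d where "d = - (of_nat a * (- 1) * \<gamma> (Suc a) b + of_nat b * cnj (- 1) * \<gamma> a (Suc b))"
  have Ed: "(E \<kappa> a b a b has_vector_derivative d) (at 1)" and E1: "E \<kappa> a b a b 1 = \<gamma> a b"
    using E_derivative[of ?q 1 "- 1" \<kappa>, OF _ qd k] unfolding d_def by (simp_all add: shear_coeff_def)
  have pw: "((\<lambda>r. complex_of_real (r ^ m)) has_vector_derivative of_nat m) (at 1)" for m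
  proof -
    have "((\<lambda>r::real. r ^ m) has_real_derivative real m) (at 1)" by (auto intro!: derivative_eq_intros)
    then have "((\<lambda>r. complex_of_real (r ^ m)) has_vector_derivative of_real (real m)) (at 1)"
      by (intro has_vector_derivative_of_real) (simp add: has_real_derivative_iff_has_vector_derivative)
    then show ?thesis by simp
  qed
  have "((\<lambda>r. of_real (r ^ (2 * CARD('n))) * E \<kappa> a b a b r) has_vector_derivative
     of_real (1 ^ (2 * CARD('n))) * d + of_nat (2 * CARD('n)) * E \<kappa> a b a b 1) (at 1)"
    by (rule has_vector_derivative_mult[OF pw Ed])
  then have "((\<lambda>r. of_real (r ^ (2 * (a + b))) * \<gamma> a b) has_vector_derivative
     of_real (1 ^ (2 * CARD('n))) * d + of_nat (2 * CARD('n)) * E \<kappa> a b a b 1) (at 1)"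
  proof (rule has_vector_derivative_transform_within_open[of _ _ _ "{0<..}"])
    show "of_real (r ^ (2 * CARD('n))) * E \<kappa> a b a b r = of_real (r ^ (2 * (a + b))) * \<gamma> a b" if "r \<in> {0<..}" for r
      unfolding E_def by (rule ev_shear[of r "\<kappa> r" 0]) (use that k(1) k(2)[of _ r] in auto)
  qed auto
  moreover have "((\<lambda>r. of_real (r ^ (2 * (a + b))) * \<gamma> a b) has_vector_derivative of_nat (2 * (a + b)) * \<gamma> a b) (at 1)"
    by (rule bounded_linear.has_vector_derivative[OF bounded_linear_mult_left pw])
  ultimately have "of_real (1 ^ (2 * CARD('n))) * d + of_nat (2 * CARD('n)) * E \<kappa> a b a b 1 = of_nat (2 * (a + b)) * \<gamma> a b"
    using vector_derivative_unique_at by metis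
  then show ?thesis unfolding E1 d_def by (simp add: algebra_simps)
qed

lemma gamma_step:
  "of_nat a * \<gamma> (Suc a) b = (of_nat (a + b) - of_nat CARD('n)) * \<gamma> a b"
  "of_nat b * \<gamma> a (Suc b) = (of_nat (a + b) - of_nat CARD('n)) * \<gamma> a b"
proof -
  have "2 * (of_nat a * \<gamma> (Suc a) b) = 2 * ((of_nat (a + b) - of_nat CARD('n)) * \<gamma> a b)"
    using gamma_rel2[of a b] unfolding gamma_rel1[symmetric] by (simp only: mult_2[symmetric] mult.assoc)
  then show "of_nat a * \<gamma> (Suc a) b = (of_nat (a + b) - of_nat CARD('n)) * \<gamma> a b"
    by (simp only: mult_cancel_left) simp
  then show "of_nat b * \<gamma> a (Suc b) = (of_nat (a + b) - of_nat CARD('n)) * \<gamma> a b"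
    by (simp only: gamma_rel1)
qed

text \<open>With \<open>a = 0\<close> the left side of the first relation vanishes, which settles
  \<open>\<gamma> 0 b\<close> for \<open>b \<noteq> n\<close>. The exceptional
  \<open>\<gamma> 0 n\<close> is reached from \<open>\<gamma> 0 (n - 1)\<close> with the factor
  \<open>n - 1\<close>, nonzero because \<open>n \<ge> 2\<close>. Symmetrically for
  \<open>\<gamma> a 0\<close>; all other values are reached from \<open>\<gamma> 1 1\<close> with
  nonzero factors in front.\<close>

lemma gamma_zero:
  assumes n: "CARD('n) \<ge> 2" and g11: "\<gamma> 1 1 = 0"
  shows "\<gamma> a b = 0"
proof -
  have ne: "of_nat m - of_nat CARD('n) \<noteq> (0::complex)" if "m \<noteq> CARD('n)" for m
    using that by simp
  have row0: "\<gamma> 0 b = 0" for b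
  proof (cases "b = CARD('n)")
    case True
    then obtain c where c: "b = Suc c" "c \<noteq> 0" using n True by (intro that[of "b - 1"]) linarith+
    have "\<gamma> 0 c = 0" using gamma_step(1)[of 0 c] ne[of c] True c by auto
    then show ?thesis using gamma_step(2)[of c 0] c by simp
  next
    case False
    then show ?thesis using gamma_step(1)[of 0 b] ne[of b] by auto
  qed
  have col0: "\<gamma> a 0 = 0" for a
  proof (cases "a = CARD('n)")
    case True
    then obtain c where c: "a = Suc c" "c \<noteq> 0" using n True by (intro that[of "a - 1"]) linarith+
    have "\<gamma> c 0 = 0" using gamma_step(2)[of 0 c] ne[of c] True c by auto
    then show ?thesis using gamma_step(1)[of c 0] c by simp
  next
    case False
    then show ?thesis using gamma_step(2)[of 0 a] ne[of a] by auto
  qed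
  have row1: "\<gamma> 1 b = 0" for b
  proof (induction b)
    case (Suc b)
    show ?case
    proof (cases "b = 0")
      case False
      then show ?thesis using gamma_step(2)[of b 1] Suc by simp
    qed (use g11 in simp)
  qed (rule col0)
  show ?thesis
  proof (induction a)
    case (Suc a)
    then show ?case using gamma_step(1)[of a b] row1[of b] by (cases "a = 0") auto
  qed (rule row0)
qed

section \<open>The horizontal coordinates and the unitary stabilizer\<close>

definition lform :: "complex ^ 'n \<Rightarrow> complex ^ 'n \<Rightarrow> complex" where "lform a z = herm z a"

lemma sm_lform: "sm UNIV (lform a)"
  unfolding lform_def[abs_def] herm_def by (intro sm_sum sm_mult sm_const sm_vec_nth sm_ident open_UNIV)

lemma herm_e: "herm e a = cnj (a $ i0)"
  unfolding e_def by (rule herm_axis)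

lemma ev_refl_phase:
  assumes "norm a = 1" "cmod w = 1" "a $ i0 = 0" "sm UNIV F"
  shows "ev (\<lambda>z. F (refl_phase a w z)) = ev F"
proof (rule ev_unitary[OF linear_refl_phase refl_phase_smult norm_refl_phase[OF assms(1,2)] _ assms(4)])
  show "refl_phase a w e = e" by (simp add: refl_phase_def herm_e assms(3))
qed

lemma Z_refl_phase: "a $ i0 = 0 \<Longrightarrow> Z b c (refl_phase a w z) = Z b c z"
  by (simp add: Z_def u_def refl_phase_def)

lemma phase_exists:
  assumes "j \<noteq> (k::nat)"
  obtains w where "cmod w = 1" "w ^ j * cnj w ^ k \<noteq> 1"
proof
  \<comment> \<open>Chosen so that the product of phases is \<open>cis pi = - 1\<close>.\<close>
  define t where "t = pi / (real j - real k)"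
  show "cmod (cis t) = 1" by simp
  have "cis t ^ j * cnj (cis t) ^ k = cis (real j * t - real k * t)"
    by (simp add: Complex.DeMoivre cis_cnj cis_mult)
  also have "real j * t - real k * t = pi" 
    unfolding left_diff_distrib[symmetric] using assms by (simp add: t_def)
  finally show "cis t ^ j * cnj (cis t) ^ k \<noteq> 1" by simp
qed

text \<open>Rotating the line of \<open>a\<close> by a phase \<open>w\<close> fixes \<open>e\<close>
  and \<open>Y\<close> and multiplies the integrand by \<open>w ^ j * cnj w ^ k\<close>, which can
  be made different from 1.\<close>

lemma ev_phase_zero:
  assumes a: "norm a = 1" "a $ i0 = 0" and Y: "sm UNIV Y" "\<And>w z. cmod w = 1 \<Longrightarrow> Y (refl_phase a w z) = Y z"
    and jk: "j \<noteq> k"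
  shows "ev (\<lambda>z. Y z * lform a z ^ j * cnj (lform a z) ^ k) = 0"
proof -
  obtain w where w: "cmod w = 1" "w ^ j * cnj w ^ k \<noteq> 1" using phase_exists[OF jk] .
  let ?F = "\<lambda>z. Y z * lform a z ^ j * cnj (lform a z) ^ k"
  have s: "sm UNIV ?F" by (intro sm_mult sm_power sm_cnj sm_lform Y)
  have aa: "herm a a = 1" using a by (simp add: herm_self)
  have la: "lform a (refl_phase a w z) = w * lform a z" for z
    by (simp add: lform_def herm_refl_phase aa algebra_simps)
  have "ev ?F = ev (\<lambda>z. ?F (refl_phase a w z))" by (rule ev_refl_phase[OF a(1) w(1) a(2) s, symmetric])
  also have "(\<lambda>z. ?F (refl_phase a w z)) = (\<lambda>z. (w ^ j * cnj w ^ k) * ?F z)"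
    unfolding la Y(2)[OF w(1)] by (simp add: power_mult_distrib mult_ac)
  also have "ev \<dots> = (w ^ j * cnj w ^ k) * ev ?F" by (rule ev_cmult[OF s])
  finally have "(1 - w ^ j * cnj w ^ k) * ev ?F = 0" by (simp add: algebra_simps)
  then show ?thesis using w(2) by simp
qed

definition moment :: "nat \<Rightarrow> nat \<Rightarrow> nat \<Rightarrow> complex ^ 'n \<Rightarrow> complex" where
  "moment r b c p = ev (\<lambda>z. Z b c z * lform p z ^ r * cnj (lform p z) ^ r)"

lemma sm_moment: "sm UNIV (\<lambda>z. Z b c z * lform p z ^ j * cnj (lform q z) ^ k)"
  by (intro sm_mult sm_power sm_cnj sm_lform sm_Z)

text \<open>The unitary maps fixing \<open>e\<close> carry any unit vector orthogonal to
  \<open>e\<close> to any other up to a phase \<open>t\<close>, and \<open>t\<close> drops out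
  because \<open>lform p\<close> and its conjugate occur with the same exponent.\<close>

lemma moment_unit_indep:
  assumes p: "norm p = 1" "p $ i0 = 0" and p': "norm p' = 1" "p' $ i0 = 0"
  shows "moment r b c p = moment r b c p'"
proof -
  obtain a w t where a: "norm a = 1" "cmod w = 1" "cmod t = 1"
    "\<And>z. herm (refl_phase a w z) p' = herm z (t *s p)"
    "\<And>e. herm e p = 0 \<Longrightarrow> herm e p' = 0 \<Longrightarrow> herm e a = 0"
    using exists_reflection[OF p(1) p'(1)] by metis
  have "herm e a = 0" by (rule a(5)) (simp_all add: herm_e p p')
  then have a0: "a $ i0 = 0" by (simp add: herm_e)
  have tt: "t * cnj t = 1" using complex_norm_square[of t] a(3) by simp
  have "moment r b c p' = ev (\<lambda>z. Z b c (refl_phase a w z) * lform p' (refl_phase a w z) ^ r * cnj (lform p' (refl_phase a w z)) ^ r)"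
    unfolding moment_def by (rule ev_refl_phase[OF a(1,2) a0 sm_moment, symmetric])
  also have "(\<lambda>z. Z b c (refl_phase a w z) * lform p' (refl_phase a w z) ^ r * cnj (lform p' (refl_phase a w z)) ^ r)
    = (\<lambda>z. Z b c z * lform p z ^ r * cnj (lform p z) ^ r)"
  proof
    fix z
    have "lform p' (refl_phase a w z) = cnj t * lform p z" by (simp add: lform_def a(4) herm_smult)
    then have "lform p' (refl_phase a w z) ^ r * cnj (lform p' (refl_phase a w z)) ^ r = (t * cnj t) ^ r * (lform p z ^ r * cnj (lform p z) ^ r)"
      by (simp add: power_mult_distrib mult_ac)
    then show "Z b c (refl_phase a w z) * lform p' (refl_phase a w z) ^ r * cnj (lform p' (refl_phase a w z)) ^ r
      = Z b c z * lform p z ^ r * cnj (lform p z) ^ r"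
      by (simp add: tt Z_refl_phase[OF a0] mult.assoc)
  qed
  finally show ?thesis by (simp add: moment_def)
qed

lemma moment_smult: "moment r b c (t *s p) = of_real ((cmod t)\<^sup>2 ^ r) * moment r b c p"
proof -
  have "(\<lambda>z. Z b c z * lform (t *s p) z ^ r * cnj (lform (t *s p) z) ^ r)
    = (\<lambda>z. of_real ((cmod t)\<^sup>2 ^ r) * (Z b c z * lform p z ^ r * cnj (lform p z) ^ r))"
    unfolding of_real_power[of "(cmod t)\<^sup>2"] complex_norm_square
    by (simp add: lform_def herm_smult power_mult_distrib mult_ac)
  then show ?thesis unfolding moment_def ev_cmult[OF sm_moment, symmetric] by simp
qed

lemma norm_axis_add: "i \<noteq> j \<Longrightarrow> (norm (axis i 1 + t *\<^sub>R axis j 1 :: complex ^ 'n))\<^sup>2 = 1 + t\<^sup>2"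
  unfolding power2_norm_eq_inner
  by (simp add: inner_add_left inner_add_right inner_axis_axis power2_eq_square)

text \<open>Compare powers of \<open>t\<close> in the moment of
  \<open>axis i 1 + t *\<^sub>R axis j 1\<close>. It equals \<open>(1 + t^2) ^ r\<close> times the
  moment of \<open>axis i 1\<close>; in the direct expansion phases kill all terms with unequal
  exponents, leaving the squared binomial coefficient at \<open>t ^ (2 * k)\<close>.\<close>

lemma moment_mixed:
  assumes ij: "i \<noteq> j" "i \<noteq> i0" "j \<noteq> i0" and k: "k \<le> r"
  shows "of_nat (r choose k) * ev (\<lambda>z. Z b c z * (z $ i) ^ (r - k) * (z $ j) ^ k * cnj (z $ i) ^ (r - k) * cnj (z $ j) ^ k)
    = moment r b c (axis i 1)"
proof -
  let ?M = "\<lambda>k m z. Z b c z * (z $ i) ^ (r - k) * (z $ j) ^ k * cnj (z $ i) ^ (r - m) * cnj (z $ j) ^ m"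
  have sM: "sm UNIV (?M k m)" for k m
    by (intro sm_mult sm_power sm_cnj sm_Z sm_vec_nth sm_ident open_UNIV)
  have nj: "norm (axis j 1 :: complex ^ 'n) = 1" by simp
  have off: "ev (?M k m) = 0" if "k \<noteq> m" for k m
  proof -
    have "ev (\<lambda>z. (Z b c z * (z $ i) ^ (r - k) * cnj (z $ i) ^ (r - m)) * lform (axis j 1) z ^ k * cnj (lform (axis j 1) z) ^ m) = 0"
    proof (rule ev_phase_zero[OF nj _ _ _ that])
      show "axis j (1::complex) $ i0 = 0" using ij by (simp add: axis_def)
      show "sm UNIV (\<lambda>z. Z b c z * (z $ i) ^ (r - k) * cnj (z $ i) ^ (r - m))"
        by (intro sm_mult sm_power sm_cnj sm_Z sm_vec_nth sm_ident open_UNIV)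
      have "refl_phase (axis j 1) w z $ i = z $ i" for w and z :: "complex ^ 'n"
        using ij by (simp add: refl_phase_def axis_def)
      then show "Z b c (refl_phase (axis j 1) w z) * refl_phase (axis j 1) w z $ i ^ (r - k) * cnj (refl_phase (axis j 1) w z $ i) ^ (r - m)
        = Z b c z * (z $ i) ^ (r - k) * cnj (z $ i) ^ (r - m)" for w z
        using Z_refl_phase[of "axis j 1" b c w z] ij by (simp add: axis_def)
    qed
    then show ?thesis by (simp add: lform_def herm_axis mult_ac)
  qed
  have key: "(\<Sum>k\<le>r. of_real (t ^ 2) ^ k * (of_nat (r choose k) * (of_nat (r choose k) * ev (?M k k) - moment r b c (axis i 1)))) = 0" for t :: real
  proof -
    define p :: "complex ^ 'n" where "p = axis i 1 + t *\<^sub>R axis j 1"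
    define c0 where "c0 = inverse (norm p)"
    have np: "(norm p)\<^sup>2 = 1 + t\<^sup>2" unfolding p_def by (rule norm_axis_add[OF ij(1)])
    have p0: "norm p \<noteq> 0" using np by (metis add_pos_nonneg less_irrefl zero_le_power2 zero_less_one zero_power2)
    have pu: "norm (of_real c0 *s p) = 1"
    proof -
      have "of_real c0 *s p = c0 *\<^sub>R p" by (simp add: vec_eq_iff scaleR_conv_of_real[where 'a = complex])
      then show ?thesis using p0 by (simp add: c0_def)
    qed
    have pi0: "(of_real c0 *s p) $ i0 = 0" using ij by (simp add: p_def axis_def)
    have "moment r b c (axis i 1) = moment r b c (of_real c0 *s p)"
      by (rule moment_unit_indep[OF _ _ pu pi0]) (simp, use ij in \<open>simp add: axis_def\<close>)
    also have "\<dots> = of_real ((c0\<^sup>2) ^ r) * moment r b c p" by (simp add: moment_smult)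
    finally have "of_real ((1 + t\<^sup>2) ^ r) * moment r b c (axis i 1) = of_real ((1 + t\<^sup>2) ^ r * (c0\<^sup>2) ^ r) * moment r b c p" by simp
    also have "(1 + t\<^sup>2) ^ r * (c0\<^sup>2) ^ r = 1"
      unfolding np[symmetric] power_mult_distrib[symmetric] c0_def using p0 by simp
    finally have 1: "of_real ((1 + t\<^sup>2) ^ r) * moment r b c (axis i 1) = moment r b c p" by simp
    have lp: "lform p z = of_real t * z $ j + z $ i" for z
      by (simp add: lform_def p_def herm_add herm_scaleR herm_axis)
    have "(\<lambda>z. Z b c z * lform p z ^ r * cnj (lform p z) ^ r)
      = (\<lambda>z. \<Sum>k\<le>r. \<Sum>m\<le>r. (of_nat (r choose k) * of_nat (r choose m) * of_real t ^ (k + m)) * ?M k m z)"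
    proof
      fix z
      have "cnj (lform p z) = of_real t * cnj (z $ j) + cnj (z $ i)" by (simp add: lp)
      then have "Z b c z * lform p z ^ r * cnj (lform p z) ^ r = Z b c z
        * (\<Sum>k\<le>r. of_nat (r choose k) * (of_real t * z $ j) ^ k * (z $ i) ^ (r - k))
        * (\<Sum>m\<le>r. of_nat (r choose m) * (of_real t * cnj (z $ j)) ^ m * cnj (z $ i) ^ (r - m))"
        by (simp only: lp binomial_ring)
      also have "\<dots> = (\<Sum>k\<le>r. \<Sum>m\<le>r. (of_nat (r choose k) * of_nat (r choose m) * of_real t ^ (k + m)) * ?M k m z)"
        unfolding mult.assoc[of "Z b c z"] sum_product unfolding sum_distrib_left
        by (intro sum.cong refl) (simp add: power_mult_distrib power_add mult_ac)
      finally show "Z b c z * lform p z ^ r * cnj (lform p z) ^ r = (\<Sum>k\<le>r. \<Sum>m\<le>r. (of_nat (r choose k) * of_nat (r choose m) * of_real t ^ (k + m)) * ?M k m z)" .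
    qed
    then have "moment r b c p = ev (\<lambda>z. \<Sum>k\<le>r. \<Sum>m\<le>r. (of_nat (r choose k) * of_nat (r choose m) * of_real t ^ (k + m)) * ?M k m z)"
      by (simp add: moment_def)
    also have "\<dots> = (\<Sum>k\<le>r. ev (\<lambda>z. \<Sum>m\<le>r. (of_nat (r choose k) * of_nat (r choose m) * of_real t ^ (k + m)) * ?M k m z))"
      by (rule ev_sum) (auto intro!: sm_sum sm_cmult sM)
    also have "\<dots> = (\<Sum>k\<le>r. \<Sum>m\<le>r. (of_nat (r choose k) * of_nat (r choose m) * of_real t ^ (k + m)) * ev (?M k m))"
    proof (rule sum.cong[OF refl])
      fix k
      show "ev (\<lambda>z. \<Sum>m\<le>r. (of_nat (r choose k) * of_nat (r choose m) * of_real t ^ (k + m)) * ?M k m z)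
        = (\<Sum>m\<le>r. (of_nat (r choose k) * of_nat (r choose m) * of_real t ^ (k + m)) * ev (?M k m))"
        unfolding ev_cmult[OF sM, symmetric] by (rule ev_sum) (auto intro!: sm_cmult sM)
    qed
    also have "\<dots> = (\<Sum>k\<le>r. \<Sum>m\<le>r. if m = k then of_real (t ^ 2) ^ k * (of_nat (r choose k) * (of_nat (r choose k) * ev (?M k k))) else 0)"
    proof (intro sum.cong refl)
      fix k m
      show "(of_nat (r choose k) * of_nat (r choose m) * of_real t ^ (k + m)) * ev (?M k m)
        = (if m = k then of_real (t ^ 2) ^ k * (of_nat (r choose k) * (of_nat (r choose k) * ev (?M k k))) else 0)"
      proof (cases "m = k")
        case True
        have "complex_of_real t ^ (k + k) = of_real (t ^ 2) ^ k"
          by (simp add: power_mult[symmetric] mult_2)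
        then show ?thesis using True by simp
      next
        case False
        then show ?thesis using off[of k m] by simp
      qed
    qed
    also have "\<dots> = (\<Sum>k\<le>r. of_real (t ^ 2) ^ k * (of_nat (r choose k) * (of_nat (r choose k) * ev (?M k k))))"
      by (intro sum.cong refl) (simp add: sum.delta)
    finally have 2: "moment r b c p = (\<Sum>k\<le>r. of_real (t ^ 2) ^ k * (of_nat (r choose k) * (of_nat (r choose k) * ev (?M k k))))" .
    have "complex_of_real ((1 + t\<^sup>2) ^ r) = (of_real (t\<^sup>2) + 1) ^ r" by (simp add: add.commute)
    also have "\<dots> = (\<Sum>k\<le>r. of_nat (r choose k) * of_real (t\<^sup>2) ^ k)" by (simp add: binomial_ring)
    finally have 3: "(\<Sum>k\<le>r. of_nat (r choose k) * of_real (t\<^sup>2) ^ k) * moment r b c (axis i 1) = moment r b c p" using 1 by simp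
    have "(\<Sum>k\<le>r. of_real (t ^ 2) ^ k * (of_nat (r choose k) * (of_nat (r choose k) * ev (?M k k) - moment r b c (axis i 1))))
      = (\<Sum>k\<le>r. of_real (t ^ 2) ^ k * (of_nat (r choose k) * (of_nat (r choose k) * ev (?M k k))))
        - (\<Sum>k\<le>r. of_nat (r choose k) * of_real (t\<^sup>2) ^ k) * moment r b c (axis i 1)"
      unfolding sum_distrib_right sum_subtractf[symmetric]
      by (intro sum.cong refl) (simp only: right_diff_distrib mult_ac)
    then show ?thesis unfolding 3 2[symmetric] by simp
  qed
  define d where "d k = of_nat (r choose k) * (of_nat (r choose k) * ev (?M k k) - moment r b c (axis i 1))" for k
  \<comment> \<open>The identity is polynomial in \<open>t^2\<close>; odd coefficients are filled
    with 0 so that it becomes a polynomial identity in all real \<open>t\<close>.\<close>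
  define d' where "d' m = (if even m then d (m div 2) else 0)" for m
  have "(\<Sum>m\<le>2 * r. of_real t ^ m * d' m) = 0" for t :: real
  proof -
    have "(\<Sum>m\<le>2 * r. of_real t ^ m * d' m) = (\<Sum>m\<in>(\<lambda>k. 2 * k) ` {..r}. of_real t ^ m * d' m)"
    proof (rule sum.mono_neutral_right)
      show "\<forall>m\<in>{..2 * r} - (\<lambda>k. 2 * k) ` {..r}. of_real t ^ m * d' m = 0"
        by (auto simp: d'_def elim!: evenE)
    qed auto
    also have "\<dots> = (\<Sum>k\<le>r. of_real (t ^ 2) ^ k * d k)"
      by (subst sum.reindex) (auto simp: inj_on_def d'_def power_mult)
    also have "\<dots> = 0" using key[of t] by (simp only: d_def)
    finally show ?thesis .
  qed
  from real_poly_coeffs_zero[OF this, of "2 * k"] k have "d k = 0" by (simp add: d'_def)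
  moreover have "of_nat (r choose k) \<noteq> (0::complex)" using k by simp
  ultimately show ?thesis by (simp add: d_def)
qed

lemma sphere_coordinates:
  assumes "z \<in> sphereS" "i \<noteq> i0"
  shows "z $ i * cnj (z $ i) + (\<Sum>j\<in>UNIV - {i0, i}. z $ j * cnj (z $ j)) = u z + cnj (u z) - u z * cnj (u z)"
proof -
  have "(\<Sum>j\<in>UNIV. z $ j * cnj (z $ j)) = herm z z" by (simp add: herm_def)
  also have "\<dots> = 1" using assms(1) by (simp add: herm_self sphereS_def)
  also have "(\<Sum>j\<in>UNIV. z $ j * cnj (z $ j)) = z $ i0 * cnj (z $ i0) + (z $ i * cnj (z $ i) + (\<Sum>j\<in>UNIV - {i0} - {i}. z $ j * cnj (z $ j)))"
    using assms(2) by (subst sum.remove[of _ i0], simp, simp, subst sum.remove[of _ i], auto)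
  also have "UNIV - {i0} - {i} = UNIV - {i0, i}" by auto
  finally show ?thesis by (simp add: u_def algebra_simps)
qed

text \<open>Contracting: on the sphere \<open>\<Sum>|z\<^sub>j|\<^sup>2\<close> over \<open>j \<noteq> i0\<close> is \<open>u + cnj u - u * cnj u\<close>, which lowers the exponent \<open>r\<close>, and
  the terms with \<open>j \<noteq> i\<close> are positive multiples of the term \<open>j = i\<close>.\<close>

lemma moment_zero:
  assumes g: "\<And>a b. \<gamma> a b = 0" and p: "norm p = 1" "p $ i0 = 0"
  shows "moment r b c p = 0"
proof -
  obtain i where i: "i \<noteq> i0"
  proof -
    have "p \<noteq> 0" using p by auto
    then obtain i where "p $ i \<noteq> 0" by (auto simp: vec_eq_iff)
    then show ?thesis using p(2) that[of i] by auto
  qed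
  have ui: "norm (axis i 1 :: complex ^ 'n) = 1" "axis i (1::complex) $ i0 = 0"
    using i by (simp, simp add: axis_def)
  have "moment r b c (axis i 1) = 0" for r b c
  proof (induction r arbitrary: b c)
    case 0
    show ?case using g by (simp add: moment_def \<gamma>_def)
  next
    case (Suc r)
    let ?G = "\<lambda>b c z. Z b c z * lform (axis i 1) z ^ r * cnj (lform (axis i 1) z) ^ r"
    let ?P = "\<lambda>j z. Z b c z * (z $ i) ^ r * (z $ j) * cnj (z $ i) ^ r * cnj (z $ j)"
    have sP: "sm UNIV (?P j)" for j
      by (intro sm_mult sm_power sm_cnj sm_Z sm_vec_nth sm_ident open_UNIV)
    have "ev (\<lambda>z. ?P i z + (\<Sum>j\<in>UNIV - {i0, i}. ?P j z)) = ev (\<lambda>z. (?G (Suc b) c z + ?G b (Suc c) z) + (- 1) * ?G (Suc b) (Suc c) z)"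
    proof (rule ev_cong)
      show "sm UNIV (\<lambda>z. (?G (Suc b) c z + ?G b (Suc c) z) + (- 1) * ?G (Suc b) (Suc c) z)"
        by (intro sm_add sm_cmult sm_moment)
      fix z :: "complex ^ 'n" assume z: "z \<in> sphereS"
      have "?P i z + (\<Sum>j\<in>UNIV - {i0, i}. ?P j z)
        = (Z b c z * (z $ i) ^ r * cnj (z $ i) ^ r) * (z $ i * cnj (z $ i) + (\<Sum>j\<in>UNIV - {i0, i}. z $ j * cnj (z $ j)))"
        by (simp add: distrib_left sum_distrib_left mult_ac)
      also have "\<dots> = (?G (Suc b) c z + ?G b (Suc c) z) + (- 1) * ?G (Suc b) (Suc c) z"
        unfolding sphere_coordinates[OF z i] by (simp add: Z_def lform_def herm_axis algebra_simps)
      finally show "?P i z + (\<Sum>j\<in>UNIV - {i0, i}. ?P j z) = (?G (Suc b) c z + ?G b (Suc c) z) + (- 1) * ?G (Suc b) (Suc c) z" .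
    qed
    also have "\<dots> = (moment r (Suc b) c (axis i 1) + moment r b (Suc c) (axis i 1)) + (- 1) * moment r (Suc b) (Suc c) (axis i 1)"
      unfolding moment_def by (simp only: ev_linear[OF sm_add[OF sm_moment sm_moment] sm_moment] ev_add[OF sm_moment sm_moment])
    also have "\<dots> = 0" by (simp add: Suc)
    also have "ev (\<lambda>z. ?P i z + (\<Sum>j\<in>UNIV - {i0, i}. ?P j z)) = ev (?P i) + (\<Sum>j\<in>UNIV - {i0, i}. ev (?P j))"
      by (simp only: ev_add[OF sP sm_sum[OF open_UNIV sP]] ev_sum[OF finite sP])
    also have "ev (?P i) = moment (Suc r) b c (axis i 1)"
      unfolding moment_def by (simp add: lform_def herm_axis mult_ac)
    also have "(\<Sum>j\<in>UNIV - {i0, i}. ev (?P j)) = (\<Sum>j\<in>UNIV - {i0, i}. moment (Suc r) b c (axis i 1) / of_nat (Suc r))"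
    proof (rule sum.cong[OF refl])
      fix j assume j: "j \<in> UNIV - {i0, i}"
      have "of_nat (Suc r) * ev (?P j) = moment (Suc r) b c (axis i 1)"
      proof -
        have "i \<noteq> j" "j \<noteq> i0" using j by auto
        from moment_mixed[OF this(1) i this(2), of 1 "Suc r" b c] show ?thesis by (simp del: of_nat_Suc)
      qed
      then show "ev (?P j) = moment (Suc r) b c (axis i 1) / of_nat (Suc r)"
        by (simp add: nonzero_eq_divide_eq mult.commute del: of_nat_Suc)
    qed
    finally have "moment (Suc r) b c (axis i 1) * (1 + of_nat (card (UNIV - {i0, i})) / of_nat (Suc r)) = 0"
      by (simp add: algebra_simps)
    moreover have "1 + of_nat (card (UNIV - {i0, i})) / of_nat (Suc r) \<noteq> (0::complex)"
    proof -
      have "0 < 1 + real (card (UNIV - {i0, i})) / real (Suc r)" by (intro add_pos_nonneg) auto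
      then have "complex_of_real (1 + real (card (UNIV - {i0, i})) / real (Suc r)) \<noteq> 0"
        unfolding of_real_eq_0_iff by linarith
      then show ?thesis by simp
    qed
    ultimately show ?case by (simp only: mult_eq_0_iff) blast
  qed
  then show ?thesis using moment_unit_indep[OF p ui] by simp
qed

text \<open>For unit \<open>p\<close>, split \<open>q\<close> into a multiple of \<open>p\<close>
  and a part \<open>q'\<close> orthogonal to \<open>p\<close>, and expand. Phases along
  \<open>p\<close> kill unequal exponents of \<open>lform p\<close>, phases along \<open>q'\<close>
  kill any remaining power of \<open>lform q'\<close>, and what is left is a moment.\<close>

lemma ev_powers_zero:
  assumes g: "\<And>a b. \<gamma> a b = 0" and i1: "i1 \<noteq> i0" and p: "p $ i0 = 0" and q: "q $ i0 = 0"
  shows "ev (\<lambda>z. Z b c z * lform p z ^ r * cnj (lform q z) ^ s) = 0"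
proof -
  have unit: "ev (\<lambda>z. Z b c z * lform p z ^ r * cnj (lform q z) ^ s) = 0" if p: "norm p = 1" "p $ i0 = 0" for p
  proof -
    define \<beta> where "\<beta> = herm q p"
    define q' where "q' = q - \<beta> *s p"
    have pp: "herm p p = 1" using p by (simp add: herm_self)
    have q'p: "herm q' p = 0" by (simp add: q'_def herm_diff herm_smult pp \<beta>_def)
    then have pq': "herm p q' = 0" using herm_cnj[of q' p] by simp
    have q'0: "q' $ i0 = 0" using q p by (simp add: q'_def)
    have lq: "cnj (lform q z) = \<beta> * cnj (lform p z) + cnj (lform q' z)" for z
      by (simp add: lform_def q'_def herm_diff herm_smult)
    let ?M = "\<lambda>k z. Z b c z * lform p z ^ r * cnj (lform p z) ^ k * cnj (lform q' z) ^ (s - k)"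
    have sM: "sm UNIV (?M k)" for k by (intro sm_mult sm_power sm_cnj sm_Z sm_lform)
    have "ev (?M k) = 0" if "k \<le> s" for k
    proof (cases "k = r")
      case False
      have "ev (\<lambda>z. (Z b c z * cnj (lform q' z) ^ (s - k)) * lform p z ^ r * cnj (lform p z) ^ k) = 0"
      proof (rule ev_phase_zero[OF p _ _ False[symmetric]])
        show "sm UNIV (\<lambda>z. Z b c z * cnj (lform q' z) ^ (s - k))" by (intro sm_mult sm_power sm_cnj sm_Z sm_lform)
        show "Z b c (refl_phase p w z) * cnj (lform q' (refl_phase p w z)) ^ (s - k) = Z b c z * cnj (lform q' z) ^ (s - k)" for w z
          by (simp add: Z_refl_phase[OF p(2)] lform_def herm_refl_phase pq')
      qed
      then show ?thesis by (simp add: mult_ac)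
    next
      case True
      show ?thesis
      proof (cases "s = k")
        case True
        then show ?thesis using moment_zero[OF g p, of r b c] \<open>k = r\<close> by (simp add: moment_def)
      next
        case False
        then have sk: "s - k \<noteq> 0" using that by simp
        show ?thesis
        proof (cases "q' = 0")
          case True
          then have "lform q' z = 0" for z by (simp add: lform_def herm_def)
          then show ?thesis using sk by (simp add: power_0_left ev_0)
        next
          case False
          define t where "t = norm q'"
          have t: "t \<noteq> 0" using False by (simp add: t_def)
          define a where "a = (1 / t) *\<^sub>R q'"
          have na: "norm a = 1" using t by (simp add: a_def t_def)
          have a0: "a $ i0 = 0" using q'0 by (simp add: a_def)
          have ap: "herm a p = 0" by (simp add: a_def herm_scaleR q'p)
          have lq': "lform q' z = of_real t * lform a z" for z using t by (simp add: a_def lform_def herm_scaleR)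
          have "ev (\<lambda>z. (Z b c z * lform p z ^ r * cnj (lform p z) ^ k) * lform a z ^ 0 * cnj (lform a z) ^ (s - k)) = 0"
          proof (rule ev_phase_zero[OF na a0])
            show "sm UNIV (\<lambda>z. Z b c z * lform p z ^ r * cnj (lform p z) ^ k)" by (rule sm_moment)
            show "Z b c (refl_phase a w z) * lform p (refl_phase a w z) ^ r * cnj (lform p (refl_phase a w z)) ^ k
              = Z b c z * lform p z ^ r * cnj (lform p z) ^ k" for w z
              by (simp add: Z_refl_phase[OF a0] lform_def herm_refl_phase ap)
            show "0 \<noteq> s - k" using sk by simp
          qed
          then have "ev (\<lambda>z. of_real t ^ (s - k) * ((Z b c z * lform p z ^ r * cnj (lform p z) ^ k) * lform a z ^ 0 * cnj (lform a z) ^ (s - k))) = 0"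
            by (subst ev_cmult) (auto intro!: sm_mult sm_power sm_cnj sm_Z sm_lform)
          then show ?thesis by (simp add: lq' power_mult_distrib mult_ac)
        qed
      qed
    qed
    note z = this
    have "(\<lambda>z. Z b c z * lform p z ^ r * cnj (lform q z) ^ s) = (\<lambda>z. \<Sum>k\<le>s. (of_nat (s choose k) * \<beta> ^ k) * ?M k z)"
      unfolding lq binomial_ring sum_distrib_left by (simp add: power_mult_distrib mult_ac)
    then have "ev (\<lambda>z. Z b c z * lform p z ^ r * cnj (lform q z) ^ s) = ev (\<lambda>z. \<Sum>k\<le>s. (of_nat (s choose k) * \<beta> ^ k) * ?M k z)" by simp
    also have "\<dots> = (\<Sum>k\<le>s. ev (\<lambda>z. (of_nat (s choose k) * \<beta> ^ k) * ?M k z))"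
      by (rule ev_sum) (auto intro!: sm_cmult sM)
    also have "\<dots> = 0" unfolding ev_cmult[OF sM] using z by (intro sum.neutral) auto
    finally show ?thesis .
  qed
  show ?thesis
  proof (cases "p = 0")
    case True
    show ?thesis
    proof (cases "r = 0")
      case True
      \<comment> \<open>A zeroth power does not see its base, so a unit vector may replace
        \<open>p = 0\<close>; \<open>i1\<close> supplies one.\<close>
      have "norm (axis i1 1 :: complex ^ 'n) = 1" "axis i1 (1::complex) $ i0 = 0"
        using i1 by (simp, simp add: axis_def)
      from unit[OF this] show ?thesis using True by simp
    next
      case False
      then show ?thesis using True by (simp add: lform_def herm_def power_0_left ev_0)
    qed
  next
    case False
    define t where "t = norm p"
    have t: "t \<noteq> 0" using False by (simp add: t_def)
    define a where "a = (1 / t) *\<^sub>R p"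
    have na: "norm a = 1" "a $ i0 = 0" using t p by (simp_all add: a_def t_def)
    have lp: "lform p z = of_real t * lform a z" for z using t by (simp add: a_def lform_def herm_scaleR)
    have "ev (\<lambda>z. of_real t ^ r * (Z b c z * lform a z ^ r * cnj (lform q z) ^ s)) = 0"
      by (subst ev_cmult[OF sm_moment]) (simp add: unit[OF na])
    then show ?thesis by (simp add: lp power_mult_distrib mult_ac)
  qed
qed

section \<open>Polarization and the reduction of all polynomials\<close>

lemma sm_prod_list: "(\<And>p. p \<in> set ps \<Longrightarrow> sm UNIV (L p)) \<Longrightarrow> sm UNIV (\<lambda>z. \<Prod>p\<leftarrow>ps. (L p z :: complex))"
  by (induction ps) (simp_all add: sm_const sm_mult)

text \<open>A functional killing \<open>Y * (L p + t * L x) ^ r\<close> for all real \<open>t\<close> kills the coefficient of \<open>t\<close>.\<close>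

lemma polarization:
  fixes L :: "complex ^ 'n \<Rightarrow> complex ^ 'n \<Rightarrow> complex"
  assumes L: "\<And>p. sm UNIV (L p)" "\<And>p x t z. L (p + t *\<^sub>R x) z = L p z + of_real t * L x z"
    and Y: "sm UNIV Y" and V: "\<And>p x t. p \<in> V \<Longrightarrow> x \<in> V \<Longrightarrow> p + t *\<^sub>R x \<in> V"
    and 0: "\<And>p r. p \<in> V \<Longrightarrow> ev (\<lambda>z. Y z * L p z ^ r) = 0"
  shows "p \<in> V \<Longrightarrow> set ps \<subseteq> V \<Longrightarrow> ev (\<lambda>z. Y z * (\<Prod>x\<leftarrow>ps. L x z) * L p z ^ m) = 0"
proof (induction ps arbitrary: p m)
  case Nil
  then show ?case using 0 by simp
next
  case (Cons x ps)
  let ?B = "\<lambda>z. Y z * (\<Prod>x\<leftarrow>ps. L x z)"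
  have sB: "sm UNIV ?B" by (intro sm_mult Y sm_prod_list L)
  have s: "sm UNIV (\<lambda>z. ?B z * L x z ^ j * L p z ^ k)" for j k by (intro sm_mult sB sm_power L)
  have "(\<Sum>j\<le>Suc m. of_real t ^ j * (of_nat (Suc m choose j) * ev (\<lambda>z. ?B z * L x z ^ j * L p z ^ (Suc m - j)))) = 0" for t :: real
  proof -
    have "0 = ev (\<lambda>z. ?B z * L (p + t *\<^sub>R x) z ^ Suc m)"
      using Cons.IH[of "p + t *\<^sub>R x" "Suc m"] Cons.prems V by simp
    also have "(\<lambda>z. ?B z * L (p + t *\<^sub>R x) z ^ Suc m)
      = (\<lambda>z. \<Sum>j\<le>Suc m. (of_real t ^ j * of_nat (Suc m choose j)) * (?B z * L x z ^ j * L p z ^ (Suc m - j)))"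
    proof
      fix z
      have "L (p + t *\<^sub>R x) z = of_real t * L x z + L p z" by (simp add: L(2))
      then show "?B z * L (p + t *\<^sub>R x) z ^ Suc m
        = (\<Sum>j\<le>Suc m. (of_real t ^ j * of_nat (Suc m choose j)) * (?B z * L x z ^ j * L p z ^ (Suc m - j)))"
        by (simp only: binomial_ring sum_distrib_left) (intro sum.cong refl, simp only: power_mult_distrib mult_ac)
    qed
    also have "ev \<dots> = (\<Sum>j\<le>Suc m. ev (\<lambda>z. (of_real t ^ j * of_nat (Suc m choose j)) * (?B z * L x z ^ j * L p z ^ (Suc m - j))))"
      by (rule ev_sum) (auto intro!: sm_cmult s)
    finally show ?thesis unfolding ev_cmult[OF s] by (simp only: mult.assoc)
  qed
  from real_poly_coeffs_zero[OF this, of 1]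
  have "of_nat (Suc m) * ev (\<lambda>z. ?B z * L x z * L p z ^ m) = 0" by (simp del: of_nat_Suc)
  then show ?case by (simp add: mult_ac del: of_nat_Suc)
qed

text \<open>The maximal complex subspace of the tangent space of the sphere at
  \<open>e\<close>.\<close>

definition horizontal :: "(complex ^ 'n) set" where "horizontal = {a. a $ i0 = 0}"

text \<open>Polarization is applied twice: to the linear factors, with a power of one conjugate
  factor carried along in \<open>Y\<close>, and then to the conjugate factors. The base vector left
  over is 0 with exponent 0.\<close>

lemma ev_products_zero:
  assumes g: "\<And>a b. \<gamma> a b = 0" and i1: "i1 \<noteq> i0" and ps: "set ps \<subseteq> horizontal" and qs: "set qs \<subseteq> horizontal"
  shows "ev (\<lambda>z. Z b c z * (\<Prod>x\<leftarrow>ps. lform x z) * (\<Prod>x\<leftarrow>qs. cnj (lform x z))) = 0"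
proof -
  have V: "p + t *\<^sub>R x \<in> horizontal" if "p \<in> horizontal" "x \<in> horizontal" for p x t using that by (simp add: horizontal_def)
  have lin: "lform (p + t *\<^sub>R x) z = lform p z + of_real t * lform x z" for p x t z by (simp add: lform_def herm_add herm_scaleR)
  have z: "0 \<in> horizontal" by (simp add: horizontal_def)
  have 1: "ev (\<lambda>z. (Z b c z * cnj (lform q z) ^ s) * (\<Prod>x\<leftarrow>ps. lform x z) * lform 0 z ^ 0) = 0" if q: "q \<in> horizontal" for q s
  proof (rule polarization[OF sm_lform lin _ V _ z ps])
    show "sm UNIV (\<lambda>z. Z b c z * cnj (lform q z) ^ s)" by (intro sm_mult sm_power sm_cnj sm_Z sm_lform)
    show "ev (\<lambda>z. (Z b c z * cnj (lform q z) ^ s) * lform p z ^ r) = 0" if "p \<in> horizontal" for p r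
      using ev_powers_zero[OF g i1, of p q b c r s] q that by (simp add: horizontal_def mult_ac)
  qed
  have "ev (\<lambda>z. (Z b c z * (\<Prod>x\<leftarrow>ps. lform x z)) * (\<Prod>x\<leftarrow>qs. cnj (lform x z)) * cnj (lform 0 z) ^ 0) = 0"
  proof (rule polarization[where L = "\<lambda>x z. cnj (lform x z)", OF sm_cnj[OF sm_lform] _ _ V _ z qs])
    show "sm UNIV (\<lambda>z. Z b c z * (\<Prod>x\<leftarrow>ps. lform x z))" by (intro sm_mult sm_Z sm_prod_list sm_lform)
    show "ev (\<lambda>z. (Z b c z * (\<Prod>x\<leftarrow>ps. lform x z)) * cnj (lform p z) ^ r) = 0" if "p \<in> horizontal" for p r
      using 1[OF that, of r] by (simp add: mult_ac)
  qed (simp add: lin)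
  then show ?thesis by simp
qed

text \<open>Every real linear function of \<open>z - e\<close> is a combination of \<open>u\<close>,
  \<open>cnj u\<close>, a horizontal \<open>lform v'\<close> and its conjugate. The induction
  distributes one such factor at a time over the exponents \<open>b\<close>, \<open>c\<close> and
  the lists \<open>ps\<close>, \<open>qs\<close>, which is why all four are generalised.\<close>

lemma ev_polynomials_zero:
  assumes g: "\<And>a b. \<gamma> a b = 0" and i1: "i1 \<noteq> i0"
  shows "set ps \<subseteq> horizontal \<Longrightarrow> set qs \<subseteq> horizontal \<Longrightarrow>
    ev (\<lambda>z. Z b c z * (\<Prod>x\<leftarrow>ps. lform x z) * (\<Prod>x\<leftarrow>qs. cnj (lform x z)) * (\<Prod>v\<leftarrow>vs. of_real ((z - e) \<bullet> v))) = 0"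
proof (induction vs arbitrary: b c ps qs)
  case Nil
  then show ?case using ev_products_zero[OF g i1] by simp
next
  case (Cons v vs)
  define v' where "v' = (\<chi> i. if i = i0 then 0 else v $ i)"
  have v': "v' \<in> horizontal" by (simp add: horizontal_def v'_def)
  let ?G = "\<lambda>b c ps qs z. Z b c z * (\<Prod>x\<leftarrow>ps. lform x z) * (\<Prod>x\<leftarrow>qs. cnj (lform x z)) * (\<Prod>v\<leftarrow>vs. of_real ((z - e) \<bullet> v))"
  have s: "sm UNIV (?G b c ps qs)" for b c ps qs
    by (intro sm_mult sm_Z sm_prod_list sm_lform sm_cnj sm_of_real sm_inner_const sm_diff sm_ident sm_const open_UNIV)
  have split: "complex_of_real ((z - e) \<bullet> v) = (1 / 2) * (- cnj (v $ i0) * u z + (- (v $ i0)) * cnj (u z) + lform v' z + cnj (lform v' z))" for z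
  proof -
    have "herm (z - e) v = - cnj (v $ i0) * u z + lform v' z"
    proof -
      have "herm (z - e) v = (z - e) $ i0 * cnj (v $ i0) + (\<Sum>i\<in>UNIV - {i0}. (z - e) $ i * cnj (v $ i))"
        unfolding herm_def by (subst sum.remove[of _ i0]) auto
      also have "(\<Sum>i\<in>UNIV - {i0}. (z - e) $ i * cnj (v $ i)) = (\<Sum>i\<in>UNIV - {i0}. z $ i * cnj (v' $ i))"
        by (rule sum.cong) (auto simp: e_nth v'_def)
      also have "\<dots> = lform v' z"
        unfolding lform_def herm_def by (subst (2) sum.remove[of _ i0]) (auto simp: v'_def)
      finally show ?thesis by (simp add: e_nth u_def algebra_simps)
    qed
    moreover have "complex_of_real ((z - e) \<bullet> v) = (1 / 2) * (herm (z - e) v + cnj (herm (z - e) v))"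
      by (simp add: complex_eq_iff Re_herm[symmetric])
    ultimately show ?thesis by simp
  qed
  have "(\<lambda>z. ?G b c ps qs z * of_real ((z - e) \<bullet> v))
    = (\<lambda>z. ((- (1 / 2) * cnj (v $ i0)) * ?G (Suc b) c ps qs z + (- (1 / 2) * (v $ i0)) * ?G b (Suc c) ps qs z)
      + ((1 / 2) * ?G b c (v' # ps) qs z + (1 / 2) * ?G b c ps (v' # qs) z))"
    unfolding split by (simp add: Z_def algebra_simps)
  then have "ev (\<lambda>z. ?G b c ps qs z * of_real ((z - e) \<bullet> v)) = 0"
    using Cons.IH[of ps qs "Suc b" c] Cons.IH[of ps qs b "Suc c"] Cons.IH[of "v' # ps" qs b c] Cons.IH[of ps "v' # qs" b c] Cons.prems v'
    by (simp only: ev_add[OF sm_add[OF sm_cmult[OF s] sm_cmult[OF s]] sm_add[OF sm_cmult[OF s] sm_cmult[OF s]]]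
        ev_add[OF sm_cmult[OF s] sm_cmult[OF s]] ev_cmult[OF s] list.set insert_subset) simp
  then show ?case by (simp add: mult_ac)
qed

text \<open>Each unfolding of \<open>taylor\<close> produces a linear factor, collected in the
  accumulator \<open>vs\<close>, until only a product of such factors and a constant remain.\<close>

lemma ev_taylor_zero:
  assumes g: "\<And>a b. \<gamma> a b = 0" and i1: "i1 \<noteq> i0"
  shows "ev (\<lambda>z. (\<Prod>v\<leftarrow>vs. of_real ((z - e) \<bullet> v)) * of_real (taylor k e F z)) = 0"
proof (induction k arbitrary: vs F)
  case 0
  have s: "sm UNIV (\<lambda>z. \<Prod>v\<leftarrow>vs. complex_of_real ((z - e) \<bullet> v))"
    by (intro sm_prod_list sm_of_real sm_inner_const sm_diff sm_ident sm_const open_UNIV)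
  have "ev (\<lambda>z. \<Prod>v\<leftarrow>vs. complex_of_real ((z - e) \<bullet> v)) = 0"
    using ev_polynomials_zero[OF g i1, of "[]" "[]" 0 0 vs] by (simp add: Z_def)
  then show ?case using ev_cmult[OF s, of "of_real (F e)"] by (simp add: mult.commute)
next
  case (Suc k)
  have "(\<lambda>z. (\<Prod>v\<leftarrow>vs. complex_of_real ((z - e) \<bullet> v)) * of_real (taylor (Suc k) e F z))
    = (\<lambda>z. \<Sum>w\<in>Basis. (\<Prod>v\<leftarrow>w # vs. of_real ((z - e) \<bullet> v)) * of_real (taylor k e (dv w F) z))"
    by (simp add: sum_distrib_left mult_ac)
  moreover have "ev (\<lambda>z. \<Sum>w\<in>Basis. (\<Prod>v\<leftarrow>w # vs. of_real ((z - e) \<bullet> v)) * of_real (taylor k e (dv w F) z))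
     = (\<Sum>w\<in>Basis. ev (\<lambda>z. (\<Prod>v\<leftarrow>w # vs. of_real ((z - e) \<bullet> v)) * of_real (taylor k e (dv w F) z)))"
    by (rule ev_sum, simp, intro sm_mult sm_prod_list sm_of_real sm_inner_const sm_diff sm_ident sm_const sm_taylor open_UNIV)
  ultimately show ?case unfolding Suc by simp
qed

text \<open>At \<open>e\<close> the operator kills the Taylor polynomials of \<open>F\<close> and,
  by finite order, the remainder. A unitary map taking \<open>e\<close> to \<open>z\<close> carries
  this to every point of the sphere.\<close>

lemma D_zero:
  assumes n: "CARD('n) \<ge> 2" and g11: "\<gamma> 1 1 = 0" and F: "sm UNIV F" and z: "z \<in> sphereS"
  shows "D F z = 0"
proof -
  note g = gamma_zero[OF n g11]
  obtain a b :: 'n where "a \<noteq> b"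
    using n card_le_Suc0_iff_eq[of "UNIV :: 'n set"] by auto
  then have "a \<noteq> i0 \<or> b \<noteq> i0" by auto
  then obtain i1 where i1: "i1 \<noteq> i0" by blast
  have De: "D G e = 0" if G: "sm UNIV G" for G
  proof -
    obtain M where M: "\<And>F. sm UNIV F \<Longrightarrow> vanishes M e F \<Longrightarrow> D F e = 0" using D_order by blast
    have t0: "D (taylor k e G) e = 0" for k
    proof -
      have "ev (\<lambda>z. of_real (taylor k e G z)) = 0" using ev_taylor_zero[OF g i1, of "[]" k G] by simp
      then have "D (\<lambda>z. Re (complex_of_real (taylor k e G z))) e = 0" by (simp add: ev_def complex_eq_iff)
      then show ?thesis by simp
    qed
    have "D (\<lambda>y. G y + (\<Sum>k<m. (- 1 / fact k) * taylor k e G y)) e = D G e" for m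
    proof (induction m)
      case (Suc m)
      have s: "sm UNIV (\<lambda>y. G y + (\<Sum>k<m. (- 1 / fact k) * taylor k e G y))"
        by (intro sm_add G sm_sum sm_cmult sm_taylor open_UNIV)
      have "D (\<lambda>y. G y + (\<Sum>k<Suc m. (- 1 / fact k) * taylor k e G y)) e
        = D (\<lambda>y. (G y + (\<Sum>k<m. (- 1 / fact k) * taylor k e G y)) + (- 1 / fact m) * taylor m e G y) e"
        by (simp add: algebra_simps)
      also have "\<dots> = D (\<lambda>y. G y + (\<Sum>k<m. (- 1 / fact k) * taylor k e G y)) e + (- 1 / fact m) * D (taylor m e G) e"
        by (rule D_linear[OF s sm_taylor e_sphere])
      finally show ?case unfolding t0 Suc by (simp only: mult_zero_right add_0_right)
    qed simp
    moreover have "D (\<lambda>y. G y + (\<Sum>k<M. (- 1 / fact k) * taylor k e G y)) e = 0"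
      by (rule M[OF _ vanishes_taylor[OF G]]) (intro sm_add G sm_sum sm_cmult sm_taylor open_UNIV)
    ultimately show ?thesis by simp
  qed
  have nz: "norm z = 1" "norm e = 1" using z e_sphere by (simp_all add: sphereS_def)
  obtain a w c where a: "norm a = 1" "cmod w = 1" "cmod c = 1" "refl_phase a w e = c *s z"
    using exists_reflection[OF nz] by metis
  \<comment> \<open>The factor \<open>cnj c\<close> cancels the phase left by
    \<open>exists_reflection\<close>, so that \<open>U e\<close> is exactly
    \<open>z\<close>.\<close>
  define U where "U x = cnj c *s refl_phase a w x" for x
  have lU: "linear U" unfolding U_def
    using linear_compose[OF linear_refl_phase[of a w] linear_smult[of "cnj c"]] by (simp add: o_def)
  have sU: "U (t *s x) = t *s U x" for t x by (simp add: U_def refl_phase_smult vec_eq_iff)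
  have nU: "norm (U x) = norm x" for x
  proof -
    have "(norm (t *s y))\<^sup>2 = (cmod t)\<^sup>2 * (norm y)\<^sup>2" for t and y :: "complex ^ 'n"
      by (simp only: power2_norm_eq_inner[of y] power2_norm_eq_inner[of "t *s y"] inner_vec_def vector_smult_component sum_distrib_left)
         (simp add: dot_square_norm norm_mult power_mult_distrib)
    then have "(norm (U x))\<^sup>2 = (norm x)\<^sup>2" by (simp add: U_def a norm_refl_phase[OF a(1,2)])
    then show ?thesis by simp
  qed
  have cc: "cnj c * c = 1" using complex_norm_square[of c] a(3) by (simp add: mult.commute)
  have Ue: "U e = z" by (simp add: U_def a(4) vec_eq_iff mult.assoc[symmetric] cc)
  have "sm UNIV (\<lambda>z. F (U z))"
    by (rule sm_compose[OF F sm_bounded_linear[OF linear_conv_bounded_linear[THEN iffD1, OF lU] open_UNIV]]) simp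
  from De[OF this] show ?thesis
    using CR_invariant_unitary[OF inv lU sU nU F e_sphere] by (simp add: Ue)
qed

end

text \<open>Used to subtract from a given operator the multiple of \<open>CR_op\<close> with the
  same value on the test function.\<close>

lemma CR_invariant_op_linear:
  fixes D D' :: "(complex ^ 'n::finite \<Rightarrow> real) \<Rightarrow> (complex ^ 'n \<Rightarrow> real)"
  assumes "CR_invariant_op D" "CR_invariant_op D'"
  shows "CR_invariant_op (\<lambda>f z. D f z + c * D' f z)"
proof -
  have d: "diffopS D" "diffopS D'" using assms by (simp_all add: CR_invariant_op_def)
  obtain ts where ts: "\<forall>(a, vs) \<in> set ts. smooth a \<and> set vs \<subseteq> Basis"
    "\<forall>F. smooth F \<longrightarrow> (\<forall>z\<in>sphereS. D F z = (\<Sum>(a, vs) \<leftarrow> ts. a z * dd vs F z))"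
    using d(1) unfolding diffopS_def by blast
  obtain ts' where ts': "\<forall>(a, vs) \<in> set ts'. smooth a \<and> set vs \<subseteq> Basis"
    "\<forall>F. smooth F \<longrightarrow> (\<forall>z\<in>sphereS. D' F z = (\<Sum>(a, vs) \<leftarrow> ts'. a z * dd vs F z))"
    using d(2) unfolding diffopS_def by blast
  define us where "us = ts @ map (\<lambda>(a, vs). (\<lambda>z. c * a z, vs)) ts'"
  have "(\<Sum>(a, vs) \<leftarrow> us. a z * dd vs F z) = (\<Sum>(a, vs) \<leftarrow> ts. a z * dd vs F z) + c * (\<Sum>(a, vs) \<leftarrow> ts'. a z * dd vs F z)" for F z
  proof -
    have "(\<Sum>(a, vs) \<leftarrow> map (\<lambda>(a, vs). (\<lambda>z. c * a z, vs)) ts'. a z * dd vs F z) = c * (\<Sum>(a, vs) \<leftarrow> ts'. a z * dd vs F z)"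
      by (induction ts') (auto simp: algebra_simps)
    then show ?thesis by (simp add: us_def)
  qed
  moreover have "\<forall>(a, vs) \<in> set us. smooth a \<and> set vs \<subseteq> Basis"
    using ts(1) ts'(1) by (fastforce simp: us_def smooth_eq_sm intro: sm_cmult)
  ultimately have "\<exists>us. (\<forall>(a, vs) \<in> set us. smooth a \<and> set vs \<subseteq> Basis) \<and>
    (\<forall>F. smooth F \<longrightarrow> (\<forall>z\<in>sphereS. D F z + c * D' F z = (\<Sum>(a, vs) \<leftarrow> us. a z * dd vs F z)))"
    using ts(2) ts'(2) by (intro exI[of _ us]) simp
  moreover have "\<forall>f F. smooth F \<and> (\<forall>z\<in>sphereS. f z = F z) \<longrightarrow> (\<forall>z\<in>sphereS. D f z + c * D' f z = D F z + c * D' F z)"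
  proof (intro allI impI ballI)
    fix f F :: "complex ^ 'n \<Rightarrow> real" and z :: "complex ^ 'n"
    assume "smooth F \<and> (\<forall>z\<in>sphereS. f z = F z)" "z \<in> sphereS"
    then have "D f z = D F z" "D' f z = D' F z" using d unfolding diffopS_def by blast+
    then show "D f z + c * D' f z = D F z + c * D' F z" by simp
  qed
  ultimately have "diffopS (\<lambda>f z. D f z + c * D' f z)" unfolding diffopS_def by blast
  moreover have "D (actE 0 g f) z + c * D' (actE 0 g f) z = actE (- int CARD('n)) g (\<lambda>z. D f z + c * D' f z) z"
    if "g \<in> SU1n" "smoothS f" "z \<in> sphereS" for g f z
    using assms that unfolding CR_invariant_op_def by (simp add: actE_def homog_ext_def algebra_simps)
  ultimately show ?thesis unfolding CR_invariant_op_def by blast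
qed

theorem mainTheorem1:
  assumes "CARD('n::finite) \<ge> 2"
  shows "\<exists>D0 :: (complex ^ 'n \<Rightarrow> real) \<Rightarrow> (complex ^ 'n \<Rightarrow> real).
           CR_invariant_op D0 \<and>
           (\<exists>f. smoothS f \<and> (\<exists>z\<in>sphereS. D0 f z \<noteq> 0)) \<and>
           (\<forall>D :: (complex ^ 'n \<Rightarrow> real) \<Rightarrow> (complex ^ 'n \<Rightarrow> real).
              CR_invariant_op D \<longrightarrow>
              (\<exists>c::real. \<forall>f. smoothS f \<longrightarrow> (\<forall>z\<in>sphereS. D f z = c * D0 f z)))"
proof -
  let ?D0 = "CR_op :: (complex ^ 'n \<Rightarrow> real) \<Rightarrow> (complex ^ 'n \<Rightarrow> real)"
  define i0 :: 'n where "i0 = undefined"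
  define p where "p = (axis i0 1 :: complex ^ 'n)"
  \<comment> \<open>The test function \<open>|u|^2 = Z 1 1\<close>: its value \<open>D f1 p\<close>
    is \<open>\<gamma> 1 1\<close>, the only free number.\<close>
  define f1 where "f1 z = (cmod (1 - z $ i0))\<^sup>2" for z :: "complex ^ 'n"
  have zero: "D f z = 0" if D: "CR_invariant_op D" and f1: "D f1 p = 0" and f: "smoothS f" and z: "z \<in> sphereS"
    for D :: "(complex ^ 'n \<Rightarrow> real) \<Rightarrow> (complex ^ 'n \<Rightarrow> real)" and f z
  proof -
    interpret inv_op D i0 using D by unfold_locales
    have Z11: "inv_op.Z i0 1 1 z = of_real (f1 z)" for z :: "complex ^ 'n"
      unfolding Z_def u_def f1_def using complex_norm_square[of "1 - z $ i0"] by simp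
    \<comment> \<open>The imaginary part of \<open>Z 1 1\<close> is the zero function, and
      \<open>ev\<close> also evaluates \<open>D\<close> on it.\<close>
    have "D (\<lambda>z. 0) e' = 0" if "e' \<in> sphereS" for e'
      using D_linear[of "\<lambda>z. 0" "\<lambda>z. 0" e' 1] that by (simp add: sm_const)
    then have "\<gamma> 1 1 = 0"
      using f1 e_sphere unfolding \<gamma>_def ev_def Z11 by (simp add: complex_eq_iff e_def p_def)
    moreover obtain F where F: "smooth F" "\<And>z. z \<in> sphereS \<Longrightarrow> f z = F z" using f unfolding smoothS_def by blast
    ultimately have "D F z = 0" using D_zero[OF assms _ _ z] by (simp add: smooth_eq_sm)
    then show ?thesis using D_cong[of F f z] F z by (simp add: smooth_eq_sm)
  qed
  obtain f0 z0 where f0: "smoothS f0" "z0 \<in> sphereS" "?D0 f0 z0 \<noteq> 0" using CR_op_nonzero[OF assms] by blast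
  \<comment> \<open>An indirect argument: if this value were zero, \<open>zero\<close> would force
    \<open>CR_op\<close> to vanish on \<open>f0\<close>.\<close>
  have d0: "?D0 f1 p \<noteq> 0" using zero[OF CR_invariant_CR_op _ f0(1,2)] f0(3) by blast
  have "\<exists>c. \<forall>f. smoothS f \<longrightarrow> (\<forall>z\<in>sphereS. D f z = c * ?D0 f z)" if D: "CR_invariant_op D"
    for D :: "(complex ^ 'n \<Rightarrow> real) \<Rightarrow> (complex ^ 'n \<Rightarrow> real)"
  proof (intro exI allI impI ballI)
    define c where "c = D f1 p / ?D0 f1 p"
    fix f :: "complex ^ 'n \<Rightarrow> real" and z :: "complex ^ 'n"
    assume f: "smoothS f" and z: "z \<in> sphereS"
    have "D f z + (- c) * ?D0 f z = 0"
      by (rule zero[OF CR_invariant_op_linear[OF D CR_invariant_CR_op] _ f z]) (use d0 in \<open>simp add: c_def\<close>)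
    then show "D f z = D f1 p / ?D0 f1 p * ?D0 f z" by (simp add: c_def)
  qed
  then show ?thesis using CR_invariant_CR_op f0 by blast
qed

end
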